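(* Let $\{\varepsilon_n\}_n,\{\delta_n\}_n$ be infinitesimal sequences (positive, converging to $0$) such that $\lim_{n\to\infty}\frac{\delta_n}{\varepsilon_n}=0$. Let $\{u_n\}_n\subset L^1(\Omega;\mathbb{R}^M)$ be such that $\sup_{n\in\mathbb{N}}\mathcal{E}_n(u_n)<\infty$. Then there exist $u\in BV(\Omega;\{a,b\})$ and a subsequence $\{u_{n_k}\}_k$ such that $u_{n_k}\to u$ strongly in $L^1(\Omega;\mathbb{R}^M)$.
   Context: Let $N,M\ge 1$, let $\Omega\subset\mathbb{R}^N$ be a bounded open set, and $Q:=(-1/2,1/2)^N$. The measurable function $W:\mathbb{R}^N\times\mathbb{R}^M\to[0,+\infty)$ satisfies: (W1) $z\mapsto W(x,z)$ is continuous for $\mathcal{L}^N$-a.e. $x\in Q$, and $x\mapsto W(x,z)$ is measurable and $Q$-periodic for all $z\in\mathbb{R}^M$; (W2) there are $a,b\in\mathbb{R}^M$ such that $W(x,z)=0$ if and only if $z\in\{a,b\}$; (W3) there exists $R>0$ such that for $\mathcal{L}^N$-a.e. $x\in Q$, $W(x,z)\ge \frac1R|z|$ whenever $|z|\ge R$; (W4) for every $K>0$ there is a constant $C_K>0$, depending only on $K$, such that $\operatorname{ess\,sup}_{x\in Q,\,|z|\le K}W(x,z)\le C_K$. The functional $\mathcal{E}_n:L^1(\Omega;\mathbb{R}^M)\to[0,+\infty]$ is defined by $$\mathcal{E}_n(u):=\int_\Omega\Big[\frac1{\varepsilon_n}W\Big(\frac{x}{\delta_n},u(x)\Big)+\varepsilon_n|\nabla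 u(x)|^2\Big]dx$$ if $u\in W^{1,2}(\Omega;\mathbb{R}^M)$, and $\mathcal{E}_n(u):=+\infty$ otherwise. $BV(\Omega;\{a,b\})$ is the space of $u\in L^1(\Omega;\mathbb{R}^M)$ with $u(x)\in\{a,b\}$ for a.e. $x\in\Omega$ and such that $\{x\in\Omega:u(x)=a\}$ has finite perimeter in $\Omega$. *)

theory Defs
  imports "HOL-Probability.Essential_Supremum"
begin

definition partial :: "'n::finite \<Rightarrow> (real^'n \<Rightarrow> 'b::real_normed_vector) \<Rightarrow> real^'n \<Rightarrow> 'b"
  where "partial i \<phi> x = frechet_derivative \<phi> (at x) (axis i 1)"

(* C_c^1(\<Omega>), as functions on the whole space that vanish outside a compact subset of \<Omega> *)
definition C1c :: "(real^'n::finite) set \<Rightarrow> (real^'n \<Rightarrow> 'b::real_normed_vector) set"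
  where "C1c \<Omega> = {\<phi>. (\<forall>x. \<phi> differentiable (at x)) \<and>
                   (\<forall>i. continuous_on UNIV (partial i \<phi>)) \<and>
                   compact (closure {x. \<phi> x \<noteq> 0}) \<and> closure {x. \<phi> x \<noteq> 0} \<subseteq> \<Omega>}"

definition divergence :: "(real^'n::finite \<Rightarrow> real^'n) \<Rightarrow> real^'n \<Rightarrow> real"
  where "divergence \<phi> x = (\<Sum>i\<in>UNIV. partial i \<phi> x $ i)"

definition locally_integrable_on ::
    "(real^'n::finite) set \<Rightarrow> (real^'n \<Rightarrow> 'b::{banach, second_countable_topology}) \<Rightarrow> bool"
  where "locally_integrable_on \<Omega> f \<longleftrightarrow>
           (\<forall>K. compact K \<and> K \<subseteq> \<Omega> \<longrightarrow> integrable (lebesgue_on K) f)"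

(* Row j of the matrix G x is the weak gradient of the j-th component of u.  The test functions
   are C_c^1, as in Evans and Gariepy, "Measure Theory and Fine Properties of Functions". *)
definition has_weak_gradient ::
    "(real^'n::finite) set \<Rightarrow> (real^'n \<Rightarrow> real^'m::finite) \<Rightarrow> (real^'n \<Rightarrow> real^'n^'m) \<Rightarrow> bool"
  where "has_weak_gradient \<Omega> u G \<longleftrightarrow>
           locally_integrable_on \<Omega> u \<and> locally_integrable_on \<Omega> G \<and>
           (\<forall>\<phi>\<in>C1c \<Omega>. \<forall>i j. (LINT x|lebesgue_on \<Omega>. u x $ j * partial i \<phi> x)
                             = - (LINT x|lebesgue_on \<Omega>. G x $ j $ i * \<phi> x))"

(* A weak gradient is determined only up to null sets; this picks a representative. *)
definition weak_gradient ::
    "(real^'n::finite) set \<Rightarrow> (real^'n \<Rightarrow> real^'m::finite) \<Rightarrow> real^'n \<Rightarrow> real^'n^'m"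
  where "weak_gradient \<Omega> u = (SOME G. has_weak_gradient \<Omega> u G)"

definition L1_space :: "(real^'n::finite) set \<Rightarrow> (real^'n \<Rightarrow> 'b::{banach, second_countable_topology}) set"
  where "L1_space \<Omega> = {f. integrable (lebesgue_on \<Omega>) f}"

definition L2_space :: "(real^'n::finite) set \<Rightarrow> (real^'n \<Rightarrow> 'b::{banach, second_countable_topology}) set"
  where "L2_space \<Omega> = {f \<in> borel_measurable (lebesgue_on \<Omega>).
                         integrable (lebesgue_on \<Omega>) (\<lambda>x. (norm (f x))\<^sup>2)}"

definition W12_space :: "(real^'n::finite) set \<Rightarrow> (real^'n \<Rightarrow> real^'m::finite) set"
  where "W12_space \<Omega> = {u \<in> L2_space \<Omega>. \<exists>G \<in> L2_space \<Omega>. has_weak_gradient \<Omega> u G}"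

(* The norm on real^'n^'m is the Frobenius norm. *)
definition energy ::
    "(real^'n::finite \<Rightarrow> real^'m::finite \<Rightarrow> real) \<Rightarrow> (real^'n) set \<Rightarrow> real \<Rightarrow> real \<Rightarrow> (real^'n \<Rightarrow> real^'m) \<Rightarrow> ennreal"
  where "energy W \<Omega> \<epsilon> \<delta> u =
           (if u \<in> W12_space \<Omega>
            then \<integral>\<^sup>+x. ennreal (1 / \<epsilon> * W (x /\<^sub>R \<delta>) (u x)
                                 + \<epsilon> * (norm (weak_gradient \<Omega> u x))\<^sup>2) \<partial>lebesgue_on \<Omega>
            else \<infinity>)"

definition perimeter :: "(real^'n::finite) set \<Rightarrow> (real^'n) set \<Rightarrow> ereal"
  where "perimeter E \<Omega> = (SUP \<phi> \<in> {\<phi> \<in> C1c \<Omega>. \<forall>x. norm (\<phi> x) \<le> 1}.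
                            ereal (LINT x|lebesgue_on (E \<inter> \<Omega>). divergence \<phi> x))"

definition finite_perimeter :: "(real^'n::finite) set \<Rightarrow> (real^'n) set \<Rightarrow> bool"
  where "finite_perimeter E \<Omega> \<longleftrightarrow> E \<inter> \<Omega> \<in> sets lebesgue \<and> perimeter E \<Omega> < \<infinity>"

definition BV_two_phase ::
    "(real^'n::finite) set \<Rightarrow> real^'m::finite \<Rightarrow> real^'m \<Rightarrow> (real^'n \<Rightarrow> real^'m) set"
  where "BV_two_phase \<Omega> a b =
           {u \<in> L1_space \<Omega>. (AE x in lebesgue_on \<Omega>. u x \<in> {a, b}) \<and>
                            finite_perimeter {x \<in> \<Omega>. u x = a} \<Omega>}"

definition unit_cube :: "(real^'n::finite) set"
  where "unit_cube = {x. \<forall>i. - 1 / 2 < x $ i \<and> x $ i < 1 / 2}"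

definition cube_periodic :: "(real^'n::finite \<Rightarrow> 'b) \<Rightarrow> bool"
  where "cube_periodic f \<longleftrightarrow> (\<forall>x i. f (x + axis i 1) = f x)"

end

theory Submission
  imports Defs "HOL-Library.Diagonal_Subsequence"
begin

text \<open>
  Only three facts about the sequence are used. First, a function with weak gradient \<open>G\<close> satisfies
  \<open>\<integral>\<bar>u (x + h) - u x\<bar>\<^sup>2 \<le> \<bar>h\<bar>\<^sup>2 \<integral>\<bar>G\<bar>\<^sup>2\<close> away from the boundary. Second, \<open>W x\<close> is bounded below off any
  neighbourhood of the wells for \<open>x\<close> in a compact set of positive measure, extended periodically.
  Averaging over translations of length comparable to \<open>\<delta>\<close>, whose cost is controlled by the first fact
  because \<open>\<delta> \<le> \<epsilon>\<close> eventually, shows that \<open>u\<close> is away from the wells only on a set of measure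
  \<open>O(\<epsilon>)\<close>. Third, for a Lipschitz cutoff \<open>g\<close> equal to \<open>1\<close> near \<open>a\<close> and to \<open>0\<close> near \<open>b\<close>, splitting a
  translation into steps no longer than \<open>\<epsilon>\<close> gives \<open>\<integral>\<bar>g (u (x + h)) - g (u x)\<bar> \<le> C \<bar>h\<bar>\<close>, uniformly along
  the sequence. This estimate yields \<open>L\<^sup>1\<close> compactness of \<open>g \<circ> u\<close> and, in the limit, finite
  perimeter, while the linear growth of \<open>W\<close> prevents concentration of mass.
\<close>

section \<open>Interior parts and translations\<close>

text \<open>On a set \<open>K\<close> of positive measure the constant is uniform, and fast
  oscillation does the rest: from every point, a fixed amount of the displacements
  \<open>\<delta> h\<close>, with \<open>h\<close> in a fixed ball, leads into the rescaled periodic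
  copies of \<open>K\<close>. Such a displacement changes \<open>u\<close> by \<open>s/2\<close> or
  more on a set of measure at most a multiple of \<open>\<delta>\<^sup>2 / \<epsilon>\<close>, and
  this is where the relation between the two scales enters. The gradient acts through finite
  differences alone. A step \<open>k\<close> no longer than \<open>\<epsilon>\<close> has quadratic
  cost \<open>\<bar>k\<bar>\<^sup>2 E / \<epsilon>\<close>, at most \<open>\<bar>k\<bar> E\<close>,
  so the costs of the steps add up to a bound linear in the whole displacement. Nothing is estimated
  near the boundary; the layer outside \<open>inner_part \<Omega> t\<close> enters through its small
  measure.\<close>

definition inner_part :: "'a::euclidean_space set \<Rightarrow> real \<Rightarrow> 'a set"
  where "inner_part \<Omega> t = {x. cball x t \<subseteq> \<Omega>}"

lemma inner_part_subset: "0 \<le> t \<Longrightarrow> inner_part \<Omega> t \<subseteq> \<Omega>"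
  by (auto simp: inner_part_def subset_iff)

lemma inner_part_antimono: "s \<le> t \<Longrightarrow> inner_part \<Omega> t \<subseteq> inner_part \<Omega> s"
  by (auto simp: inner_part_def subset_iff)

lemma inner_part_add:
  assumes "x \<in> inner_part \<Omega> t" "norm h + s \<le> t"
  shows "x + h \<in> inner_part \<Omega> s"
proof -
  have "cball (x + h) s \<subseteq> cball x t"
    using assms(2) by (intro cball_subset_cball_iff[THEN iffD2] disjI1) (simp add: dist_norm)
  then show ?thesis using assms(1) by (auto simp: inner_part_def)
qed

text \<open>The compact ball around \<open>x\<close> and the closed complement of
  \<open>\<Omega>\<close> are separated by a gap \<open>d\<close>. A point \<open>z\<close> of the
  ball around \<open>y\<close> is moved into the ball around \<open>x\<close> by
  \<open>x - y\<close>, so if \<open>z\<close> were outside \<open>\<Omega>\<close> the gap would be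
  at most \<open>dist y x\<close>.\<close>

lemma open_inner_part:
  assumes "open \<Omega>" shows "open (inner_part \<Omega> t)"
  unfolding open_dist
proof
  fix x assume x: "x \<in> inner_part \<Omega> t"
  have "cball x t \<inter> - \<Omega> = {}" using x by (auto simp: inner_part_def)
  then obtain d where d: "d > 0" "\<And>p q. p \<in> cball x t \<Longrightarrow> q \<in> - \<Omega> \<Longrightarrow> d \<le> dist p q"
    using separate_compact_closed[of "cball x t" "- \<Omega>"] assms by (auto simp: closed_Compl)
  show "\<exists>e>0. \<forall>y. dist y x < e \<longrightarrow> y \<in> inner_part \<Omega> t"
  proof (intro exI[of _ d] conjI allI impI d(1))
    fix y assume y: "dist y x < d"
    have "z \<in> \<Omega>" if "z \<in> cball y t" for z
    proof (rule ccontr)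
      assume "z \<notin> \<Omega>"
      then have "d \<le> dist (z + (x - y)) z"
        using that by (intro d(2)) (auto simp: dist_norm algebra_simps)
      then show False using y by (simp add: dist_norm norm_minus_commute)
    qed
    then show "y \<in> inner_part \<Omega> t" by (auto simp: inner_part_def)
  qed
qed

lemma borel_inner_part [measurable]: "open \<Omega> \<Longrightarrow> inner_part \<Omega> t \<in> sets borel"
  by (simp add: open_inner_part)

text \<open>Openness makes the layers decrease to the empty set, and finite measure turns this into
  convergence of measures. It lets estimates valid away from the boundary yield convergence on all
  of \<open>\<Omega>\<close>.\<close>

lemma inner_part_exhausts:
  fixes \<Omega> :: "'a::euclidean_space set"
  assumes Om: "open \<Omega>" "emeasure lborel \<Omega> < \<infinity>" and e: "e > 0"
  obtains t where "t > 0" "emeasure lborel (\<Omega> - inner_part \<Omega> t) < ennreal e"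
proof -
  have [measurable]: "\<Omega> \<in> sets borel" "\<And>t. inner_part \<Omega> t \<in> sets borel"
    using Om borel_inner_part by auto
  let ?A = "\<lambda>n. \<Omega> - inner_part \<Omega> (1 / real (Suc n))"
  have le: "emeasure lborel (?A n) \<le> emeasure lborel \<Omega>" for n
    by (rule emeasure_mono) auto
  then have fin: "emeasure lborel (?A n) \<noteq> \<infinity>" for n
    using Om(2) by (metis infinity_ennreal_def leD)
  have mono: "decseq ?A"
  proof (rule decseq_SucI)
    fix n
    have "1 / real (Suc (Suc n)) \<le> 1 / real (Suc n)" by (simp add: field_simps)
    then show "?A (Suc n) \<subseteq> ?A n" using inner_part_antimono by blast
  qed
  have "(\<lambda>n. emeasure lborel (?A n)) \<longlonglongrightarrow> emeasure lborel (\<Inter>n. ?A n)"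
    using mono fin by (intro Lim_emeasure_decseq) auto
  moreover have "(\<Inter>n. ?A n) = {}"
  proof (rule ccontr)
    assume "(\<Inter>n. ?A n) \<noteq> {}"
    then obtain x where x: "x \<in> \<Omega>" "\<And>n. x \<notin> inner_part \<Omega> (1 / real (Suc n))" by blast
    then obtain d where d: "d > 0" "cball x d \<subseteq> \<Omega>" using Om(1) open_contains_cball by blast
    obtain n where "1 / real (Suc n) < d" using nat_approx_posE[OF d(1)] by blast
    then have "cball x (1 / real (Suc n)) \<subseteq> cball x d" by (intro subset_cball) simp
    then show False using x(2)[of n] d(2) by (auto simp: inner_part_def)
  qed
  ultimately have "(\<lambda>n. emeasure lborel (?A n)) \<longlonglongrightarrow> 0" by (simp only: emeasure_empty)
  then have "eventually (\<lambda>n. emeasure lborel (?A n) < ennreal e) sequentially"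
    using e by (intro order_tendstoD(2)) auto
  then obtain n where "emeasure lborel (?A n) < ennreal e" by (auto simp: eventually_sequentially)
  then show thesis by (intro that[of "1 / real (Suc n)"]) auto
qed


section \<open>Translation invariance, and continuity of translations in L^1\<close>

lemma nn_integral_lborel_translate:
  fixes f :: "'a::euclidean_space \<Rightarrow> ennreal"
  assumes [measurable]: "f \<in> borel_measurable borel"
  shows "(\<integral>\<^sup>+x. f (x + h) \<partial>lborel) = (\<integral>\<^sup>+x. f x \<partial>lborel)"
proof -
  have "(\<integral>\<^sup>+x. f x \<partial>lborel) = (\<integral>\<^sup>+x. f x \<partial>distr lborel borel ((+) h))"
    by (simp add: lborel_distr_plus)
  also have "\<dots> = (\<integral>\<^sup>+x. f (x + h) \<partial>lborel)"
    by (subst nn_integral_distr) (auto simp: add.commute)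
  finally show ?thesis ..
qed

lemma emeasure_lborel_translate:
  fixes A :: "'a::euclidean_space set"
  assumes [measurable]: "A \<in> sets borel"
  shows "emeasure lborel {x. x + v \<in> A} = emeasure lborel A"
proof -
  have "emeasure lborel {x. x + v \<in> A} = (\<integral>\<^sup>+x. indicator {x. x + v \<in> A} x \<partial>lborel)"
    by (rule nn_integral_indicator[symmetric]) simp
  also have "\<dots> = (\<integral>\<^sup>+x. indicator A (x + v) \<partial>lborel)"
    by (intro nn_integral_cong) (simp add: indicator_def)
  also have "\<dots> = emeasure lborel A"
    by (subst nn_integral_lborel_translate) auto
  finally show ?thesis .
qed

lemma AE_lborel_translate:
  fixes h :: "'a::euclidean_space"
  assumes "AE x in lborel. P x"
  shows "AE x in lborel. P (x + h)"
proof -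
  obtain N where N: "N \<in> null_sets lborel" "{x. \<not> P x} \<subseteq> N"
    using assms by (auto simp: eventually_ae_filter)
  then have [measurable]: "N \<in> sets borel" by auto
  have "emeasure lborel {x. x + h \<in> N} = 0"
    using N by (auto simp: emeasure_lborel_translate)
  moreover have "{x. x + h \<in> N} \<in> sets lborel" by simp
  ultimately have "{x. x + h \<in> N} \<in> null_sets lborel"
    by blast
  then show ?thesis
    by (rule AE_I') (use N in auto)
qed

text \<open>An open \<open>U\<close> around \<open>A\<close> with little excess reduces the question
  to \<open>U\<close>. If exactly one of \<open>x\<close> and \<open>x + h\<close> is in
  \<open>A\<close>, then one of the two points lies in \<open>U - A\<close> or in the boundary layer
  of \<open>U\<close>; these four possibilities account for the \<open>e/4\<close>.\<close>

lemma indicator_translate_small: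
  fixes A :: "'a::euclidean_space set"
  assumes A[measurable]: "A \<in> sets borel" and fin: "emeasure lborel A < \<infinity>" and e: "e > 0"
  shows "\<exists>d>0. \<forall>h. norm h < d \<longrightarrow>
    (\<integral>\<^sup>+x. ennreal \<bar>indicator A (x + h) - indicator A x\<bar> \<partial>lborel) \<le> ennreal e"
proof -
  obtain U where U: "open U" "A \<subseteq> U" "emeasure lborel (U - A) < ennreal (e/4)"
    using outer_regular_lborel[OF A, of "e/4"] e by auto
  have [measurable]: "U \<in> sets borel" "\<And>t. inner_part U t \<in> sets borel"
    using U(1) by auto
  have "emeasure lborel U \<le> emeasure lborel (A \<union> (U - A))" by (rule emeasure_mono) auto
  also have "\<dots> \<le> emeasure lborel A + emeasure lborel (U - A)" by (rule emeasure_subadditive) auto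
  also have "\<dots> < \<infinity>" using fin less_trans[OF U(3) ennreal_less_top] by simp
  finally obtain d where d: "d > 0" "emeasure lborel (U - inner_part U d) < ennreal (e/4)"
    using inner_part_exhausts[OF U(1), of "e/4"] e by auto
  let ?I = "\<lambda>S. indicator S :: 'a \<Rightarrow> ennreal" and ?V = "U - inner_part U d"
  show ?thesis
  proof (intro exI[of _ d] conjI allI impI d(1))
    fix h :: 'a assume h: "norm h < d"
    have pt: "ennreal \<bar>indicator A (x + h) - indicator A x\<bar> \<le> ?I (U - A) (x + h) + ?I (U - A) x + ?I ?V (x + h) + ?I ?V x" for x
    proof -
      have "x + h \<in> U" if "x \<in> inner_part U d"
        using inner_part_add[OF that, of h 0] h inner_part_subset[of 0 U] by auto
      moreover have "x \<in> U" if "x + h \<in> inner_part U d"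
        using inner_part_add[OF that, of "- h" 0] h inner_part_subset[of 0 U] by auto
      ultimately show ?thesis using U(2) by (auto simp: indicator_def)
    qed
    have "(\<integral>\<^sup>+x. ennreal \<bar>indicator A (x + h) - indicator A x\<bar> \<partial>lborel) \<le>
      (\<integral>\<^sup>+x. ?I (U - A) (x + h) + ?I (U - A) x + ?I ?V (x + h) + ?I ?V x \<partial>lborel)"
      by (intro nn_integral_mono pt)
    also have "\<dots> = emeasure lborel (U - A) + emeasure lborel (U - A) + emeasure lborel ?V + emeasure lborel ?V"
      using nn_integral_lborel_translate[of "?I (U - A)" h] nn_integral_lborel_translate[of "?I ?V" h]
      by (simp add: nn_integral_add)
    also have "\<dots> \<le> ennreal (e/4) + ennreal (e/4) + ennreal (e/4) + ennreal (e/4)"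
      using U(3) d(2) by (intro add_mono) auto
    also have "\<dots> = ennreal e" using e by (simp flip: ennreal_plus)
    finally show "(\<integral>\<^sup>+x. ennreal \<bar>indicator A (x + h) - indicator A x\<bar> \<partial>lborel) \<le> ennreal e" .
  qed
qed

text \<open>Density of simple functions. The result serves the convergence of mollifications in
  \<open>smooth_tendsto_AE\<close>.\<close>

lemma L1_translate_small:
  fixes f :: "'a::euclidean_space \<Rightarrow> 'b::{banach, second_countable_topology}"
  assumes "integrable lborel f" "e > 0"
  shows "\<exists>d>0. \<forall>h. norm h < d \<longrightarrow> (\<integral>\<^sup>+x. ennreal (norm (f (x + h) - f x)) \<partial>lborel) \<le> ennreal e"
  using assms
proof (induction f arbitrary: e rule: integrable_induct)
  case (base A c)
  let ?A = "\<lambda>h. \<integral>\<^sup>+x. ennreal \<bar>indicator A (x + h) - indicator A x\<bar> \<partial>lborel"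
  have [measurable]: "A \<in> sets borel" using base by simp
  define e' where "e' = e / (norm c + 1)"
  have e': "e' > 0" using base by (simp add: e'_def add_nonneg_pos)
  obtain d where d: "d > 0" "\<And>h. norm h < d \<Longrightarrow>
      ?A h \<le> ennreal e'"
    using indicator_translate_small[of A e'] base e' by auto
  show ?case
  proof (intro exI[of _ d] conjI allI impI d(1))
    fix h :: 'a assume h: "norm h < d"
    have "(\<integral>\<^sup>+x. ennreal (norm (indicat_real A (x + h) *\<^sub>R c - indicat_real A x *\<^sub>R c)) \<partial>lborel)
      = (\<integral>\<^sup>+x. ennreal (norm c) * ennreal \<bar>indicator A (x + h) - indicator A x\<bar> \<partial>lborel)"
      by (intro nn_integral_cong) (auto simp flip: scaleR_diff_left simp: ennreal_mult' mult.commute)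
    also have "\<dots> = ennreal (norm c) * ?A h"
      by (intro nn_integral_cmult) auto
    also have "\<dots> \<le> ennreal (norm c) * ennreal e'"
      using d(2)[OF h] by (intro mult_left_mono) auto
    also have "\<dots> = ennreal (norm c * e')" using e' by (simp add: ennreal_mult)
    also have "\<dots> \<le> ennreal e"
    proof (intro ennreal_leI)
      have "norm c * e' \<le> (norm c + 1) * e'" using e' by (intro mult_right_mono) auto
      also have "\<dots> = e" unfolding e'_def by (simp add: add_nonneg_eq_0_iff)
      finally show "norm c * e' \<le> e" .
    qed
    finally show "(\<integral>\<^sup>+x. ennreal (norm (indicat_real A (x + h) *\<^sub>R c - indicat_real A x *\<^sub>R c)) \<partial>lborel) \<le> ennreal e" .
  qed
next
  case (add f g)
  let ?T = "\<lambda>(f :: 'a \<Rightarrow> 'b) h. \<integral>\<^sup>+x. ennreal (norm (f (x + h) - f x)) \<partial>lborel"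
  have [measurable]: "f \<in> borel_measurable borel" "g \<in> borel_measurable borel" using add by auto
  obtain d1 where d1: "d1 > 0" "\<And>h. norm h < d1 \<Longrightarrow>
      ?T f h \<le> ennreal (e/2)"
    using add(3)[of "e/2"] add(5) by auto
  obtain d2 where d2: "d2 > 0" "\<And>h. norm h < d2 \<Longrightarrow>
      ?T g h \<le> ennreal (e/2)"
    using add(4)[of "e/2"] add(5) by auto
  show ?case
  proof (intro exI[of _ "min d1 d2"] conjI allI impI)
    fix h :: 'a assume h: "norm h < min d1 d2"
    have "(\<integral>\<^sup>+x. ennreal (norm ((f (x + h) + g (x + h)) - (f x + g x))) \<partial>lborel)
      \<le> (\<integral>\<^sup>+x. ennreal (norm (f (x + h) - f x)) + ennreal (norm (g (x + h) - g x)) \<partial>lborel)"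
      by (intro nn_integral_mono) (auto simp flip: ennreal_plus intro!: ennreal_leI intro: norm_diff_triangle_ineq)
    also have "\<dots> = ?T f h + ?T g h"
      by (intro nn_integral_add) auto
    also have "\<dots> \<le> ennreal (e/2) + ennreal (e/2)"
      using d1 d2 h by (intro add_mono) auto
    also have "\<dots> = ennreal e" using add(5) by (simp flip: ennreal_plus)
    finally show "(\<integral>\<^sup>+x. ennreal (norm ((f (x + h) + g (x + h)) - (f x + g x))) \<partial>lborel) \<le> ennreal e" .
  qed (use d1 d2 in auto)
next
  case (lim f s)
  let ?T = "\<lambda>(f :: 'a \<Rightarrow> 'b) h. \<integral>\<^sup>+x. ennreal (norm (f (x + h) - f x)) \<partial>lborel"
  have [measurable]: "f \<in> borel_measurable borel" "\<And>i. s i \<in> borel_measurable borel" using lim by auto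
  \<comment> \<open>The approximating functions satisfy
    \<open>norm (s i x) \<le> 2 * norm (f x)\<close>, hence the factor 3 in the dominating
    function.\<close>
  have "(\<lambda>i. \<integral>\<^sup>+x. ennreal (norm (f x - s i x)) \<partial>lborel) \<longlonglongrightarrow> (\<integral>\<^sup>+x. 0 \<partial>(lborel :: 'a measure))"
  proof (rule nn_integral_dominated_convergence[where w="\<lambda>x. ennreal (3 * norm (f x))"])
    show "AE x in lborel. ennreal (norm (f x - s j x)) \<le> ennreal (3 * norm (f x))" for j
    proof (intro AE_I2 ennreal_leI)
      fix x :: 'a
      have "norm (f x - s j x) \<le> norm (f x) + norm (s j x)" by (rule norm_triangle_ineq4)
      also have "\<dots> \<le> 3 * norm (f x)" using lim(3)[of x j] by simp
      finally show "norm (f x - s j x) \<le> 3 * norm (f x)" .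
    qed
    show "(\<integral>\<^sup>+x. ennreal (3 * norm (f x)) \<partial>lborel) < \<infinity>"
      using lim(4) by (simp add: integrable_iff_bounded ennreal_mult' nn_integral_cmult ennreal_mult_less_top)
    show "AE x in lborel. (\<lambda>i. ennreal (norm (f x - s i x))) \<longlonglongrightarrow> 0"
    proof (intro AE_I2)
      fix x :: 'a
      have "(\<lambda>i. norm (f x - s i x)) \<longlonglongrightarrow> norm (f x - f x)"
        using lim(2)[of x] by (intro tendsto_intros) auto
      then show "(\<lambda>i. ennreal (norm (f x - s i x))) \<longlonglongrightarrow> 0"
        using tendsto_ennrealI by fastforce
    qed
  qed auto
  then have "eventually (\<lambda>i. (\<integral>\<^sup>+x. ennreal (norm (f x - s i x)) \<partial>lborel) < ennreal (e/3)) sequentially"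
    using lim.prems by (intro order_tendstoD(2)) auto
  then obtain i where i: "(\<integral>\<^sup>+x. ennreal (norm (f x - s i x)) \<partial>lborel) < ennreal (e/3)"
    by (auto simp: eventually_sequentially)
  obtain d where d: "d > 0" "\<And>h. norm h < d \<Longrightarrow>
      ?T (s i) h \<le> ennreal (e/3)"
    using lim.IH[of "e/3" i] lim.prems by auto
  show ?case
  proof (intro exI[of _ d] conjI allI impI d(1))
    fix h :: 'a assume h: "norm h < d"
    have tri: "norm (f (x + h) - f x) \<le> norm (f (x + h) - s i (x + h)) + norm (s i (x + h) - s i x) + norm (f x - s i x)" for x
      using norm_triangle_ineq4[of "f (x + h) - s i (x + h) + (s i (x + h) - s i x)" "f x - s i x"]
        norm_triangle_ineq[of "f (x + h) - s i (x + h)" "s i (x + h) - s i x"] by (simp add: algebra_simps)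
    have "?T f h
      \<le> (\<integral>\<^sup>+x. ennreal (norm (f (x + h) - s i (x + h))) + ennreal (norm (s i (x + h) - s i x)) + ennreal (norm (f x - s i x)) \<partial>lborel)"
      using tri by (intro nn_integral_mono) (auto simp flip: ennreal_plus intro!: ennreal_leI)
    also have "\<dots> = (\<integral>\<^sup>+x. ennreal (norm (f (x + h) - s i (x + h))) \<partial>lborel)
        + ?T (s i) h + (\<integral>\<^sup>+x. ennreal (norm (f x - s i x)) \<partial>lborel)"
      by (simp add: nn_integral_add)
    also have "(\<integral>\<^sup>+x. ennreal (norm (f (x + h) - s i (x + h))) \<partial>lborel) = (\<integral>\<^sup>+x. ennreal (norm (f x - s i x)) \<partial>lborel)"
      by (rule nn_integral_lborel_translate) auto
    also have "(\<integral>\<^sup>+x. ennreal (norm (f x - s i x)) \<partial>lborel) + ?T (s i) h + (\<integral>\<^sup>+x. ennreal (norm (f x - s i x)) \<partial>lborel)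
      \<le> ennreal (e/3) + ennreal (e/3) + ennreal (e/3)"
      using i d(2)[OF h] by (intro add_mono) auto
    also have "\<dots> = ennreal e" using lim.prems by (simp flip: ennreal_plus)
    finally show "?T f h \<le> ennreal e" .
  qed
qed

section \<open>A mollifier\<close>

text \<open>Squaring the positive part makes the function continuously differentiable across the
  sphere of radius \<open>d\<close>, which is the regularity required by \<open>C1c\<close>, and
  keeps the gradient explicit.\<close>

definition bump :: "real \<Rightarrow> 'a::euclidean_space \<Rightarrow> real"
  where "bump d z = (max 0 (d\<^sup>2 - (norm z)\<^sup>2))\<^sup>2"

lemma bump_nonneg [simp]: "0 \<le> bump d z"
  by (simp add: bump_def)

lemma bump_minus [simp]: "bump d (- z) = bump d z"
  by (simp add: bump_def)

lemma bump_eq_0: "d > 0 \<Longrightarrow> norm z \<ge> d \<Longrightarrow> bump d z = 0"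
  using power_mono[of d "norm z" 2] by (simp add: bump_def)

lemma bump_le: "bump d z \<le> d ^ 4"
proof -
  have "(max 0 (d\<^sup>2 - (norm z)\<^sup>2))\<^sup>2 \<le> (d\<^sup>2)\<^sup>2"
    by (intro power_mono) auto
  then show ?thesis by (simp add: bump_def)
qed

lemma continuous_on_bump [continuous_intros]:
  "continuous_on A f \<Longrightarrow> continuous_on A (\<lambda>x. bump d (f x))"
  unfolding bump_def by (intro continuous_intros)

lemma borel_measurable_bump [measurable]: "bump d \<in> borel_measurable borel"
  by (intro borel_measurable_continuous_onI continuous_intros)

lemma integrable_bump:
  assumes "d > 0" shows "integrable lborel (bump d :: 'a::euclidean_space \<Rightarrow> real)"
proof (rule Bochner_Integration.integrable_bound[where f="\<lambda>z. indicator (cball 0 d) z * d ^ 4"])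
  show "integrable lborel (\<lambda>z. indicat_real (cball (0::'a) d) z * d ^ 4)"
    using emeasure_bounded_finite[of "cball (0::'a) d"]
    by (intro integrable_mult_left integrable_real_indicator) auto
  show "AE z in lborel. norm (bump d (z::'a)) \<le> norm (indicat_real (cball 0 d) z * d ^ 4)"
    using assms by (auto simp: indicator_def bump_le bump_eq_0)
qed auto

text \<open>On the ball of radius \<open>d/2\<close> the inner difference is at least
  \<open>d\<^sup>2 - (d/2)\<^sup>2\<close>, the source of the factor \<open>3/4\<close>.\<close>

lemma integral_bump_pos:
  assumes "d > 0" shows "(LINT z|lborel. bump d (z::'a::euclidean_space)) > 0"
proof -
  let ?B = "ball (0::'a) (d/2)"
  have "0 < (3/4*d\<^sup>2)\<^sup>2 * measure lborel ?B"
    using assms content_ball_pos[of "d/2" "0::'a"] by simp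
  also have "\<dots> = (LINT z|lborel. (3/4*d\<^sup>2)\<^sup>2 * indicator ?B z)"
    using emeasure_bounded_finite[of ?B] by simp
  also have "\<dots> \<le> (LINT z|lborel. bump d (z::'a))"
  proof (intro integral_mono integrable_bump assms)
    show "integrable lborel (\<lambda>z. (3/4*d\<^sup>2)\<^sup>2 * indicat_real ?B z)"
      using emeasure_bounded_finite[of ?B] by (intro integrable_mult_right integrable_real_indicator) auto
    show "(3/4*d\<^sup>2)\<^sup>2 * indicat_real ?B z \<le> bump d z" for z
    proof (cases "z \<in> ?B")
      case True
      then have "(norm z)\<^sup>2 \<le> (d/2)\<^sup>2" by (intro power_mono) auto
      then have "3/4*d\<^sup>2 \<le> d\<^sup>2 - (norm z)\<^sup>2" by (simp add: power_divide)
      then have "3/4*d\<^sup>2 \<le> max 0 (d\<^sup>2 - (norm z)\<^sup>2)" by linarith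
      then have "(3/4*d\<^sup>2)\<^sup>2 \<le> (max 0 (d\<^sup>2 - (norm z)\<^sup>2))\<^sup>2" by (intro power_mono) auto
      then show ?thesis using True by (simp add: bump_def)
    qed simp
  qed
  finally show ?thesis .
qed

definition mollifier :: "real \<Rightarrow> 'a::euclidean_space \<Rightarrow> real"
  where "mollifier d z = bump d z / (LINT y|lborel. bump d (y::'a))"

lemma mollifier_nonneg [simp]: "d > 0 \<Longrightarrow> 0 \<le> mollifier d z"
  using integral_bump_pos[of d, where 'a='a] by (simp add: mollifier_def less_imp_le)

lemma mollifier_minus: "mollifier d (- z) = mollifier d z"
  by (simp add: mollifier_def)

lemma mollifier_diff_commute: "mollifier d (x - y) = mollifier d (y - x)"
  using mollifier_minus[of d "x - y"] by simp

lemma mollifier_eq_0: "d > 0 \<Longrightarrow> norm z \<ge> d \<Longrightarrow> mollifier d z = 0"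
  by (simp add: mollifier_def bump_eq_0)

lemma continuous_on_mollifier [continuous_intros]:
  "continuous_on A f \<Longrightarrow> continuous_on A (\<lambda>x. mollifier d (f x))"
  unfolding mollifier_def divide_inverse by (intro continuous_intros)

lemma borel_measurable_mollifier [measurable]: "mollifier d \<in> borel_measurable borel"
  by (intro borel_measurable_continuous_onI continuous_intros)

lemma mollifier_bounded:
  assumes "d > 0"
  obtains C where "C > 0" "\<And>z::'a::euclidean_space. mollifier d z \<le> C"
proof
  let ?c = "LINT y|lborel. bump d (y::'a)"
  show "d ^ 4 / ?c > 0" using assms integral_bump_pos[OF assms, where 'a='a] by simp
  show "mollifier d z \<le> d ^ 4 / ?c" for z :: 'a
    unfolding mollifier_def using integral_bump_pos[OF assms, where 'a='a] bump_le
    by (intro divide_right_mono) auto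
qed

lemma nn_integral_mollifier:
  assumes "d > 0" shows "(\<integral>\<^sup>+z. ennreal (mollifier d (z::'a::euclidean_space)) \<partial>lborel) = 1"
proof -
  have "integrable lborel (mollifier d :: 'a \<Rightarrow> real)"
    unfolding mollifier_def[abs_def] divide_inverse
    by (intro integrable_mult_left integrable_bump assms)
  then have "(\<integral>\<^sup>+z. ennreal (mollifier d (z::'a)) \<partial>lborel) = ennreal (LINT z|lborel. mollifier d (z::'a))"
    using assms by (intro nn_integral_eq_integral) auto
  also have "(LINT z|lborel. mollifier d (z::'a)) = 1"
    using integral_bump_pos[OF assms, where 'a='a] by (simp add: mollifier_def)
  finally show ?thesis by simp
qed

lemma nn_integral_mollifier_diff:
  assumes "d > 0"
  shows "(\<integral>\<^sup>+y. ennreal (mollifier d (x - y)) \<partial>lborel) = 1" "(\<integral>\<^sup>+y. ennreal (mollifier d (y - x)) \<partial>lborel) = 1"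
proof -
  show *: "(\<integral>\<^sup>+y. ennreal (mollifier d (y - x)) \<partial>lborel) = 1"
    using nn_integral_lborel_translate[of "\<lambda>z. ennreal (mollifier d z)" "- x"] nn_integral_mollifier[OF assms]
    by simp
  then show "(\<integral>\<^sup>+y. ennreal (mollifier d (x - y)) \<partial>lborel) = 1"
    by (subst mollifier_diff_commute)
qed

lemma has_bochner_integral_mollifier:
  assumes "d > 0" shows "has_bochner_integral lborel (\<lambda>y. mollifier d (x - y)) 1"
  using assms nn_integral_mollifier_diff[OF assms, of x]
  by (intro has_bochner_integral_nn_integral) auto

lemma integrable_mollifier_mult:
  fixes f :: "'a::euclidean_space \<Rightarrow> 'b::{banach, second_countable_topology}"
  assumes "d > 0" "integrable lborel f"
  shows "integrable lborel (\<lambda>y. mollifier d (x - y) *\<^sub>R f y)"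
proof -
  have [measurable]: "f \<in> borel_measurable borel" using assms by auto
  obtain C where C: "C > 0" "\<And>z::'a. mollifier d z \<le> C" using mollifier_bounded[OF assms(1)] by blast
  show ?thesis
  proof (rule Bochner_Integration.integrable_bound)
    show "integrable lborel (\<lambda>y. C *\<^sub>R f y)" using assms by simp
    show "AE y in lborel. norm (mollifier d (x - y) *\<^sub>R f y) \<le> norm (C *\<^sub>R f y)"
      using C assms by (auto intro!: mult_right_mono)
  qed auto
qed

text \<open>The remainder of the first-order expansion is at most \<open>(s - t)\<^sup>2\<close> for
  every combination of signs, so the difference quotients are squeezed without a case distinction at
  the kink.\<close>

lemma has_real_derivative_max0_square: "((\<lambda>s. (max 0 s)\<^sup>2) has_real_derivative 2 * max 0 t) (at t)"
  unfolding has_field_derivative_def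
proof (rule has_derivativeI_sandwich[of 1])
  show "bounded_linear ((*) (2 * max 0 t))" by (rule bounded_linear_mult_right)
  fix s :: real assume "s \<noteq> t"
  have "\<bar>(max 0 s)\<^sup>2 - (max 0 t)\<^sup>2 - 2 * max 0 t * (s - t)\<bar> \<le> (s - t)\<^sup>2"
  proof -
    consider "0 \<le> t" "0 \<le> s" | "0 \<le> t" "s < 0" | "t < 0" "0 \<le> s" | "t < 0" "s < 0" by linarith
    then show ?thesis
    proof cases
      case 1 then have "(max 0 s)\<^sup>2 - (max 0 t)\<^sup>2 - 2 * max 0 t * (s - t) = (s - t)\<^sup>2"
        by (simp add: power2_eq_square algebra_simps)
      then show ?thesis by simp
    next
      case 2
      then have "(max 0 s)\<^sup>2 - (max 0 t)\<^sup>2 - 2 * max 0 t * (s - t) = t * (t - 2 * s)"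
        by (simp add: power2_eq_square algebra_simps)
      moreover have "0 \<le> t * (t - 2 * s)" using 2 by simp
      moreover have "(s - t)\<^sup>2 - t * (t - 2 * s) = s\<^sup>2" by (simp add: power2_eq_square algebra_simps)
      ultimately show ?thesis by (smt (verit) zero_le_power2)
    next
      case 3
      then have "s\<^sup>2 \<le> (s - t)\<^sup>2" by (intro power_mono) auto
      then show ?thesis using 3 by simp
    qed simp
  qed
  then show "norm ((max 0 s)\<^sup>2 - (max 0 t)\<^sup>2 - 2 * max 0 t * (s - t)) / norm (s - t) \<le> \<bar>s - t\<bar>"
    using \<open>s \<noteq> t\<close> by (simp add: divide_le_eq power2_eq_square)
next
  have "((\<lambda>y. \<bar>y - t\<bar>) \<longlongrightarrow> \<bar>t - t\<bar>) (at t)" by (intro tendsto_intros)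
  then show "((\<lambda>y. \<bar>y - t\<bar>) \<longlongrightarrow> 0) (at t)" by simp
qed auto

text \<open>The gradient of the normalised \<open>bump\<close>: a factor 2 from the square and
  \<open>-2 z\<close> from \<open>d\<^sup>2 - (norm z)\<^sup>2\<close>.\<close>

definition grad_mollifier :: "real \<Rightarrow> 'a::euclidean_space \<Rightarrow> 'a"
  where "grad_mollifier d z = (- 4 * max 0 (d\<^sup>2 - (norm z)\<^sup>2) / (LINT y|lborel. bump d (y::'a))) *\<^sub>R z"

lemma has_derivative_mollifier:
  "(mollifier d has_derivative (\<lambda>v. grad_mollifier d z \<bullet> v)) (at z)"
proof -
  have 1: "((\<lambda>z. d\<^sup>2 - z \<bullet> z) has_derivative (\<lambda>v. - (2 * (z \<bullet> v)))) (at z)"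
    by (auto intro!: derivative_eq_intros simp: inner_commute)
  have "((\<lambda>z. (max 0 (d\<^sup>2 - z \<bullet> z))\<^sup>2) has_derivative (\<lambda>v. 2 * max 0 (d\<^sup>2 - z \<bullet> z) * (- (2 * (z \<bullet> v))))) (at z)"
    using has_derivative_compose[OF 1, of "\<lambda>s. (max 0 s)\<^sup>2" "(*) (2 * max 0 (d\<^sup>2 - z \<bullet> z))"]
      has_real_derivative_max0_square[of "d\<^sup>2 - z \<bullet> z"] by (simp add: has_field_derivative_def)
  then have "((\<lambda>z. bump d z * inverse (LINT y|lborel. bump d (y::'a))) has_derivative
    (\<lambda>v. 2 * max 0 (d\<^sup>2 - z \<bullet> z) * (- (2 * (z \<bullet> v))) * inverse (LINT y|lborel. bump d (y::'a)))) (at z)"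
    unfolding bump_def power2_norm_eq_inner by (rule has_derivative_mult_left)
  then show ?thesis
    by (simp add: mollifier_def[abs_def] divide_inverse grad_mollifier_def power2_norm_eq_inner[symmetric] ac_simps)
qed

lemma continuous_on_grad_mollifier [continuous_intros]:
  "continuous_on A f \<Longrightarrow> continuous_on A (\<lambda>x. grad_mollifier d (f x))"
  unfolding grad_mollifier_def divide_inverse by (intro continuous_intros)

lemma borel_measurable_grad_mollifier [measurable]: "grad_mollifier d \<in> borel_measurable borel"
  by (intro borel_measurable_continuous_onI continuous_intros)

lemma grad_mollifier_bounded:
  assumes "d > 0"
  obtains C where "C > 0" "\<And>z::'a::euclidean_space. norm (grad_mollifier d z) \<le> C"
proof
  let ?c = "LINT y|lborel. bump d (y::'a)"
  have c: "?c > 0" using integral_bump_pos[OF assms] .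
  show "4 * d\<^sup>2 / ?c * d > 0" using assms c by simp
  show "norm (grad_mollifier d z) \<le> 4 * d\<^sup>2 / ?c * d" for z :: 'a
  proof (cases "norm z \<ge> d")
    case True
    then have "max 0 (d\<^sup>2 - (norm z)\<^sup>2) = 0" using assms by (simp add: power_mono)
    then show ?thesis using c assms by (simp add: grad_mollifier_def)
  next
    case False
    have "4 * max 0 (d\<^sup>2 - (norm z)\<^sup>2) / ?c * norm z \<le> 4 * d\<^sup>2 / ?c * d"
      using False assms c by (intro mult_mono divide_right_mono) auto
    then show ?thesis using c by (simp add: grad_mollifier_def abs_mult)
  qed
qed

lemma mollifier_lipschitz:
  assumes "d > 0"
  obtains L where "L > 0" "\<And>y z::'a::euclidean_space. \<bar>mollifier d y - mollifier d z\<bar> \<le> L * norm (y - z)"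
proof -
  obtain C where C: "C > 0" "\<And>z::'a. norm (grad_mollifier d z) \<le> C"
    using grad_mollifier_bounded[OF assms] by blast
  have "norm (mollifier d y - mollifier d z) \<le> C * norm (y - z)" for y z :: 'a
  proof (rule differentiable_bound[where S=UNIV and f'="\<lambda>z v. grad_mollifier d z \<bullet> v"])
    show "(mollifier d has_derivative (\<bullet>) (grad_mollifier d x)) (at x)" for x :: 'a
      using has_derivative_mollifier[of d x] by simp
    show "onorm ((\<bullet>) (grad_mollifier d x)) \<le> C" for x :: 'a
      using C by (intro onorm_le) (metis Cauchy_Schwarz_ineq2 mult_right_mono norm_ge_zero order_trans real_norm_def)
  qed auto
  then show ?thesis using that[of C] C(1) by simp
qed

lemma mollifier_has_derivative_reflect:
  "((\<lambda>y. mollifier d (x - y)) has_derivative (\<lambda>v. - (grad_mollifier d (x - y) \<bullet> v))) (at y)"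
proof -
  have "((\<lambda>y. x - y) has_derivative (\<lambda>v. - v)) (at y)"
    by (auto intro!: derivative_eq_intros)
  from has_derivative_compose[OF this has_derivative_mollifier[of d "x - y"]]
  show ?thesis by simp
qed

lemma partial_mollifier:
  "partial i (\<lambda>y. mollifier d (x - y)) y = - grad_mollifier d (x - y) $ i"
  unfolding partial_def
  by (subst frechet_derivative_at[OF mollifier_has_derivative_reflect, symmetric]) (simp add: inner_axis)

text \<open>This admits the kernel as a test function in the weak formulation. The closed ball has
  to lie in \<open>\<Omega>\<close> because \<open>C1c\<close> constrains the closure of the
  support.\<close>

lemma mollifier_in_C1c:
  fixes x :: "real^'n::finite"
  assumes "d > 0" "cball x d \<subseteq> \<Omega>"
  shows "(\<lambda>y. mollifier d (x - y)) \<in> C1c \<Omega>"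
proof -
  have "closure {y. mollifier d (x - y) \<noteq> 0} \<subseteq> cball x d"
    using mollifier_eq_0[OF assms(1)] by (intro closure_minimal) (fastforce simp: dist_norm not_le intro: less_imp_le)+
  moreover from this have "compact (closure {y. mollifier d (x - y) \<noteq> 0})"
    by (metis bounded_cball bounded_subset closed_closure compact_eq_bounded_closed)
  ultimately show ?thesis
    unfolding C1c_def using assms
    by (auto simp: partial_mollifier intro!: differentiableI[OF mollifier_has_derivative_reflect] continuous_intros)
qed

text \<open>Mollification error is an average of the differences \<open>f (x + k) - f x\<close>
  against a probability density in \<open>k\<close>, and the density vanishes for
  \<open>norm k \<ge> d\<close>. The integral is restricted to \<open>A\<close> so that translation
  bounds known on an inner part are enough.\<close>

lemma mollify_L1_bound:
  fixes f :: "'a::euclidean_space \<Rightarrow> 'b::{banach, second_countable_topology}"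
  assumes "d > 0" and int: "integrable lborel f" and A[measurable]: "A \<in> sets borel"
    and S: "\<And>k. norm k < d \<Longrightarrow> (\<integral>\<^sup>+x\<in>A. ennreal (norm (f (x + k) - f x)) \<partial>lborel) \<le> S"
  shows "(\<integral>\<^sup>+x\<in>A. ennreal (norm ((LINT y|lborel. mollifier d (x - y) *\<^sub>R f y) - f x)) \<partial>lborel) \<le> S"
proof -
  have [measurable]: "f \<in> borel_measurable borel" using int by auto
  have "norm ((LINT y|lborel. mollifier d (x - y) *\<^sub>R f y) - f x)
      \<le> (\<integral>\<^sup>+k. ennreal (mollifier d k) * ennreal (norm (f (x + k) - f x)) \<partial>lborel)" for x
  proof -
    have i1: "integrable lborel (\<lambda>y. mollifier d (x - y) *\<^sub>R f y)"
      using assms by (intro integrable_mollifier_mult) auto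
    have i2: "has_bochner_integral lborel (\<lambda>y. mollifier d (x - y) *\<^sub>R f x) (1 *\<^sub>R f x)"
      using has_bochner_integral_mollifier[OF assms(1)] by (rule has_bochner_integral_scaleR_left)
    then have "(LINT y|lborel. mollifier d (x - y) *\<^sub>R f y) - f x = (LINT y|lborel. mollifier d (x - y) *\<^sub>R f y - mollifier d (x - y) *\<^sub>R f x)"
      using i1 by (simp add: has_bochner_integral_iff)
    also have "ennreal (norm \<dots>) \<le> (\<integral>\<^sup>+y. norm (mollifier d (x - y) *\<^sub>R f y - mollifier d (x - y) *\<^sub>R f x) \<partial>lborel)"
      using i1 i2 by (intro integral_norm_bound_ennreal) (auto simp: has_bochner_integral_iff)
    also have "\<dots> = (\<integral>\<^sup>+y. ennreal (mollifier d (y - x)) * ennreal (norm (f y - f x)) \<partial>lborel)"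
      using assms(1) by (intro nn_integral_cong)
        (simp add: mollifier_diff_commute[of d x] ennreal_mult' flip: scaleR_diff_right)
    also have "\<dots> = (\<integral>\<^sup>+k. ennreal (mollifier d k) * ennreal (norm (f (k + x) - f x)) \<partial>lborel)"
      by (subst nn_integral_lborel_translate[of _ x, symmetric]) auto
    finally show ?thesis by (simp add: add.commute)
  qed
  then have "(\<integral>\<^sup>+x\<in>A. ennreal (norm ((LINT y|lborel. mollifier d (x - y) *\<^sub>R f y) - f x)) \<partial>lborel)
    \<le> (\<integral>\<^sup>+x. (\<integral>\<^sup>+k. ennreal (mollifier d k) * ennreal (norm (f (x + k) - f x)) \<partial>lborel) * indicator A x \<partial>lborel)"
    by (intro nn_integral_mono mult_right_mono) auto
  also have "\<dots> = (\<integral>\<^sup>+x. (\<integral>\<^sup>+k. ennreal (mollifier d k) * ennreal (norm (f (x + k) - f x)) * indicator A x \<partial>lborel) \<partial>lborel)"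
    by (intro nn_integral_cong nn_integral_multc[symmetric]) auto
  also have "\<dots> = (\<integral>\<^sup>+k. (\<integral>\<^sup>+x. ennreal (mollifier d k) * ennreal (norm (f (x + k) - f x)) * indicator A x \<partial>lborel) \<partial>lborel)"
    by (rule lborel_pair.Fubini'[symmetric]) measurable
  also have "\<dots> = (\<integral>\<^sup>+k. ennreal (mollifier d k) * (\<integral>\<^sup>+x\<in>A. ennreal (norm (f (x + k) - f x)) \<partial>lborel) \<partial>lborel)"
    by (intro nn_integral_cong) (simp add: nn_integral_cmult mult.assoc)
  also have "\<dots> \<le> (\<integral>\<^sup>+k. ennreal (mollifier d (k::'a)) * S \<partial>lborel)"
  proof (intro nn_integral_mono)
    fix k :: 'a
    show "ennreal (mollifier d k) * (\<integral>\<^sup>+x\<in>A. ennreal (norm (f (x + k) - f x)) \<partial>lborel) \<le> ennreal (mollifier d k) * S"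
    proof (cases "norm k < d")
      case True then show ?thesis using S by (intro mult_left_mono) auto
    next
      case False then show ?thesis using mollifier_eq_0[OF assms(1), of k] by simp
    qed
  qed
  also have "\<dots> = S" using nn_integral_mollifier[OF assms(1), where 'a='a] by (simp add: nn_integral_multc)
  finally show ?thesis .
qed

section \<open>Translations of Sobolev functions\<close>

text \<open>The tensor product of \<open>D\<close> and \<open>h\<close>. Its inner product with
  \<open>G\<close> is \<open>D\<close> times the directional derivative \<open>G h\<close>, and its
  Frobenius norm factorises, so Cauchy-Schwarz gives the bound
  \<open>norm G * norm D * norm h\<close>.\<close>

abbreviation rank_one :: "real^'m \<Rightarrow> real^'n \<Rightarrow> real^'n^'m"
  where "rank_one D h \<equiv> (\<chi> j. D $ j *\<^sub>R h)"

text \<open>All that later sections retain of the Dirichlet energy, with \<open>D\<close> in the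
  place of the integral of the squared gradient. The strict inequality leaves room for a
  mollification radius between \<open>norm h\<close> and \<open>t\<close>.\<close>

definition translation_L2_bound :: "(real^'n::finite) set \<Rightarrow> (real^'n \<Rightarrow> real^'m::finite) \<Rightarrow> real \<Rightarrow> bool"
  where "translation_L2_bound \<Omega> f D \<longleftrightarrow> (\<forall>h t. norm h < t \<longrightarrow>
    (\<integral>\<^sup>+x\<in>inner_part \<Omega> t. ennreal ((norm (f (x + h) - f x))\<^sup>2) \<partial>lborel) \<le> ennreal ((norm h)\<^sup>2 * D))"

lemma norm_rank_one_matrix:
  fixes D :: "real^'m::finite" and h :: "real^'n::finite"
  shows "norm (rank_one D h) = norm D * norm h"
proof -
  have "norm (rank_one D h) = L2_set (\<lambda>j. norm (D $ j) * norm h) UNIV"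
    by (subst norm_vec_def) simp
  then show ?thesis
    by (simp add: L2_set_left_distrib[symmetric] norm_vec_def[of D])
qed

lemma inner_rank_one_matrix:
  fixes D :: "real^'m::finite" and h :: "real^'n::finite"
  shows "G \<bullet> (rank_one D h) = (\<Sum>j\<in>UNIV. \<Sum>i\<in>UNIV. D $ j * h $ i * G $ j $ i)"
  by (simp add: inner_vec_def sum_distrib_left mult_ac)

lemma mollifier_line_integral:
  fixes x h y :: "'a::euclidean_space"
  shows "(LINT t|lborel. indicator {0..1} t *\<^sub>R (grad_mollifier d (x + t *\<^sub>R h - y) \<bullet> h))
    = mollifier d (x + h - y) - mollifier d (x - y)"
proof -
  have d: "((\<lambda>t. mollifier d (x + t *\<^sub>R h - y)) has_real_derivative grad_mollifier d (x + t *\<^sub>R h - y) \<bullet> h) (at t)" for t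
  proof -
    have "((\<lambda>t. x + t *\<^sub>R h - y) has_derivative (\<lambda>v. v *\<^sub>R h)) (at t)"
      by (auto intro!: derivative_eq_intros)
    from has_derivative_compose[OF this has_derivative_mollifier[of d "x + t *\<^sub>R h - y"]]
    show ?thesis unfolding has_field_derivative_def by (simp add: mult_commute_abs)
  qed
  have "(LINT t|lborel. indicator {0..1} t *\<^sub>R (grad_mollifier d (x + t *\<^sub>R h - y) \<bullet> h))
    = mollifier d (x + 1 *\<^sub>R h - y) - mollifier d (x + 0 *\<^sub>R h - y)"
  proof (rule integral_FTC_Icc)
    show "((\<lambda>t. mollifier d (x + t *\<^sub>R h - y)) has_vector_derivative grad_mollifier d (x + t *\<^sub>R h - y) \<bullet> h) (at t within {0..1})" for t
      using d[of t] has_real_derivative_iff_has_vector_derivative has_vector_derivative_at_within by blast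
  qed (auto intro!: continuous_intros)
  then show ?thesis by simp
qed

text \<open>For fixed \<open>t\<close> and \<open>y\<close> the kernel has mass 1 in
  \<open>x\<close>, and the parameter interval has length 1; hence the constant in the translation
  estimate is exactly 1.\<close>

lemma nn_integral_mollifier_segment:
  fixes h :: "'a::euclidean_space" and g :: "'a \<Rightarrow> ennreal"
  assumes "d > 0" and [measurable]: "g \<in> borel_measurable borel"
  shows "(\<integral>\<^sup>+x. \<integral>\<^sup>+t. \<integral>\<^sup>+y. indicator {0..1::real} t * ennreal (mollifier d (x + t *\<^sub>R h - y)) * g y \<partial>lborel \<partial>lborel \<partial>lborel)
    = (\<integral>\<^sup>+y. g y \<partial>lborel)"
proof -
  let ?k = "\<lambda>x t y. indicator {0..1::real} t * ennreal (mollifier d (x + t *\<^sub>R h - y)) * g y"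
  have "(\<integral>\<^sup>+x. \<integral>\<^sup>+t. \<integral>\<^sup>+y. ?k x t y \<partial>lborel \<partial>lborel \<partial>lborel)
    = (\<integral>\<^sup>+t. \<integral>\<^sup>+x. \<integral>\<^sup>+y. ?k x t y \<partial>lborel \<partial>lborel \<partial>lborel)"
    by (rule lborel_pair.Fubini'[symmetric]) measurable
  also have "\<dots> = (\<integral>\<^sup>+t. \<integral>\<^sup>+y. \<integral>\<^sup>+x. ?k x t y \<partial>lborel \<partial>lborel \<partial>lborel)"
    by (intro nn_integral_cong lborel_pair.Fubini'[symmetric]) measurable
  also have "\<dots> = (\<integral>\<^sup>+t. \<integral>\<^sup>+y. indicator {0..1::real} t * g y \<partial>lborel \<partial>lborel)"
  proof (intro nn_integral_cong)
    fix t :: real and y :: 'a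
    have "(\<integral>\<^sup>+x. ennreal (mollifier d (x + t *\<^sub>R h - y)) \<partial>lborel) = 1"
      using nn_integral_mollifier_diff(2)[OF assms(1), of "y - t *\<^sub>R h"] by (simp add: algebra_simps)
    then show "(\<integral>\<^sup>+x. ?k x t y \<partial>lborel) = indicator {0..1::real} t * g y"
      by (simp add: nn_integral_cmult nn_integral_multc)
  qed
  also have "\<dots> = (\<integral>\<^sup>+y. g y \<partial>lborel)"
    by (simp add: nn_integral_cmult nn_integral_multc)
  finally show ?thesis .
qed

text \<open>A Bochner integral without integrability has the default value 0, for which the bound is
  trivial. It can therefore be applied to iterated integrals without discussing the inner
  ones.\<close>

lemma ennreal_norm_integral_le: "ennreal (norm (LINT x|M. g x)) \<le> (\<integral>\<^sup>+x. ennreal (norm (g x)) \<partial>M)"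
  for g :: "'z \<Rightarrow> 'y::{banach, second_countable_topology}"
  by (cases "integrable M g") (auto simp: integral_norm_bound_ennreal not_integrable_integral_eq)

text \<open>The setting of a Sobolev function and its gradient extended by zero. The extension may
  jump across the boundary, so the weak identity is asked only for test functions supported in
  \<open>\<Omega>\<close>, while all integrals run over the whole space.\<close>

locale weak_gradient_on =
  fixes \<Omega> :: "(real^'n::finite) set" and f :: "real^'n \<Rightarrow> real^'m::finite" and G :: "real^'n \<Rightarrow> real^'n^'m"
  assumes open_dom: "open \<Omega>" and int_f: "integrable lborel f" and int_G: "integrable lborel G"
    and weak_form: "\<And>\<phi> i j. \<phi> \<in> C1c \<Omega> \<Longrightarrow>
      (LINT y|lborel. f y $ j * partial i \<phi> y) = - (LINT y|lborel. G y $ j $ i * \<phi> y)"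
begin

lemma meas_f [measurable]: "f \<in> borel_measurable borel" using int_f by auto
lemma meas_G [measurable]: "G \<in> borel_measurable borel" using int_G by auto

definition smooth :: "real \<Rightarrow> real^'n \<Rightarrow> real^'m"
  where "smooth d x = (LINT y|lborel. mollifier d (x - y) *\<^sub>R f y)"

lemma integrable_component_f: "integrable lborel (\<lambda>y. f y $ j)"
  using int_f by (rule integrable_bounded_linear[OF bounded_linear_vec_nth])

lemma integrable_component_G: "integrable lborel (\<lambda>y. G y $ j $ i)"
  using integrable_bounded_linear[OF bounded_linear_vec_nth integrable_bounded_linear[OF bounded_linear_vec_nth int_G]] .

lemma integrable_grad_mollifier_mult:
  assumes "d > 0"
  shows "integrable lborel (\<lambda>y. grad_mollifier d (z - y) $ i * f y $ j)"
proof -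
  obtain C where C: "C > 0" "\<And>z::real^'n. norm (grad_mollifier d z) \<le> C" using grad_mollifier_bounded[OF assms(1)] by blast
  show ?thesis
  proof (rule Bochner_Integration.integrable_bound)
    show "integrable lborel (\<lambda>y. C * f y $ j)" using integrable_component_f by simp
    have "\<bar>grad_mollifier d z $ i\<bar> \<le> C" for z :: "real^'n"
      using C(2)[of z] component_le_norm_cart[of "grad_mollifier d z" i] by linarith
    then show "AE y in lborel. norm (grad_mollifier d (z - y) $ i * f y $ j) \<le> norm (C * f y $ j)"
      using C by (auto simp: abs_mult intro!: mult_right_mono)
    have "(\<lambda>y. grad_mollifier d (z - y) $ i) \<in> borel_measurable borel"
      by (intro borel_measurable_continuous_onI continuous_intros)
    then show "(\<lambda>y. grad_mollifier d (z - y) $ i * f y $ j) \<in> borel_measurable lborel"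
      using borel_measurable_integrable[OF integrable_component_f[of j]] by simp
  qed
qed

text \<open>The weak formulation is tested with the kernel centred at \<open>z\<close>. Its sign
  cancels the one produced by differentiating \<open>mollifier d (z - y)\<close> in
  \<open>y\<close>.\<close>

lemma integral_grad_mollifier:
  assumes "d > 0" "cball z d \<subseteq> \<Omega>"
  shows "(LINT y|lborel. (grad_mollifier d (z - y) \<bullet> h) * (D \<bullet> f y))
    = (LINT y|lborel. mollifier d (z - y) * (G y \<bullet> (rank_one D h)))"
proof -
  have G_int: "integrable lborel (\<lambda>y. mollifier d (z - y) * G y $ j $ i)" for i j
    using integrable_mollifier_mult[OF assms(1) integrable_component_G, of z] by simp
  have *: "(LINT y|lborel. grad_mollifier d (z - y) $ i * f y $ j) = (LINT y|lborel. mollifier d (z - y) * G y $ j $ i)" for i j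
    using weak_form[OF mollifier_in_C1c[OF assms], of j i] by (simp add: partial_mollifier mult.commute)
  have "(LINT y|lborel. (grad_mollifier d (z - y) \<bullet> h) * (D \<bullet> f y))
    = (LINT y|lborel. (\<Sum>j\<in>UNIV. \<Sum>i\<in>UNIV. D $ j * h $ i * (grad_mollifier d (z - y) $ i * f y $ j)))"
    by (intro Bochner_Integration.integral_cong refl, unfold inner_vec_def inner_real_def sum_product, subst sum.swap)
      (simp add: mult_ac)
  also have "\<dots> = (\<Sum>j\<in>UNIV. \<Sum>i\<in>UNIV. D $ j * h $ i * (LINT y|lborel. grad_mollifier d (z - y) $ i * f y $ j))"
    using integrable_grad_mollifier_mult[OF assms(1)] by simp
  also have "\<dots> = (LINT y|lborel. (\<Sum>j\<in>UNIV. \<Sum>i\<in>UNIV. D $ j * h $ i * (mollifier d (z - y) * G y $ j $ i)))"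
    using G_int by (simp add: *)
  also have "\<dots> = (LINT y|lborel. mollifier d (z - y) * (G y \<bullet> (rank_one D h)))"
    unfolding inner_rank_one_matrix
    by (intro Bochner_Integration.integral_cong refl) (simp add: sum_distrib_left mult_ac)
  finally show ?thesis .
qed

text \<open>The fundamental theorem is applied to the kernel along the segment, for each
  \<open>y\<close> separately, and the gradient is moved onto \<open>G\<close> after exchanging the
  integrals. This avoids differentiating \<open>smooth d\<close> under the integral.\<close>

lemma smooth_diff_eq:
  assumes "d > 0" and seg: "\<And>t. 0 \<le> t \<Longrightarrow> t \<le> 1 \<Longrightarrow> cball (x + t *\<^sub>R h) d \<subseteq> \<Omega>"
  shows "D \<bullet> (smooth d (x + h) - smooth d x) = (LINT t|lborel. LINT y|lborel.
    indicator {0..1} t * (mollifier d (x + t *\<^sub>R h - y) * (G y \<bullet> (rank_one D h))))"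
proof -
  define F where "F y t = indicat_real {0..1} t * ((grad_mollifier d (x + t *\<^sub>R h - y) \<bullet> h) * (D \<bullet> f y))" for y t
  obtain C where C: "C > 0" "\<And>z::real^'n. norm (grad_mollifier d z) \<le> C" using grad_mollifier_bounded[OF assms(1)] by blast
  have F_meas [measurable]: "case_prod F \<in> borel_measurable (lborel \<Otimes>\<^sub>M lborel)"
    unfolding F_def by measurable
  \<comment> \<open>The kernel gradient is bounded for fixed \<open>d\<close> and \<open>f\<close>
    is integrable, so Fubini applies; the bound depends on \<open>d\<close> but does not enter the
    result.\<close>
  have F_int: "integrable (lborel \<Otimes>\<^sub>M lborel) (case_prod F)"
    unfolding integrable_iff_bounded
  proof
    have "(\<integral>\<^sup>+ z. ennreal (norm (case_prod F z)) \<partial>(lborel \<Otimes>\<^sub>M lborel)) = (\<integral>\<^sup>+y. \<integral>\<^sup>+t. ennreal (norm (F y t)) \<partial>lborel \<partial>lborel)"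
      by (subst lborel.nn_integral_fst[symmetric]) auto
    also have "\<dots> \<le> (\<integral>\<^sup>+y. \<integral>\<^sup>+t. indicator {0..1::real} t * ennreal (C * norm h * norm D * norm (f y)) \<partial>lborel \<partial>lborel)"
    proof (intro nn_integral_mono)
      fix y t
      have "\<bar>(grad_mollifier d (x + t *\<^sub>R h - y) \<bullet> h) * (D \<bullet> f y)\<bar> \<le> (C * norm h) * (norm D * norm (f y))"
        unfolding abs_mult using C
        by (intro mult_mono Cauchy_Schwarz_ineq2 order_trans[OF Cauchy_Schwarz_ineq2] mult_right_mono) auto
      then show "ennreal (norm (F y t)) \<le> indicator {0..1} t * ennreal (C * norm h * norm D * norm (f y))"
        by (auto simp: F_def indicator_def mult.assoc intro!: ennreal_leI)
    qed
    also have "\<dots> = ennreal (C * norm h * norm D) * (\<integral>\<^sup>+y. ennreal (norm (f y)) \<partial>lborel)"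
      using C by (simp add: nn_integral_multc ennreal_mult' nn_integral_cmult)
    also have "\<dots> < \<infinity>"
      using int_f by (simp add: integrable_iff_bounded ennreal_mult_less_top)
    finally show "(\<integral>\<^sup>+ z. ennreal (norm (case_prod F z)) \<partial>(lborel \<Otimes>\<^sub>M lborel)) < \<infinity>" .
  qed measurable
  have int_m: "integrable lborel (\<lambda>y. mollifier d (z - y) *\<^sub>R f y)" for z
    by (rule integrable_mollifier_mult[OF assms(1) int_f])
  have "D \<bullet> (smooth d (x + h) - smooth d x) = D \<bullet> (LINT y|lborel. mollifier d (x + h - y) *\<^sub>R f y - mollifier d (x - y) *\<^sub>R f y)"
    unfolding smooth_def using int_m by simp
  also have "\<dots> = (LINT y|lborel. D \<bullet> (mollifier d (x + h - y) *\<^sub>R f y - mollifier d (x - y) *\<^sub>R f y))"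
    by (rule integral_inner_right[symmetric]) (use int_m in auto)
  also have "\<dots> = (LINT y|lborel. LINT t|lborel. F y t)"
  proof (intro Bochner_Integration.integral_cong refl)
    fix y
    have "(LINT t|lborel. F y t) = (LINT t|lborel. (indicator {0..1} t *\<^sub>R (grad_mollifier d (x + t *\<^sub>R h - y) \<bullet> h)) * (D \<bullet> f y))"
      unfolding F_def by (simp add: mult.assoc)
    also have "\<dots> = (mollifier d (x + h - y) - mollifier d (x - y)) * (D \<bullet> f y)"
      unfolding mollifier_line_integral[symmetric] by (rule integral_mult_left_zero)
    finally show "D \<bullet> (mollifier d (x + h - y) *\<^sub>R f y - mollifier d (x - y) *\<^sub>R f y) = (LINT t|lborel. F y t)"
      by (simp add: inner_diff_right algebra_simps)
  qed
  also have "\<dots> = (LINT t|lborel. LINT y|lborel. F y t)"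
    by (rule lborel_pair.Fubini_integral[symmetric]) (rule F_int)
  also have "\<dots> = (LINT t|lborel. LINT y|lborel.
    indicator {0..1} t * (mollifier d (x + t *\<^sub>R h - y) * (G y \<bullet> (rank_one D h))))"
  proof (rule Bochner_Integration.integral_cong[OF refl])
    fix t :: real
    show "(LINT y|lborel. F y t) = (LINT y|lborel.
      indicator {0..1} t * (mollifier d (x + t *\<^sub>R h - y) * (G y \<bullet> (rank_one D h))))"
      using integral_grad_mollifier[OF assms(1) seg, of t] by (auto simp: F_def indicator_def)
  qed
  finally show ?thesis .
qed

text \<open>A form of Jensen's inequality: the kernel times the indicator of the unit interval is a
  probability density in \<open>t\<close> and \<open>y\<close>. Young's inequality produces half of
  the left-hand side, which is then absorbed.\<close>

lemma smooth_diff_bound: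
  assumes "d > 0" and seg: "\<And>t. 0 \<le> t \<Longrightarrow> t \<le> 1 \<Longrightarrow> cball (x + t *\<^sub>R h) d \<subseteq> \<Omega>"
  shows "ennreal ((norm (smooth d (x + h) - smooth d x))\<^sup>2) \<le> (\<integral>\<^sup>+t. \<integral>\<^sup>+y.
    indicator {0..1} t * ennreal (mollifier d (x + t *\<^sub>R h - y)) * ennreal ((norm h)\<^sup>2 * (norm (G y))\<^sup>2) \<partial>lborel \<partial>lborel)"
proof -
  let ?m = "\<lambda>t y. mollifier d (x + t *\<^sub>R h - y)" and ?i = "indicator {0..1::real}"
  let ?g = "\<lambda>y. (norm h)\<^sup>2 * (norm (G y))\<^sup>2"
  \<comment> \<open>Taking the difference itself as the direction turns the linear identity into one
    for its squared norm.\<close>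
  define D where "D = smooth d (x + h) - smooth d x"
  let ?R = "\<integral>\<^sup>+t. \<integral>\<^sup>+y. ?i t * ennreal (?m t y) * ennreal (?g y) \<partial>lborel \<partial>lborel"
  have "(norm D)\<^sup>2 = (LINT t|lborel. LINT y|lborel.
    ?i t * (?m t y * (G y \<bullet> (rank_one D h))))"
    using smooth_diff_eq[OF assms, of D] unfolding D_def[symmetric] power2_norm_eq_inner .
  then have "ennreal ((norm D)\<^sup>2) = ennreal (norm (LINT t|lborel. LINT y|lborel.
    ?i t * (?m t y * (G y \<bullet> (rank_one D h)))))"
    by (metis abs_of_nonneg real_norm_def zero_le_power2)
  also have "\<dots> \<le> (\<integral>\<^sup>+t. ennreal (norm (LINT y|lborel.
    ?i t * (?m t y * (G y \<bullet> (rank_one D h))))) \<partial>lborel)"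
    by (rule ennreal_norm_integral_le)
  also have "\<dots> \<le> (\<integral>\<^sup>+t. \<integral>\<^sup>+y. ennreal (norm (
    ?i t * (?m t y * (G y \<bullet> (rank_one D h))))) \<partial>lborel \<partial>lborel)"
    by (intro nn_integral_mono ennreal_norm_integral_le)
  also have "\<dots> \<le> (\<integral>\<^sup>+t. \<integral>\<^sup>+y. ?i t * ennreal (?m t y) *
      (ennreal ((norm D)\<^sup>2 / 2) + ennreal (1/2) * ennreal (?g y)) \<partial>lborel \<partial>lborel)"
  proof (intro nn_integral_mono)
    fix t :: real and y
    have "\<bar>G y \<bullet> (rank_one D h)\<bar> \<le> norm (G y) * (norm D * norm h)"
      using Cauchy_Schwarz_ineq2[of "G y" "(rank_one D h)"] by (simp add: norm_rank_one_matrix)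
    also have "\<dots> \<le> (norm D)\<^sup>2 / 2 + 1/2 * (?g y)"
      using zero_le_power2[of "norm D - norm h * norm (G y)"] by (simp add: power2_eq_square algebra_simps)
    finally have "?m t y * \<bar>G y \<bullet> (rank_one D h)\<bar> \<le>
      ?m t y * ((norm D)\<^sup>2 / 2 + 1/2 * (?g y))"
      using assms(1) by (intro mult_left_mono) auto
    moreover have "ennreal m * (ennreal ((norm D)\<^sup>2 / 2) + ennreal (1/2) * ennreal (?g y))
      = ennreal (m * ((norm D)\<^sup>2 / 2 + 1/2 * (?g y)))" if "0 \<le> m" for m
      using that by (subst ennreal_mult, simp, simp, subst ennreal_plus, simp, simp, subst ennreal_mult[of "1/2"]) auto
    ultimately have "ennreal (?m t y * \<bar>G y \<bullet> (rank_one D h)\<bar>) \<le>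
      ennreal (?m t y) * (ennreal ((norm D)\<^sup>2 / 2) + ennreal (1/2) * ennreal (?g y))"
      using assms(1) by (metis ennreal_leI mollifier_nonneg)
    then show "ennreal (norm (?i t * (?m t y * (G y \<bullet> (rank_one D h)))))
      \<le> ?i t * ennreal (?m t y) *
      (ennreal ((norm D)\<^sup>2 / 2) + ennreal (1/2) * ennreal (?g y))"
      using assms(1) by (auto simp: indicator_def abs_mult)
  qed
  also have "\<dots> = (\<integral>\<^sup>+t. \<integral>\<^sup>+y. ?i t * ennreal (?m t y) * ennreal ((norm D)\<^sup>2 / 2) +
      ennreal (1/2) * (?i t * ennreal (?m t y) * ennreal (?g y)) \<partial>lborel \<partial>lborel)"
    by (simp add: distrib_left mult_ac)
  also have "\<dots> = (\<integral>\<^sup>+t. \<integral>\<^sup>+y. ?i t * ennreal (?m t y) * ennreal ((norm D)\<^sup>2 / 2) \<partial>lborel \<partial>lborel)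
      + ennreal (1/2) * ?R"
    by (simp add: nn_integral_add nn_integral_cmult)
  also have "(\<integral>\<^sup>+t. \<integral>\<^sup>+y. ?i t * ennreal (?m t y) * ennreal ((norm D)\<^sup>2 / 2) \<partial>lborel \<partial>lborel)
      = ennreal ((norm D)\<^sup>2 / 2)"
    by (simp add: nn_integral_cmult nn_integral_multc nn_integral_mollifier_diff(1)[OF assms(1)])
  finally have *: "ennreal ((norm D)\<^sup>2) \<le> ennreal ((norm D)\<^sup>2 / 2) + ennreal (1/2) * ?R" .
  \<comment> \<open>Absorption is legitimate because the squared norm is finite; if the right-hand
    side is infinite there is nothing to prove.\<close>
  have "ennreal ((norm D)\<^sup>2) \<le> ?R"
  proof (cases ?R)
    case (real r)
    have "ennreal (1/2) * ennreal r = ennreal (1/2 * r)" using real by (intro ennreal_mult[symmetric]) auto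
    moreover have "ennreal ((norm D)\<^sup>2 / 2) + ennreal (1/2 * r) = ennreal ((norm D)\<^sup>2 / 2 + 1/2 * r)"
      using real by (intro ennreal_plus[symmetric]) auto
    ultimately have "ennreal ((norm D)\<^sup>2) \<le> ennreal ((norm D)\<^sup>2 / 2 + 1/2 * r)"
      using * unfolding real by (simp only:)
    then have "(norm D)\<^sup>2 \<le> (norm D)\<^sup>2 / 2 + 1/2 * r"
      using real by (subst (asm) ennreal_le_iff) auto
    then show ?thesis using real by (simp add: ennreal_leI)
  qed simp
  then show ?thesis by (simp add: D_def)
qed

lemma smooth_translation_bound:
  assumes "d > 0" "norm h + d \<le> t"
  shows "(\<integral>\<^sup>+x\<in>inner_part \<Omega> t. ennreal ((norm (smooth d (x + h) - smooth d x))\<^sup>2) \<partial>lborel)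
    \<le> ennreal ((norm h)\<^sup>2) * (\<integral>\<^sup>+y. ennreal ((norm (G y))\<^sup>2) \<partial>lborel)"
proof -
  have "(\<integral>\<^sup>+x\<in>inner_part \<Omega> t. ennreal ((norm (smooth d (x + h) - smooth d x))\<^sup>2) \<partial>lborel)
    \<le> (\<integral>\<^sup>+x. \<integral>\<^sup>+t. \<integral>\<^sup>+y. indicator {0..1} t * ennreal (mollifier d (x + t *\<^sub>R h - y)) * ennreal ((norm h)\<^sup>2 * (norm (G y))\<^sup>2) \<partial>lborel \<partial>lborel \<partial>lborel)"
  proof (intro nn_integral_mono)
    fix x
    show "ennreal ((norm (smooth d (x + h) - smooth d x))\<^sup>2) * indicator (inner_part \<Omega> t) x \<le>
      (\<integral>\<^sup>+t. \<integral>\<^sup>+y. indicator {0..1} t * ennreal (mollifier d (x + t *\<^sub>R h - y)) * ennreal ((norm h)\<^sup>2 * (norm (G y))\<^sup>2) \<partial>lborel \<partial>lborel)"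
    proof (cases "x \<in> inner_part \<Omega> t")
      case True
      have "cball (x + s *\<^sub>R h) d \<subseteq> \<Omega>" if "0 \<le> s" "s \<le> 1" for s
      proof -
        have "norm (s *\<^sub>R h) \<le> norm h" using that by (simp add: mult_left_le_one_le)
        then have "x + s *\<^sub>R h \<in> inner_part \<Omega> d" using assms by (intro inner_part_add[OF True]) simp
        then show ?thesis by (simp add: inner_part_def)
      qed
      from smooth_diff_bound[OF assms(1) this] True show ?thesis by simp
    qed simp
  qed
  also have "\<dots> = (\<integral>\<^sup>+y. ennreal ((norm h)\<^sup>2 * (norm (G y))\<^sup>2) \<partial>lborel)"
    by (rule nn_integral_mollifier_segment[OF assms(1)]) measurable
  also have "\<dots> = ennreal ((norm h)\<^sup>2) * (\<integral>\<^sup>+y. ennreal ((norm (G y))\<^sup>2) \<partial>lborel)"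
    by (simp add: ennreal_mult nn_integral_cmult)
  finally show ?thesis .
qed

lemma measurable_smooth [measurable]: "smooth d \<in> borel_measurable borel"
  unfolding smooth_def[abs_def] by measurable

text \<open>Continuity of translations gives convergence in L^1, and a subsequence converges almost
  everywhere, which is the form needed for Fatou's lemma.\<close>

lemma smooth_tendsto_AE:
  assumes "\<And>k. d k > 0" "d \<longlonglongrightarrow> 0"
  shows "\<exists>r::nat \<Rightarrow> nat. strict_mono r \<and> (AE x in lborel. (\<lambda>k. smooth (d (r k)) x) \<longlonglongrightarrow> f x)"
proof -
  let ?n = "\<lambda>k x. norm (smooth (d k) x - f x)"
  have bd: "\<forall>\<^sub>F k in sequentially. (\<integral>\<^sup>+x. ennreal (?n k x) \<partial>lborel) \<le> ennreal e" if "e > 0" for e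
  proof -
    obtain c where c: "c > 0" "\<And>h. norm h < c \<Longrightarrow> (\<integral>\<^sup>+x. ennreal (norm (f (x + h) - f x)) \<partial>lborel) \<le> ennreal e"
      using L1_translate_small[OF int_f \<open>e > 0\<close>] by blast
    have "\<forall>\<^sub>F k in sequentially. d k < c" using assms(2) c(1) by (rule order_tendstoD)
    then show ?thesis
    proof eventually_elim
      case (elim k)
      have "(\<integral>\<^sup>+x\<in>UNIV. ennreal (?n k x) \<partial>lborel) \<le> ennreal e"
        unfolding smooth_def using elim c
        by (intro mollify_L1_bound[OF assms(1) int_f]) auto
      then show ?case by simp
    qed
  qed
  \<comment> \<open>The index shift \<open>K\<close> discards the terms for which the difference is
    not yet known to be integrable.\<close>
  obtain K where K: "\<And>k. k \<ge> K \<Longrightarrow> (\<integral>\<^sup>+x. ennreal (?n k x) \<partial>lborel) \<le> ennreal 1"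
    using bd[of 1] by (auto simp: eventually_sequentially)
  have int: "integrable lborel (\<lambda>x. smooth (d (k + K)) x - f x)" for k
    unfolding integrable_iff_bounded using K[of "k + K"] by (auto intro: le_less_trans)
  have "(\<lambda>k. LINT x|lborel. ?n (k + K) x) \<longlonglongrightarrow> 0"
  proof (rule LIMSEQ_I)
    fix e :: real assume e: "e > 0"
    obtain N where N: "\<And>k. k \<ge> N \<Longrightarrow> (\<integral>\<^sup>+x. ennreal (?n k x) \<partial>lborel) \<le> ennreal (e/2)"
      using bd[of "e/2"] e by (auto simp: eventually_sequentially)
    have "norm ((LINT x|lborel. ?n (k + K) x) - 0) < e" if "k \<ge> N" for k
    proof -
      have "ennreal (LINT x|lborel. ?n (k + K) x) \<le> ennreal (e/2)"
        using N[of "k + K"] that nn_integral_eq_integral[OF integrable_norm[OF int[of k]]] by simp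
      then have "(LINT x|lborel. ?n (k + K) x) \<le> e/2" using e by simp
      then show ?thesis using e by simp
    qed
    then show "\<exists>N. \<forall>k\<ge>N. norm ((LINT x|lborel. ?n (k + K) x) - 0) < e" by blast
  qed
  from tendsto_L1_AE_subseq[OF int this] obtain r where r: "strict_mono (r::nat\<Rightarrow>nat)"
    "AE x in lborel. (\<lambda>k. smooth (d (r k + K)) x - f x) \<longlonglongrightarrow> 0" by blast
  show ?thesis
    using r by (intro exI[of _ "\<lambda>k. r k + K"]) (auto simp: strict_mono_def LIM_zero_iff)
qed

text \<open>Fatou's lemma transfers the bound from the mollified functions to \<open>f\<close>,
  whose squared differences are not known to be integrable beforehand.\<close>

theorem translation_bound:
  assumes "norm h < t"
  shows "(\<integral>\<^sup>+x\<in>inner_part \<Omega> t. ennreal ((norm (f (x + h) - f x))\<^sup>2) \<partial>lborel)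
    \<le> ennreal ((norm h)\<^sup>2) * (\<integral>\<^sup>+y. ennreal ((norm (G y))\<^sup>2) \<partial>lborel)"
proof -
  note [measurable] = borel_inner_part[OF open_dom, of t]
  let ?B = "ennreal ((norm h)\<^sup>2) * (\<integral>\<^sup>+y. ennreal ((norm (G y))\<^sup>2) \<partial>lborel)"
  \<comment> \<open>The radii exhaust the gap between \<open>norm h\<close> and \<open>t\<close>, so
    segment and kernel together stay inside \<open>\<Omega>\<close>.\<close>
  define d where "d k = (t - norm h) / real (Suc k)" for k
  have d: "d k > 0" "norm h + d k \<le> t" for k
  proof -
    show "d k > 0" using assms by (simp add: d_def)
    have "(t - norm h) / real (Suc k) \<le> (t - norm h) / 1"
      using assms by (intro divide_left_mono) auto
    then show "norm h + d k \<le> t" by (simp add: d_def)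
  qed
  have "d \<longlonglongrightarrow> 0" unfolding d_def
    using LIMSEQ_Suc[OF lim_const_over_n[of "t - norm h"]] by simp
  from smooth_tendsto_AE[OF d(1) this] obtain r where r: "strict_mono (r::nat\<Rightarrow>nat)"
    "AE x in lborel. (\<lambda>k. smooth (d (r k)) x) \<longlonglongrightarrow> f x" by blast
  define F where "F k x = ennreal ((norm (smooth (d (r k)) (x + h) - smooth (d (r k)) x))\<^sup>2) * indicator (inner_part \<Omega> t) x" for k x
  have [measurable]: "F k \<in> borel_measurable lborel" for k unfolding F_def[abs_def] by measurable
  have "(\<integral>\<^sup>+x\<in>inner_part \<Omega> t. ennreal ((norm (f (x + h) - f x))\<^sup>2) \<partial>lborel) = (\<integral>\<^sup>+x. liminf (\<lambda>k. F k x) \<partial>lborel)"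
  proof (rule nn_integral_cong_AE)
    \<comment> \<open>Convergence is required at \<open>x\<close> and at \<open>x + h\<close>, hence
      the translated null set.\<close>
    show "AE x in lborel. ennreal ((norm (f (x + h) - f x))\<^sup>2) * indicator (inner_part \<Omega> t) x = liminf (\<lambda>k. F k x)"
      using r(2) AE_lborel_translate[OF r(2), of h]
    proof eventually_elim
      case (elim x)
      have "(\<lambda>k. ennreal ((norm (smooth (d (r k)) (x + h) - smooth (d (r k)) x))\<^sup>2)) \<longlonglongrightarrow> ennreal ((norm (f (x + h) - f x))\<^sup>2)"
        using elim by (intro tendsto_ennrealI tendsto_intros)
      then have "(\<lambda>k. F k x) \<longlonglongrightarrow> ennreal ((norm (f (x + h) - f x))\<^sup>2) * indicator (inner_part \<Omega> t) x"
        unfolding F_def by (cases "x \<in> inner_part \<Omega> t") auto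
      then show ?case by (simp add: lim_imp_Liminf)
    qed
  qed
  also have "\<dots> \<le> liminf (\<lambda>k. \<integral>\<^sup>+x. F k x \<partial>lborel)"
    by (rule nn_integral_liminf) measurable
  also have "\<dots> \<le> liminf (\<lambda>k::nat. ?B)"
    unfolding F_def by (intro Liminf_mono always_eventually allI smooth_translation_bound d)
  also have "\<dots> = ?B" by (simp add: Liminf_const)
  finally show ?thesis .
qed

end

lemma AE_lborel_scale:
  fixes P :: "'a::euclidean_space \<Rightarrow> bool"
  assumes "AE x in lborel. P x" "\<delta> > 0"
  shows "AE x in lborel. P (x /\<^sub>R \<delta>)"
proof -
  obtain N where N: "N \<in> null_sets lborel" "{x. \<not> P x} \<subseteq> N"
    using assms by (auto simp: eventually_ae_filter)
  then have [measurable]: "N \<in> sets borel" by auto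
  have *: "AE x in lborel. x \<notin> N" using N by (intro AE_not_in)
  have "AE x in density (distr lborel borel (\<lambda>x::'a. 0 + \<delta> *\<^sub>R x)) (\<lambda>_. ennreal (\<bar>\<delta>\<bar> ^ DIM('a))). x /\<^sub>R \<delta> \<notin> N"
    using assms(2) * by (subst AE_density) (auto simp: AE_distr_iff)
  then have "AE x in (lborel :: 'a measure). x /\<^sub>R \<delta> \<notin> N"
    by (subst lborel_affine[of \<delta> "0::'a"]) (use assms(2) in auto)
  then show ?thesis
    by eventually_elim (use N in auto)
qed

section \<open>Averaging over the periodicity cell\<close>

definition int_lattice :: "(real^'n::finite) set"
  where "int_lattice = {k. \<forall>i. k $ i \<in> \<int>}"

lemma countable_int_lattice: "countable (int_lattice :: (real^'n::finite) set)"
proof -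
  have "int_lattice \<subseteq> range (\<lambda>v::'n \<Rightarrow> int. (\<chi> i. of_int (v i)) :: real^'n)"
  proof
    fix k :: "real^'n" assume "k \<in> int_lattice"
    then have "k = (\<chi> i. of_int \<lfloor>k $ i\<rfloor>)" by (auto simp: int_lattice_def vec_eq_iff)
    then show "k \<in> range (\<lambda>v::'n \<Rightarrow> int. (\<chi> i. of_int (v i)) :: real^'n)"
      by (rule range_eqI[of _ _ "\<lambda>i. \<lfloor>k $ i\<rfloor>"])
  qed
  then show ?thesis by (rule countable_subset) auto
qed

lemma cube_periodic_lattice:
  fixes f :: "real^'n::finite \<Rightarrow> 'b"
  assumes "cube_periodic f" "k \<in> int_lattice"
  shows "f (x + k) = f x"
proof -
  have nat: "f (x + of_nat m *\<^sub>R axis i 1) = f x" for x i and m :: nat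
  proof (induction m)
    case (Suc m)
    then show ?case using assms(1)[unfolded cube_periodic_def, rule_format, of "x + of_nat m *\<^sub>R axis i 1" i]
      by (simp add: algebra_simps)
  qed simp
  have int: "f (x + of_int m *\<^sub>R axis i 1) = f x" for x i and m :: int
  proof (cases m rule: int_cases2)
    case (nonneg n) then show ?thesis using nat by simp
  next
    case (nonpos n) then show ?thesis using nat[of "x - of_nat n *\<^sub>R axis i 1" n i] by simp
  qed
  have "f (x + (\<Sum>i\<in>S. (k $ i) *\<^sub>R axis i 1)) = f x" if "finite S" for S x
    using that
  proof (induction S arbitrary: x)
    case (insert i S)
    obtain m where m: "k $ i = of_int m" using assms(2) by (auto simp: int_lattice_def elim!: Ints_cases)
    show ?case using insert int[of "x + (\<Sum>i\<in>S. (k $ i) *\<^sub>R axis i 1)" m i] by (simp add: m algebra_simps)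
  qed simp
  from this[of UNIV x] show ?thesis
    using basis_expansion[of k] by (simp add: scalar_mult_eq_scaleR)
qed

lemma nearest_lattice_point:
  fixes x :: "real^'n::finite"
  obtains k where "k \<in> int_lattice" "\<And>i. \<bar>x $ i - k $ i\<bar> \<le> 1/2"
proof
  show "(\<chi> i. of_int (round (x $ i))) \<in> int_lattice" by (simp add: int_lattice_def)
  show "\<bar>x $ i - (\<chi> i. of_int (round (x $ i))) $ i\<bar> \<le> 1/2" for i
    using of_int_round_abs_le[of "x $ i"] by (simp add: abs_minus_commute)
qed

lemma uminus_int_lattice: "k \<in> int_lattice \<Longrightarrow> - k \<in> int_lattice"
  by (simp add: int_lattice_def)

lemma unit_cube_eq_box: "unit_cube = box (\<chi> i. - 1/2) (\<chi> i. 1/2)"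
  by (auto simp: unit_cube_def mem_box_cart)

text \<open>Lattice translates of the open cube cover everything except countably many hyperplanes,
  and countably many translates of a null set are null.\<close>

lemma AE_periodic_extension:
  fixes P :: "real^'n::finite \<Rightarrow> bool"
  assumes "AE x in lebesgue_on unit_cube. P x" "cube_periodic P"
  shows "AE x in lborel. P x"
proof -
  have "AE x in lebesgue. x \<in> unit_cube \<longrightarrow> P x"
    using assms(1) by (subst (asm) AE_restrict_space_iff) (auto simp: unit_cube_eq_box)
  then have "AE x in lborel. x \<in> unit_cube \<longrightarrow> P x" by (simp add: AE_completion_iff)
  then have "AE x in lborel. x + k \<in> unit_cube \<longrightarrow> P (x + k)" for k
    by (rule AE_lborel_translate)
  then have 1: "AE x in lborel. \<forall>k\<in>int_lattice. x + k \<in> unit_cube \<longrightarrow> P (x + k)"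
    by (subst AE_ball_countable) (auto simp: countable_int_lattice)
  have "AE x in lborel. (x::real^'n) $ i \<noteq> of_int m + 1/2" for i and m :: int
  proof -
    have "{x::real^'n. x $ i = of_int m + 1/2} \<in> null_sets lebesgue"
      using negligible_standard_hyperplane[of "axis i 1 :: real^'n" "of_int m + 1/2"]
      by (simp add: negligible_iff_null_sets inner_axis axis_in_Basis_iff)
    then have "AE x in lebesgue. (x::real^'n) $ i \<noteq> of_int m + 1/2"
      by (rule AE_I') auto
    then show ?thesis by (simp add: AE_completion_iff)
  qed
  then have 2: "AE x in lborel. \<forall>i. \<forall>m::int. (x::real^'n) $ i \<noteq> of_int m + 1/2"
    by (simp add: AE_all_countable)
  show ?thesis
    using 1 2
  proof eventually_elim
    case (elim x)
    obtain k where k: "k \<in> int_lattice" "\<And>i. \<bar>x $ i - k $ i\<bar> \<le> 1/2" using nearest_lattice_point[of x] by blast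
    have "- 1/2 < x $ i - k $ i" "x $ i - k $ i < 1/2" for i
    proof -
      obtain m where m: "k $ i = of_int m" using k(1) by (auto simp: int_lattice_def elim!: Ints_cases)
      \<comment> \<open>Equality would place \<open>x\<close> on the hyperplane with offset
        \<open>m - 1/2\<close> or \<open>m + 1/2\<close>; the first is the instance
        \<open>m - 1\<close> of the excluded family.\<close>
      show "- 1/2 < x $ i - k $ i" "x $ i - k $ i < 1/2"
        using k(2)[of i, unfolded abs_le_iff m] elim(2)[rule_format, of i m] elim(2)[rule_format, of i "m - 1"]
        unfolding m by (simp_all only: of_int_diff of_int_1) linarith+
    qed
    then have "x + (- k) \<in> unit_cube" by (simp add: unit_cube_def)
    then have "P (x + (- k))" using elim(1) uminus_int_lattice[OF k(1)] by blast
    then show "P x" using cube_periodic_lattice[OF assms(2) uminus_int_lattice[OF k(1)], of x] by simp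
  qed
qed

section \<open>Quantitative positivity of the potential off the wells\<close>

definition off_wells :: "'a::real_normed_vector \<Rightarrow> 'a \<Rightarrow> real \<Rightarrow> 'a set"
  where "off_wells a b s = {z. s \<le> norm (z - a) \<and> s \<le> norm (z - b)}"

lemma closed_off_wells: "closed (off_wells a b s)"
  unfolding off_wells_def by (intro closed_Collect_conj closed_Collect_le continuous_intros)

lemma borel_off_wells [measurable]: "off_wells a b s \<in> sets borel"
  by (simp add: closed_off_wells)

text \<open>Linear growth gives at least 1 outside the ball of radius \<open>R\<close>; inside, the
  minimum over a compact set is attained and positive.\<close>

lemma continuous_coercive_positive_lower_bound:
  fixes w :: "'a::euclidean_space \<Rightarrow> real"
  assumes cont: "continuous_on UNIV w" and pos: "\<And>z. z \<in> S \<Longrightarrow> w z > 0" and S: "closed S"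
    and R: "R > 0" "\<And>z. norm z \<ge> R \<Longrightarrow> w z \<ge> 1 / R * norm z"
  obtains c where "c > 0" "\<And>z. z \<in> S \<Longrightarrow> c \<le> w z"
proof -
  have out: "1 \<le> w z" if "norm z \<ge> R" for z
    using R that by (intro order_trans[OF _ R(2)[OF that]]) (simp add: field_simps)
  show thesis
  proof (cases "S \<inter> cball 0 R = {}")
    case True
    show thesis using True out by (intro that[of 1]) force+
  next
    case False
    have "compact (S \<inter> cball 0 R)" using S by (intro closed_Int_compact) auto
    then obtain z0 where z0: "z0 \<in> S \<inter> cball 0 R" "\<And>z. z \<in> S \<inter> cball 0 R \<Longrightarrow> w z0 \<le> w z"
      using continuous_attains_inf[OF _ False, of w] continuous_on_subset[OF cont] by blast
    show thesis
    proof (rule that[of "min 1 (w z0)"])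
      show "min 1 (w z0) > 0" using pos z0 by simp
      fix z assume "z \<in> S"
      then show "min 1 (w z0) \<le> w z" using z0(2)[of z] out[of z] by (cases "norm z \<le> R") auto
    qed
  qed
qed

text \<open>For almost every \<open>x\<close> there is some positive lower bound. The sets
  \<open>P k\<close>, where \<open>1 / real (Suc k)\<close> is one, cover the cube up to a null set,
  so one of them is not null, and inner regularity yields a compact part of it.\<close>

lemma uniform_positivity_set:
  fixes W :: "real^'n::finite \<Rightarrow> real^'m::finite \<Rightarrow> real"
  assumes cont: "AE x in lebesgue_on unit_cube. continuous_on UNIV (W x)"
    and meas: "\<And>z. (\<lambda>x. W x z) \<in> borel_measurable lebesgue"
    and pos: "\<And>x z. z \<notin> {a, b} \<Longrightarrow> W x z > 0"
    and R: "R > 0" "AE x in lebesgue_on unit_cube. \<forall>z. norm z \<ge> R \<longrightarrow> W x z \<ge> 1 / R * norm z"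
    and s: "s > 0"
  obtains K c where "compact K" "K \<subseteq> unit_cube" "emeasure lborel K > 0" "c > 0"
    "\<And>x z. x \<in> K \<Longrightarrow> z \<in> off_wells a b s \<Longrightarrow> c \<le> W x z"
proof -
  let ?Q = "unit_cube :: (real^'n) set"
  let ?good = "\<lambda>x. continuous_on UNIV (W x) \<and> (\<forall>z. norm z \<ge> R \<longrightarrow> W x z \<ge> 1 / R * norm z)"
  \<comment> \<open>A dense set need not be dense in the closed set \<open>off_wells a b s\<close>,
    but it meets every nonempty open subset of the open enlargement \<open>Z\<close>; this is the
    reason for halving \<open>s\<close>.\<close>
  define Z where "Z = {z. s/2 < norm (z - a) \<and> s/2 < norm (z - b)}"
  have openZ: "open Z" unfolding Z_def by (intro open_Collect_conj open_Collect_less continuous_intros)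
  obtain D :: "(real^'m) set" where D: "countable D" "\<And>X. open X \<Longrightarrow> X \<noteq> {} \<Longrightarrow> \<exists>d\<in>D. d \<in> X"
    using countable_dense_setE by blast
  have cube: "?Q \<in> sets lebesgue" by (simp add: unit_cube_eq_box)
  \<comment> \<open>Testing only countably many \<open>z\<close> makes \<open>P k\<close>
    measurable.\<close>
  define P where "P k = {x\<in>unit_cube. \<forall>z\<in>D \<inter> Z. 1 / real (Suc k) \<le> W x z}" for k
  have P_meas: "P k \<in> sets lebesgue" for k
  proof -
    have "{x \<in> space lebesgue. 1 / real (Suc k) \<le> W x z} \<in> sets lebesgue" for z
      using meas[of z] by measurable
    then have "{x \<in> space lebesgue. \<forall>z\<in>D \<inter> Z. 1 / real (Suc k) \<le> W x z} \<in> sets lebesgue"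
      using countable_Int1[OF D(1)] by (rule sets.sets_Collect_countable_All')
    moreover have "P k = unit_cube \<inter> {x \<in> space lebesgue. \<forall>z\<in>D \<inter> Z. 1 / real (Suc k) \<le> W x z}"
      by (auto simp: P_def)
    ultimately show ?thesis using cube by auto
  qed
  have AE: "AE x in lebesgue. x \<in> unit_cube \<longrightarrow> ?good x"
  proof -
    have "AE x in lebesgue_on unit_cube. ?good x"
      using cont R(2) by eventually_elim blast
    then show ?thesis using cube by (subst (asm) AE_restrict_space_iff) auto
  qed
  obtain N where N: "N \<in> null_sets lebesgue"
    "{x. \<not> (x \<in> unit_cube \<longrightarrow> ?good x)} \<subseteq> N"
    using AE by (auto simp: eventually_ae_filter)
  have cov: "unit_cube - N \<subseteq> (\<Union>k. P k)"
  proof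
    fix x assume x: "x \<in> unit_cube - N"
    have "x \<notin> {x. \<not> (x \<in> unit_cube \<longrightarrow> ?good x)}"
      using x N(2) by blast
    then have c: "continuous_on UNIV (W x)" "\<And>z. norm z \<ge> R \<Longrightarrow> W x z \<ge> 1 / R * norm z"
      using x by auto
    have "W x z > 0" if "z \<in> off_wells a b (s/2)" for z
      using that s by (intro pos) (auto simp: off_wells_def)
    then obtain c where c: "c > 0" "\<And>z. z \<in> off_wells a b (s/2) \<Longrightarrow> c \<le> W x z"
      using continuous_coercive_positive_lower_bound[OF c(1) _ closed_off_wells R(1) c(2), of a b "s/2"] by blast
    obtain k where k: "1 / real (Suc k) < c" using nat_approx_posE[OF c(1)] by blast
    have "x \<in> P k" unfolding P_def
    proof (intro CollectI conjI ballI)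
      fix z assume "z \<in> D \<inter> Z"
      then have "c \<le> W x z" by (intro c(2)) (auto simp: Z_def off_wells_def)
      then show "1 / real (Suc k) \<le> W x z" using k by simp
    qed (use x in auto)
    then show "x \<in> (\<Union>k. P k)" by blast
  qed
  have "\<exists>k. P k \<notin> null_sets lebesgue"
  proof (rule ccontr)
    assume "\<nexists>k. P k \<notin> null_sets lebesgue"
    then have "(\<Union>k. P k) \<in> null_sets lebesgue" by (intro null_sets_UN') auto
    then have "(\<Union>k. P k) \<union> N \<in> null_sets lebesgue" using N(1) by auto
    then have "?Q \<in> null_sets lebesgue"
      by (rule null_sets_completion_subset[rotated]) (use cov in auto)
    then have "unit_cube \<in> null_sets (lborel :: (real^'n) measure)"
      by (subst (asm) null_sets_completion_iff) (auto simp: unit_cube_eq_box)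
    moreover have "open ?Q" unfolding unit_cube_eq_box by (rule open_box)
    moreover have "0 \<in> ?Q" by (simp add: unit_cube_def)
    ultimately show False
      using open_not_negligible[of "unit_cube :: (real^'n) set"]
      by (auto simp: negligible_iff_null_sets dest: null_sets_completionI)
  qed
  then obtain k where k: "P k \<notin> null_sets lebesgue" ..
  \<comment> \<open>Removing \<open>N\<close> makes \<open>W x\<close> continuous at every
    \<open>x\<close> in the set, as the passage from \<open>D\<close> to all \<open>z\<close>
    requires.\<close>
  define S where "S = P k - N"
  have S: "S \<in> sets lebesgue" unfolding S_def using P_meas N by auto
  have "S \<notin> null_sets lebesgue"
  proof
    assume "S \<in> null_sets lebesgue"
    then have "S \<union> N \<in> null_sets lebesgue" using N by auto
    then have "P k \<in> null_sets lebesgue" by (rule null_sets_completion_subset[rotated]) (auto simp: S_def)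
    with k show False ..
  qed
  then have Spos: "emeasure lebesgue S > 0" using S by (auto simp: null_sets_def zero_less_iff_neq_zero)
  \<comment> \<open>With \<open>e\<close> below the measure of \<open>S\<close>, a closed subset
    that misses less than \<open>e\<close> of it cannot be null.\<close>
  obtain e where e: "e > 0" "ennreal e < emeasure lebesgue S"
  proof -
    obtain x where x: "0 < x" "x < emeasure lebesgue S" using dense[OF Spos] by blast
    then show thesis by (cases x) (auto intro: that)
  qed
  obtain T where T: "closed T" "T \<subseteq> S" "S - T \<in> lmeasurable" "emeasure lebesgue (S - T) < ennreal e"
    using sets_lebesgue_inner_closed[OF S e(1)] by blast
  have [measurable]: "T \<in> sets borel" using T by auto
  show thesis
  proof (rule that[of T "1 / real (Suc k)"])
    have TC: "T \<subseteq> unit_cube" using T by (auto simp: S_def P_def)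
    then show "T \<subseteq> unit_cube" .
    show "compact T" using T(1) TC bounded_subset[OF bounded_box]
      by (auto simp: compact_eq_bounded_closed unit_cube_eq_box)
    show "emeasure lborel T > 0"
    proof (rule ccontr)
      assume "\<not> emeasure lborel T > 0"
      then have "emeasure lebesgue T = 0" by (auto simp: zero_less_iff_neq_zero)
      moreover have "emeasure lebesgue S \<le> emeasure lebesgue T + emeasure lebesgue (S - T)"
      proof -
        have "emeasure lebesgue S \<le> emeasure lebesgue (T \<union> (S - T))"
          using T S by (intro emeasure_mono) auto
        also have "\<dots> \<le> emeasure lebesgue T + emeasure lebesgue (S - T)"
          using S by (intro emeasure_subadditive) auto
        finally show ?thesis .
      qed
      ultimately show False using T(4) e(2) by (auto dest: less_trans)
    qed
    show "1 / real (Suc k) > 0" by simp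
    fix x z assume x: "x \<in> T" and z: "z \<in> off_wells a b s"
    have xP: "x \<in> P k" "x \<notin> N" using x T by (auto simp: S_def)
    then have "x \<notin> {x. \<not> (x \<in> unit_cube \<longrightarrow> ?good x)}"
      using N(2) by blast
    then have cont: "continuous_on UNIV (W x)" using xP by (auto simp: P_def)
    have zZ: "z \<in> Z" using z s by (auto simp: Z_def off_wells_def)
    \<comment> \<open>By continuity a violation at \<open>z\<close> would persist on a nonempty open
      subset of \<open>Z\<close>, which contains a point of \<open>D\<close>.\<close>
    show "1 / real (Suc k) \<le> W x z"
    proof (rule ccontr)
      assume "\<not> 1 / real (Suc k) \<le> W x z"
      then have "z \<in> Z \<inter> {z. W x z < 1 / real (Suc k)}" using zZ by simp
      moreover have "open (Z \<inter> {z. W x z < 1 / real (Suc k)})"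
        using cont by (intro open_Int openZ open_Collect_less) auto
      ultimately obtain d where "d \<in> D" "d \<in> Z" "W x d < 1 / real (Suc k)" using D(2) by blast
      moreover have "1 / real (Suc k) \<le> W x d" using xP(1) \<open>d \<in> D\<close> \<open>d \<in> Z\<close> unfolding P_def by blast
      ultimately show False by linarith
    qed
  qed
qed

text \<open>Double counting of pairs \<open>(y, h)\<close> with \<open>y\<close> off the wells,
  \<open>h\<close> in a fixed ball and \<open>y /\<^sub>R \<delta> + h\<close> in the periodic
  copies of \<open>K\<close>. Each \<open>y\<close> has at least the measure of \<open>K\<close> of
  such \<open>h\<close>. For fixed \<open>h\<close>, either the displaced value is still off the
  wells at a place where \<open>W\<close> is at least \<open>c\<close>, or \<open>f\<close> has
  changed by \<open>s/2\<close>; the energy and the translation bound control these two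
  sets.\<close>

lemma off_wells_measure_bound:
  fixes W :: "real^'n::finite \<Rightarrow> real^'m::finite \<Rightarrow> real" and f :: "real^'n \<Rightarrow> real^'m"
  assumes K: "compact K" "K \<subseteq> unit_cube" and c: "c > 0"
    and Wc: "\<And>x z. x \<in> K \<Longrightarrow> z \<in> off_wells a b (s/2) \<Longrightarrow> c \<le> W x z"
    and per: "\<And>z. cube_periodic (\<lambda>x. W x z)"
    and Om: "open \<Omega>" and f[measurable]: "f \<in> borel_measurable borel" and s: "s > 0"
    and trans: "translation_L2_bound \<Omega> f D"
    and pot: "(\<integral>\<^sup>+x\<in>\<Omega>. ennreal (W (x /\<^sub>R \<delta>) (f x)) \<partial>lborel) \<le> ennreal E"
    and E: "E \<ge> 0" "D \<ge> 0" and \<delta>: "\<delta> > 0" "(real CARD('n) + 1) * \<delta> < t"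
  shows "emeasure lborel {x \<in> inner_part \<Omega> t. f x \<in> off_wells a b s} * emeasure lborel K
    \<le> emeasure lborel (ball (0::real^'n) (real CARD('n) + 1)) * ennreal (E / c + 4 / s\<^sup>2 * (((real CARD('n) + 1) * \<delta>)\<^sup>2 * D))"
proof -
  define L where "L = real CARD('n) + 1"
  have L: "L > 0" by (simp add: L_def)
  have [measurable]: "K \<in> sets borel" "\<Omega> \<in> sets borel" using K Om by (auto intro: borel_compact)
  note [measurable] = borel_inner_part[OF Om, of t]
  define P where "P = (\<Union>k\<in>int_lattice. (+) k ` K)"
  let ?P = "\<lambda>y h. indicator P (y /\<^sub>R \<delta> + h) :: ennreal"
  have [measurable]: "P \<in> sets borel"
    unfolding P_def using countable_int_lattice K
    by (intro sets.countable_UN'') (auto intro!: borel_compact compact_translation)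
  have WP: "c \<le> W x z" if x: "x \<in> P" and z: "z \<in> off_wells a b (s/2)" for x z
  proof -
    obtain k q where kq: "k \<in> int_lattice" "q \<in> K" "x = k + q" using x by (auto simp: P_def)
    then have "W x z = W q z" using cube_periodic_lattice[OF per kq(1), of q] by (simp add: add.commute)
    then show ?thesis using Wc[OF kq(2) z] by simp
  qed
  define U where "U = {x \<in> \<Omega>. x /\<^sub>R \<delta> \<in> P \<and> f x \<in> off_wells a b (s/2)}"
  have U[measurable]: "U \<in> sets borel" unfolding U_def by measurable
  \<comment> \<open>Chebyshev's inequality for the potential; \<open>U\<close> collects the points
    where the lower bound \<open>c\<close> is available.\<close>
  have U_le: "emeasure lborel U \<le> ennreal (E / c)"
  proof -
    have "ennreal c * emeasure lborel U = (\<integral>\<^sup>+x. ennreal c * indicator U x \<partial>lborel)"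
      by (simp add: nn_integral_cmult)
    also have "\<dots> \<le> (\<integral>\<^sup>+x\<in>\<Omega>. ennreal (W (x /\<^sub>R \<delta>) (f x)) \<partial>lborel)"
      by (intro nn_integral_mono) (auto simp: U_def indicator_def intro!: ennreal_leI WP)
    also have "\<dots> \<le> ennreal E" by (rule pot)
    finally have *: "ennreal c * emeasure lborel U \<le> ennreal E" .
    have "emeasure lborel U = ennreal (1/c) * (ennreal c * emeasure lborel U)"
      using c by (simp add: mult.assoc[symmetric] ennreal_mult[symmetric])
    also have "\<dots> \<le> ennreal (1/c) * ennreal E" using * by (intro mult_left_mono) auto
    also have "\<dots> = ennreal (1/c * E)" using E c by (intro ennreal_mult[symmetric]) auto
    finally show ?thesis by simp
  qed
  define V where "V h = {y \<in> inner_part \<Omega> t. s/2 \<le> norm (f (y + h) - f y)}" for h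
  have V[measurable]: "V h \<in> sets borel" for h unfolding V_def by measurable
  \<comment> \<open>Chebyshev's inequality for the squared difference; the threshold
    \<open>s/2\<close> is the source of \<open>4 / s\<^sup>2\<close>.\<close>
  have V_le: "emeasure lborel (V h) \<le> ennreal (4 / s\<^sup>2 * ((norm h)\<^sup>2 * D))" if "norm h < t" for h
  proof -
    have "emeasure lborel (V h) = ennreal (4 / s\<^sup>2) * (\<integral>\<^sup>+x. ennreal ((s/2)\<^sup>2) * indicator (V h) x \<partial>lborel)"
      using s by (simp add: nn_integral_cmult mult.assoc[symmetric] ennreal_mult[symmetric] power_divide)
    also have "\<dots> \<le> ennreal (4 / s\<^sup>2) * (\<integral>\<^sup>+x\<in>inner_part \<Omega> t. ennreal ((norm (f (x + h) - f x))\<^sup>2) \<partial>lborel)"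
      using s by (intro mult_left_mono nn_integral_mono)
        (auto simp: V_def indicator_def intro!: ennreal_leI power_mono)
    also have "\<dots> \<le> ennreal (4 / s\<^sup>2) * ennreal ((norm h)\<^sup>2 * D)"
      using trans that unfolding translation_L2_bound_def by (intro mult_left_mono) auto
    also have "\<dots> = ennreal (4 / s\<^sup>2 * ((norm h)\<^sup>2 * D))"
      using E by (intro ennreal_mult[symmetric]) auto
    finally show ?thesis .
  qed
  define Y where "Y = {y \<in> inner_part \<Omega> t. f y \<in> off_wells a b s}"
  have [measurable]: "Y \<in> sets borel" unfolding Y_def by measurable
  let ?B = "ball (0::real^'n) L"
  have B_meas [measurable]: "?B \<in> sets borel" by (rule borel_open[OF open_ball])
  let ?b = "ennreal (E / c + 4 / s\<^sup>2 * ((L * \<delta>)\<^sup>2 * D))"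
  have A_le: "(\<integral>\<^sup>+y. indicator Y y * ?P y h \<partial>lborel) \<le> ?b" if h: "h \<in> ?B" for h
  proof -
    have nh: "norm (\<delta> *\<^sub>R h) < L * \<delta>" using h \<delta> by (simp add: mult.commute)
    then have nh': "norm (\<delta> *\<^sub>R h) < t" using \<delta>(2) unfolding L_def by linarith
    \<comment> \<open>A change of less than \<open>s/2\<close> cannot bring a value at distance
      \<open>s\<close> from the wells closer than \<open>s/2\<close>. The point
      \<open>y + \<delta> *\<^sub>R h\<close> stays in \<open>\<Omega>\<close> since the
      displacement is shorter than \<open>t\<close>.\<close>
    have "{y \<in> Y. y /\<^sub>R \<delta> + h \<in> P} \<subseteq> {y. y + \<delta> *\<^sub>R h \<in> U} \<union> V (\<delta> *\<^sub>R h)"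
    proof safe
      fix y assume y: "y \<in> Y" "y /\<^sub>R \<delta> + h \<in> P" "y \<notin> V (\<delta> *\<^sub>R h)"
      have yi: "y \<in> inner_part \<Omega> t" and fy: "f y \<in> off_wells a b s" using y by (auto simp: Y_def)
      have "y + \<delta> *\<^sub>R h \<in> inner_part \<Omega> 0" using nh' by (intro inner_part_add[OF yi]) simp
      moreover have "(y + \<delta> *\<^sub>R h) /\<^sub>R \<delta> = y /\<^sub>R \<delta> + h" using \<delta> by (simp add: scaleR_add_right)
      moreover have "f (y + \<delta> *\<^sub>R h) \<in> off_wells a b (s/2)"
      proof -
        let ?F = "f (y + \<delta> *\<^sub>R h)"
        have "norm (?F - f y) < s/2" using y(3) yi by (simp add: V_def)
        moreover have "norm (f y - q) \<le> norm (?F - q) + norm (?F - f y)" for q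
          using norm_triangle_ineq4[of "?F - q" "?F - f y"] by simp
        ultimately show ?thesis using fy by (auto simp: off_wells_def) (smt (verit) field_sum_of_halves)+
      qed
      ultimately show "y + \<delta> *\<^sub>R h \<in> U"
        using y inner_part_subset[of 0 \<Omega>] by (auto simp: U_def)
    qed
    then have sub: "indicator Y y * ?P y h \<le> indicator {y. y + \<delta> *\<^sub>R h \<in> U} y + (indicator (V (\<delta> *\<^sub>R h)) y :: ennreal)" for y
      by (auto simp: indicator_def)
    have "(\<integral>\<^sup>+y. indicator Y y * ?P y h \<partial>lborel) \<le> (\<integral>\<^sup>+y. indicator {y. y + \<delta> *\<^sub>R h \<in> U} y + indicator (V (\<delta> *\<^sub>R h)) y \<partial>lborel)"
      by (intro nn_integral_mono sub)
    also have "\<dots> = emeasure lborel {y. y + \<delta> *\<^sub>R h \<in> U} + emeasure lborel (V (\<delta> *\<^sub>R h))"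
      by (subst nn_integral_add) auto
    also have "\<dots> \<le> ennreal (E / c) + ennreal (4 / s\<^sup>2 * ((norm (\<delta> *\<^sub>R h))\<^sup>2 * D))"
      using U_le V_le[OF nh'] by (intro add_mono) (simp_all add: emeasure_lborel_translate)
    also have "\<dots> \<le> ennreal (E / c) + ennreal (4 / s\<^sup>2 * ((L * \<delta>)\<^sup>2 * D))"
      using nh E by (intro add_left_mono ennreal_leI mult_left_mono mult_right_mono power_mono) auto
    also have "\<dots> = ?b" using E c by (intro ennreal_plus[symmetric]) auto
    finally show ?thesis .
  qed
  \<comment> \<open>With \<open>k\<close> a lattice point nearest to \<open>y\<close>, the translate
    of \<open>K\<close> by \<open>k - y\<close> consists of admissible \<open>h\<close>.\<close>
  have K_le: "emeasure lborel K \<le> (\<integral>\<^sup>+h. indicator ?B h * indicator P (y + h) \<partial>lborel)" for y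
  proof -
    obtain k where k: "k \<in> int_lattice" "\<And>i. \<bar>y $ i - k $ i\<bar> \<le> 1/2" using nearest_lattice_point[of y] by blast
    have "emeasure lborel K = emeasure lborel {h. h + (y - k) \<in> K}" by (rule emeasure_lborel_translate[symmetric]) measurable
    also have "\<dots> = (\<integral>\<^sup>+h. indicator {h. h + (y - k) \<in> K} h \<partial>lborel)" by (rule nn_integral_indicator[symmetric]) measurable
    also have "\<dots> \<le> (\<integral>\<^sup>+h. indicator ?B h * indicator P (y + h) \<partial>lborel)"
    proof (intro nn_integral_mono)
      fix h
      have "h \<in> ?B \<and> y + h \<in> P" if "h + (y - k) \<in> K"
      proof
        have "y + h = k + (h + (y - k))" by simp
        then show "y + h \<in> P" unfolding P_def using k(1) that by blast
        \<comment> \<open>One half comes from the cube containing \<open>K\<close> and one half from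
          the rounding. Thus \<open>norm h\<close> is at most the dimension, and the extra 1 in
          \<open>L\<close> puts \<open>h\<close> in the open ball.\<close>
        have "\<bar>h $ i\<bar> \<le> 1" for i
        proof -
          have "\<bar>(h + (y - k)) $ i\<bar> < 1/2" using subsetD[OF K(2) that] unfolding unit_cube_def mem_Collect_eq abs_less_iff
            by (metis minus_divide_left minus_less_iff)
          then show ?thesis using k(2)[of i] unfolding vector_add_component vector_minus_component by linarith
        qed
        then have "(\<Sum>i\<in>UNIV. \<bar>h $ i\<bar>) \<le> of_nat (card (UNIV :: 'n set)) * 1" by (intro sum_bounded_above)
        then have "norm h \<le> real CARD('n)" using norm_le_l1_cart[of h] by simp
        then show "h \<in> ?B" by (simp add: L_def)
      qed
      then show "indicator {h. h + (y - k) \<in> K} h \<le> indicator ?B h * (indicator P (y + h) :: ennreal)"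
        by (auto simp: indicator_def)
    qed
    finally show ?thesis .
  qed
  have "emeasure lborel Y * emeasure lborel K = (\<integral>\<^sup>+y. indicator Y y * emeasure lborel K \<partial>lborel)"
    by (simp add: nn_integral_multc)
  also have "\<dots> \<le> (\<integral>\<^sup>+y. indicator Y y * (\<integral>\<^sup>+h. indicator ?B h * ?P y h \<partial>lborel) \<partial>lborel)"
    by (intro nn_integral_mono mult_left_mono K_le) auto
  also have "\<dots> = (\<integral>\<^sup>+y. \<integral>\<^sup>+h. indicator Y y * (indicator ?B h * ?P y h) \<partial>lborel \<partial>lborel)"
  proof (intro nn_integral_cong)
    fix y :: "real^'n"
    have "(\<lambda>h. ?P y h) \<in> borel_measurable lborel"
      by (rule measurable_compose[of "\<lambda>h. y /\<^sub>R \<delta> + h" lborel borel]) auto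
    then have "(\<lambda>h. indicator ?B h * ?P y h) \<in> borel_measurable lborel"
      by (intro borel_measurable_times_ennreal) auto
    then show "indicator Y y * (\<integral>\<^sup>+h. indicator ?B h * ?P y h \<partial>lborel)
      = (\<integral>\<^sup>+h. indicator Y y * (indicator ?B h * ?P y h) \<partial>lborel)"
      by (rule nn_integral_cmult[symmetric])
  qed
  also have "\<dots> = (\<integral>\<^sup>+h. \<integral>\<^sup>+y. indicator Y y * (indicator ?B h * ?P y h) \<partial>lborel \<partial>lborel)"
    by (rule lborel_pair.Fubini'[symmetric]) measurable
  also have "\<dots> = (\<integral>\<^sup>+h. indicator ?B h * (\<integral>\<^sup>+y. indicator Y y * ?P y h \<partial>lborel) \<partial>lborel)"
    by (simp add: nn_integral_cmult[symmetric] mult_ac)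
  also have "\<dots> \<le> (\<integral>\<^sup>+h. indicator ?B h * ?b \<partial>lborel)"
    using A_le by (intro nn_integral_mono) (auto simp: indicator_def)
  also have "\<dots> = emeasure lborel ?B * ?b" by (simp add: nn_integral_multc)
  finally show ?thesis unfolding Y_def L_def .
qed

section \<open>The phase indicator along translations\<close>

text \<open>A cutoff equal to 1 within distance \<open>r\<close> of \<open>a\<close> and to 0 beyond
  \<open>2 * r\<close>, so constant near each well when these are \<open>4 * r\<close>
  apart.\<close>

definition phase :: "real \<Rightarrow> 'a::real_normed_vector \<Rightarrow> 'a \<Rightarrow> real"
  where "phase r a z = max 0 (min 1 (2 - norm (z - a) / r))"

lemma phase_bounds: "0 \<le> phase r a z" "phase r a z \<le> 1"
  by (auto simp: phase_def)

lemma phase_eq_1: "r > 0 \<Longrightarrow> norm (z - a) \<le> r \<Longrightarrow> phase r a z = 1"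
  by (simp add: phase_def field_simps min_def max_def)

lemma phase_eq_0: "r > 0 \<Longrightarrow> norm (z - a) \<ge> 2 * r \<Longrightarrow> phase r a z = 0"
  by (simp add: phase_def field_simps min_def max_def)

lemma continuous_on_phase: "continuous_on A (phase r a)"
  unfolding phase_def[abs_def] divide_inverse by (intro continuous_intros)

lemma borel_measurable_phase [measurable]: "phase r a \<in> borel_measurable borel"
  by (intro borel_measurable_continuous_onI continuous_on_phase)

lemma ennreal_mult_plus_mult:
  "0 \<le> p \<Longrightarrow> 0 \<le> q \<Longrightarrow> 0 \<le> s \<Longrightarrow> 0 \<le> t \<Longrightarrow> ennreal p * ennreal q + ennreal s * ennreal t = ennreal (p * q + s * t)"
  by (simp add: ennreal_mult)

lemma phase_lipschitz:
  assumes "r > 0" shows "\<bar>phase r a z - phase r a w\<bar> \<le> norm (z - w) / r"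
proof -
  have "\<bar>phase r a z - phase r a w\<bar> \<le> \<bar>norm (z - a) / r - norm (w - a) / r\<bar>"
  proof -
    have "\<bar>max 0 (min 1 (2 - p)) - max 0 (min 1 (2 - q))\<bar> \<le> \<bar>p - q\<bar>" for p q :: real
      unfolding min_def max_def by (smt (verit))
    then show ?thesis by (simp add: phase_def)
  qed
  also have "\<dots> = \<bar>norm (z - a) - norm (w - a)\<bar> / r"
    using assms by (simp add: diff_divide_distrib[symmetric])
  also have "\<dots> \<le> norm ((z - a) - (w - a)) / r"
    using assms norm_triangle_ineq3[of "z - a" "w - a"] by (intro divide_right_mono) auto
  finally show ?thesis by simp
qed

text \<open>Within \<open>r/2\<close> of a well the cutoff is locally constant: a change forces
  \<open>norm (z - w) \<ge> r/2\<close>, and then the Lipschitz bound is dominated by a quadratic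
  one. The linear term therefore survives only off the wells, on a set whose measure is
  small.\<close>

lemma phase_diff_bound:
  assumes r: "r > 0" and ab: "a = b \<or> 4 * r \<le> norm (a - b)"
  shows "\<bar>phase r a z - phase r a w\<bar> \<le> indicator (off_wells a b (r/2)) z * norm (z - w) / r + 2 / r\<^sup>2 * (norm (z - w))\<^sup>2"
proof (cases "z \<in> off_wells a b (r/2)")
  case True
  then show ?thesis using phase_lipschitz[OF r, of a z w] by (simp add: add_increasing2)
next
  case False
  have *: "\<bar>phase r a z - phase r a w\<bar> \<le> 2 / r\<^sup>2 * (norm (z - w))\<^sup>2" if "phase r a z \<noteq> phase r a w \<Longrightarrow> r/2 \<le> norm (z - w)"
  proof (cases "phase r a z = phase r a w")
    case neq: False
    have "norm (z - w) / r * 1 \<le> norm (z - w) / r * (2 * norm (z - w) / r)"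
      using that[OF neq] r by (intro mult_left_mono) (auto simp: field_simps)
    then show ?thesis using phase_lipschitz[OF r, of a z w] by (simp add: power2_eq_square mult_ac)
  qed simp
  have tri: "norm (w - a) \<le> norm (z - a) + norm (z - w)" "norm (z - a) \<le> norm (w - a) + norm (z - w)" "norm (a - b) \<le> norm (z - a) + norm (z - b)"
    using norm_triangle_ineq[of "z - a" "w - z"] norm_triangle_ineq[of "w - a" "z - w"] norm_triangle_ineq[of "a - z" "z - b"]
    by (simp_all add: norm_minus_commute)
  from False consider "norm (z - a) < r/2" | "norm (z - b) < r/2" "a \<noteq> b"
    by (cases "a = b") (auto simp: off_wells_def not_le)
  then have "\<bar>phase r a z - phase r a w\<bar> \<le> 2 / r\<^sup>2 * (norm (z - w))\<^sup>2"
  proof cases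
    case 1
    then have "phase r a z = 1" using r by (intro phase_eq_1) auto
    then show ?thesis using phase_eq_1[OF r, of w a] 1 tri by (intro *) force
  next
    case 2
    then have z: "norm (z - a) > 3 * r" using ab tri r by auto
    then have "phase r a z = 0" using r by (intro phase_eq_0) auto
    then show ?thesis using phase_eq_0[OF r, of w a] z tri r by (intro *) force
  qed
  then show ?thesis using False by simp
qed

text \<open>Both parts of \<open>phase_diff_bound\<close> become linear in \<open>norm k\<close>.
  Young's inequality splits the linear part between the measure of the set off the wells, of order
  \<open>\<epsilon>\<close>, and the squared difference, of order
  \<open>(norm k)\<^sup>2 / \<epsilon>\<close>; the quadratic part is linear because
  \<open>norm k \<le> \<epsilon>\<close>.\<close>

lemma phase_step_bound:
  fixes f :: "real^'n::finite \<Rightarrow> real^'m::finite"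
  assumes r: "r > 0" and ab: "a = b \<or> 4 * r \<le> norm (a - b)" and \<epsilon>: "\<epsilon> > 0" and S[measurable]: "S \<in> sets borel"
    and f[measurable]: "f \<in> borel_measurable borel" and CE: "C \<ge> 0" "E \<ge> 0"
    and k: "k \<noteq> 0" "norm k \<le> \<epsilon>"
    and trans: "(\<integral>\<^sup>+x\<in>S. ennreal ((norm (f (x + k) - f x))\<^sup>2) \<partial>lborel) \<le> ennreal ((norm k)\<^sup>2 * (E / \<epsilon>))"
    and off: "emeasure lborel {x \<in> S. f x \<in> off_wells a b (r/2)} \<le> ennreal (C * \<epsilon>)"
  shows "(\<integral>\<^sup>+x\<in>S. ennreal \<bar>phase r a (f (x + k)) - phase r a (f x)\<bar> \<partial>lborel)
    \<le> ennreal (norm k * ((C + E) / (2 * r) + 2 * E / r\<^sup>2))"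
proof -
  let ?g = "\<lambda>x. \<bar>phase r a (f (x + k)) - phase r a (f x)\<bar>" and ?d = "\<lambda>x. ennreal ((norm (f (x + k) - f x))\<^sup>2)"
  \<comment> \<open>The weight in Young's inequality that gives both resulting terms the order
    \<open>norm k\<close>.\<close>
  define l where "l = norm k / \<epsilon>"
  have l: "l > 0" "l \<le> 1" using k \<epsilon> by (auto simp: l_def)
  define Y where "Y = {x \<in> S. f x \<in> off_wells a b (r/2)}"
  have [measurable]: "Y \<in> sets borel" unfolding Y_def by measurable
  have pt: "ennreal (?g x) * indicator S x \<le>
    ennreal (l / (2 * r)) * indicator Y x + ennreal (1 / (2 * r * l) + 2 / r\<^sup>2) * (?d x * indicator S x)" for x
  proof (cases "x \<in> S")
    case True
    define d where "d = norm (f (x + k) - f x)"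
    define i :: real where "i = indicator Y x"
    have i: "i * i = i" "0 \<le> i" by (auto simp: i_def indicator_def)
    have "?g x \<le> i * d / r + 2 / r\<^sup>2 * d\<^sup>2"
      using phase_diff_bound[OF r ab, of "f x" "f (x + k)"] True
      by (simp add: i_def Y_def d_def norm_minus_commute abs_minus_commute indicator_def)
    also have "i * d / r \<le> l / (2 * r) * i + 1 / (2 * r * l) * d\<^sup>2"
    proof -
      have "0 \<le> (l * i - d)\<^sup>2 / (2 * r * l)" using r l by simp
      also have "(l * i - d)\<^sup>2 = l * l * i - 2 * l * i * d + d\<^sup>2"
        using i(1) by (simp add: power2_eq_square algebra_simps) (metis mult.assoc)
      finally show ?thesis using r l by (simp add: field_simps)
    qed
    finally have "?g x \<le> l / (2 * r) * i + (1 / (2 * r * l) + 2 / r\<^sup>2) * d\<^sup>2"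
      by (simp add: algebra_simps)
    then have "ennreal (?g x) \<le> ennreal (l / (2 * r) * i + (1 / (2 * r * l) + 2 / r\<^sup>2) * d\<^sup>2)"
      by (rule ennreal_leI)
    also have "\<dots> = ennreal (l / (2 * r)) * ennreal i + ennreal (1 / (2 * r * l) + 2 / r\<^sup>2) * ennreal (d\<^sup>2)"
      using r l i by (intro ennreal_mult_plus_mult[symmetric]) auto
    finally show ?thesis using True by (simp add: i_def d_def ennreal_indicator)
  qed simp
  have "(\<integral>\<^sup>+x\<in>S. ennreal (?g x) \<partial>lborel) \<le>
    (\<integral>\<^sup>+x. ennreal (l / (2 * r)) * indicator Y x + ennreal (1 / (2 * r * l) + 2 / r\<^sup>2) * (?d x * indicator S x) \<partial>lborel)"
    by (intro nn_integral_mono pt)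
  also have "\<dots> = ennreal (l / (2 * r)) * emeasure lborel Y + ennreal (1 / (2 * r * l) + 2 / r\<^sup>2) * (\<integral>\<^sup>+x\<in>S. ?d x \<partial>lborel)"
    by (simp add: nn_integral_add nn_integral_cmult)
  also have "\<dots> \<le> ennreal (l / (2 * r)) * ennreal (C * \<epsilon>) + ennreal (1 / (2 * r * l) + 2 / r\<^sup>2) * ennreal ((norm k)\<^sup>2 * (E / \<epsilon>))"
    using trans off by (intro add_mono mult_left_mono) (auto simp: Y_def)
  also have "\<dots> = ennreal (l / (2 * r) * (C * \<epsilon>) + (1 / (2 * r * l) + 2 / r\<^sup>2) * ((norm k)\<^sup>2 * (E / \<epsilon>)))"
    using l r CE \<epsilon> by (intro ennreal_mult_plus_mult) auto
  also have "\<dots> \<le> ennreal (norm k * ((C + E) / (2 * r) + 2 * E / r\<^sup>2))"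
  proof (rule ennreal_leI)
    have 1: "l / (2 * r) * (C * \<epsilon>) = norm k * (C / (2 * r))" using \<epsilon> by (simp add: l_def)
    have 2: "1 / (2 * r * l) * ((norm k)\<^sup>2 * (E / \<epsilon>)) = norm k * (E / (2 * r))"
      using \<epsilon> k by (simp add: l_def power2_eq_square)
    have "2 / r\<^sup>2 * ((norm k)\<^sup>2 * (E / \<epsilon>)) = l * (norm k * (2 * E / r\<^sup>2))"
      by (simp add: l_def power2_eq_square mult_ac)
    also have "\<dots> \<le> 1 * (norm k * (2 * E / r\<^sup>2))"
      using l CE by (intro mult_right_mono) auto
    finally have 3: "2 / r\<^sup>2 * ((norm k)\<^sup>2 * (E / \<epsilon>)) \<le> norm k * (2 * E / r\<^sup>2)" by simp
    have "l / (2 * r) * (C * \<epsilon>) + (1 / (2 * r * l) + 2 / r\<^sup>2) * ((norm k)\<^sup>2 * (E / \<epsilon>))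
      = l / (2 * r) * (C * \<epsilon>) + 1 / (2 * r * l) * ((norm k)\<^sup>2 * (E / \<epsilon>)) + 2 / r\<^sup>2 * ((norm k)\<^sup>2 * (E / \<epsilon>))"
      by (simp only: distrib_right add.assoc)
    also have "\<dots> \<le> norm k * (C / (2 * r)) + norm k * (E / (2 * r)) + norm k * (2 * E / r\<^sup>2)"
      using 1 2 3 by linarith
    also have "\<dots> = norm k * ((C + E) / (2 * r) + 2 * E / r\<^sup>2)"
      by (simp add: add_divide_distrib distrib_left)
    finally show "l / (2 * r) * (C * \<epsilon>) + (1 / (2 * r * l) + 2 / r\<^sup>2) * ((norm k)\<^sup>2 * (E / \<epsilon>))
      \<le> norm k * ((C + E) / (2 * r) + 2 * E / r\<^sup>2)" .
  qed
  finally show ?thesis .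
qed

text \<open>Going from \<open>x\<close> to \<open>x + h\<close> in steps no longer than \<open>\<epsilon>\<close> replaces the chain rule for Sobolev functions.\<close>

lemma phase_translation_bound:
  fixes f :: "real^'n::finite \<Rightarrow> real^'m::finite"
  assumes r: "r > 0" and ab: "a = b \<or> 4 * r \<le> norm (a - b)" and \<epsilon>: "\<epsilon> > 0" and Om: "open \<Omega>"
    and f[measurable]: "f \<in> borel_measurable borel" and CE: "C \<ge> 0" "E \<ge> 0"
    and trans: "translation_L2_bound \<Omega> f (E / \<epsilon>)"
    and off: "emeasure lborel {x \<in> inner_part \<Omega> (t/2). f x \<in> off_wells a b (r/2)} \<le> ennreal (C * \<epsilon>)"
    and h: "norm h \<le> t/2"
  shows "(\<integral>\<^sup>+x\<in>inner_part \<Omega> t. ennreal \<bar>phase r a (f (x + h)) - phase r a (f x)\<bar> \<partial>lborel)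
    \<le> ennreal (norm h * ((C + E) / (2 * r) + 2 * E / r\<^sup>2))"
proof (cases "h = 0")
  case False
  note [measurable] = borel_inner_part[OF Om]
  let ?g = "\<lambda>x. phase r a (f x)"
  let ?C = "(C + E) / (2 * r) + 2 * E / r\<^sup>2"
  obtain m0 :: nat where m0: "norm h / \<epsilon> < real m0" using reals_Archimedean2 by blast
  \<comment> \<open>At least \<open>norm h / \<epsilon>\<close> steps make each one no longer than
    \<open>\<epsilon>\<close>; at least two make it strictly shorter than \<open>t/2\<close>, as
    \<open>translation_L2_bound\<close> demands.\<close>
  define m where "m = m0 + 2"
  define k where "k = h /\<^sub>R real m"
  have m: "real m \<ge> 2" "norm h / \<epsilon> \<le> real m" using m0 by (auto simp: m_def)
  have k: "k \<noteq> 0" "norm k \<le> \<epsilon>" "norm k < t/2" and mk: "real m * norm k = norm h" "h = real m *\<^sub>R k"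
  proof -
    show "k \<noteq> 0" "h = real m *\<^sub>R k" using False m by (auto simp: k_def)
    show mk: "real m * norm k = norm h" using m by (simp add: k_def)
    have "norm h \<le> real m * \<epsilon>" using m(2) \<epsilon> by (simp add: field_simps)
    then show "norm k \<le> \<epsilon>" using m unfolding mk[symmetric] by simp
    have "2 * norm k \<le> norm h" unfolding mk[symmetric] using m by (intro mult_right_mono) auto
    moreover have "norm h > 0" using False by simp
    ultimately show "norm k < t/2" using h by linarith
  qed
  define J where "J = (\<integral>\<^sup>+x\<in>inner_part \<Omega> (t/2). ennreal \<bar>?g (x + k) - ?g x\<bar> \<partial>lborel)"
  have J: "J \<le> ennreal (norm k * ?C)"
    unfolding J_def using trans k(3) unfolding translation_L2_bound_def
    by (intro phase_step_bound[OF r ab \<epsilon> _ f CE k(1,2) _ off]) auto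
  let ?s = "\<lambda>j x. ?g (x + real (Suc j) *\<^sub>R k) - ?g (x + real j *\<^sub>R k)" and ?I = "inner_part \<Omega> t"
  \<comment> \<open>The intermediate points are at distance at most \<open>norm h \<le> t/2\<close>
    from \<open>x\<close>, so they remain in \<open>inner_part \<Omega> (t/2)\<close>, and by
    translation invariance each step costs at most \<open>J\<close>.\<close>
  have step: "(\<integral>\<^sup>+x\<in>?I. ennreal \<bar>?s j x\<bar> \<partial>lborel) \<le> J" if j: "j < m" for j
  proof -
    have "norm (real j *\<^sub>R k) \<le> norm h" unfolding mk(1)[symmetric] using j by (simp add: mult_right_mono)
    then have shift: "x + real j *\<^sub>R k \<in> inner_part \<Omega> (t/2)" if "x \<in> ?I" for x
      using h by (intro inner_part_add[OF that]) simp
    have "(\<integral>\<^sup>+x\<in>?I. ennreal \<bar>?s j x\<bar> \<partial>lborel)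
      \<le> (\<integral>\<^sup>+x. (\<lambda>y. ennreal \<bar>?g (y + k) - ?g y\<bar> * indicator (inner_part \<Omega> (t/2)) y) (x + real j *\<^sub>R k) \<partial>lborel)"
      using shift by (intro nn_integral_mono) (auto simp: indicator_def algebra_simps)
    also have "\<dots> = J" unfolding J_def by (rule nn_integral_lborel_translate) measurable
    finally show ?thesis .
  qed
  have tele: "\<bar>?g (x + h) - ?g x\<bar> \<le> (\<Sum>j<m. \<bar>?s j x\<bar>)" for x
  proof -
    have "?g (x + h) - ?g x = (\<Sum>j<m. ?s j x)"
      by (subst sum_lessThan_telescope) (simp add: mk(2))
    then show ?thesis using sum_abs[of "\<lambda>j. ?s j x" "{..<m}"] by simp
  qed
  have "(\<integral>\<^sup>+x\<in>?I. ennreal \<bar>?g (x + h) - ?g x\<bar> \<partial>lborel) \<le>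
    (\<integral>\<^sup>+x. (\<Sum>j<m. ennreal \<bar>?s j x\<bar> * indicator ?I x) \<partial>lborel)"
    using tele by (intro nn_integral_mono) (simp add: sum_distrib_right[symmetric] sum_nonneg ennreal_leI mult_right_mono)
  also have "\<dots> = (\<Sum>j<m. \<integral>\<^sup>+x\<in>?I. ennreal \<bar>?s j x\<bar> \<partial>lborel)"
    by (rule nn_integral_sum) measurable
  also have "\<dots> \<le> (\<Sum>j<m. J)" using step by (intro sum_mono) auto
  also have "\<dots> \<le> of_nat m * ennreal (norm k * ?C)" using J by (simp add: mult_left_mono)
  also have "\<dots> = ennreal (real m * (norm k * ?C))"
    using r CE by (simp add: ennreal_mult ennreal_of_nat_eq_real_of_nat)
  also have "\<dots> = ennreal (norm h * ?C)" using mk(1) by (simp add: mult.assoc[symmetric])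
  finally show ?thesis .
qed (simp)

section \<open>Compactness from translation estimates\<close>

lemma diagonal_convergent_subsequence:
  fixes F :: "nat \<Rightarrow> 'i \<Rightarrow> real"
  assumes I: "countable I" and bd: "\<And>n i. i \<in> I \<Longrightarrow> \<bar>F n i\<bar> \<le> B"
  obtains r :: "nat \<Rightarrow> nat" where "strict_mono r" "\<And>i. i \<in> I \<Longrightarrow> convergent (\<lambda>n. F (r n) i)"
proof (cases "I = {}")
  case True then show thesis using that[of id] by (simp add: strict_mono_def)
next
  case False
  interpret subseqs "\<lambda>j s. convergent (\<lambda>n. F (s n) (from_nat_into I j))"
  proof
    fix j and s :: "nat \<Rightarrow> nat"
    have "bounded (range (\<lambda>n. F (s n) (from_nat_into I j)))"
      using bd[OF from_nat_into[OF False]] by (intro boundedI[of _ B]) auto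
    then obtain l r where "strict_mono r" "((\<lambda>n. F (s n) (from_nat_into I j)) \<circ> r) \<longlonglongrightarrow> l"
      using bounded_imp_convergent_subsequence by blast
    then show "\<exists>r'. strict_mono r' \<and> convergent (\<lambda>n. F ((s \<circ> r') n) (from_nat_into I j))"
      by (auto simp: o_def convergent_def)
  qed
  show thesis
  proof (rule that[OF subseq_diagseq])
    fix i assume "i \<in> I"
    then obtain j where j: "i = from_nat_into I j" using I from_nat_into_surj by metis
    have "convergent (\<lambda>n. F ((diagseq \<circ> (+) (Suc j)) n) (from_nat_into I j))"
    proof (rule diagseq_holds)
      fix r s :: "nat \<Rightarrow> nat" and n
      assume "strict_mono r" "convergent (\<lambda>m. F (s m) (from_nat_into I n))"
      then show "convergent (\<lambda>m. F ((s \<circ> r) m) (from_nat_into I n))"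
        using convergent_subseq_convergent[of "\<lambda>m. F (s m) (from_nat_into I n)" r] by (simp add: o_def)
    qed
    then have "convergent (\<lambda>n. F (diagseq (n + Suc j)) i)" by (simp add: o_def j add.commute)
    then show "convergent (\<lambda>n. F (diagseq n) i)"
      using convergent_ignore_initial_segment[of "\<lambda>n. F (diagseq n) i" "Suc j"] by simp
  qed
qed

text \<open>The Arzela-Ascoli mechanism: a common Lipschitz constant spreads convergence from a
  dense set to every point.\<close>

lemma equi_lipschitz_convergent:
  fixes F :: "nat \<Rightarrow> 'a::real_normed_vector \<Rightarrow> real"
  assumes lip: "\<And>n x y. \<bar>F n x - F n y\<bar> \<le> L * norm (x - y)"
    and dense: "\<And>X. open X \<Longrightarrow> X \<noteq> {} \<Longrightarrow> \<exists>d\<in>D. d \<in> X" and conv: "\<And>q. q \<in> D \<Longrightarrow> convergent (\<lambda>n. F n q)"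
  shows "convergent (\<lambda>n. F n x)"
proof -
  have "Cauchy (\<lambda>n. F n x)"
  proof (rule metric_CauchyI)
    fix e :: real assume e: "e > 0"
    \<comment> \<open>\<open>L\<close> may be zero or negative, and the radius below divides by the
      constant.\<close>
    define L' where "L' = \<bar>L\<bar> + 1"
    have L': "L' > 0" "L \<le> L'" by (auto simp: L'_def)
    obtain q where q: "q \<in> D" "norm (x - q) < e / (3 * L')"
    proof -
      have "e / (3 * L') > 0" using e L' by simp
      then have "x \<in> ball x (e / (3 * L'))" by simp
      then obtain q where "q \<in> D" "q \<in> ball x (e / (3 * L'))" using dense[of "ball x (e / (3 * L'))"] by blast
      then show thesis using that by (auto simp: dist_norm)
    qed
    have near: "\<bar>F n x - F n q\<bar> < e/3" for n
    proof -
      have "\<bar>F n x - F n q\<bar> \<le> L * norm (x - q)" by (rule lip)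
      also have "\<dots> \<le> L' * norm (x - q)" using L' by (intro mult_right_mono) auto
      also have "\<dots> < L' * (e / (3 * L'))" using q L' by (intro mult_strict_left_mono) auto
      also have "\<dots> = e/3" using L' by simp
      finally show ?thesis .
    qed
    obtain N where N: "\<And>m n. m \<ge> N \<Longrightarrow> n \<ge> N \<Longrightarrow> dist (F m q) (F n q) < e/3"
      using metric_CauchyD[OF convergent_Cauchy[OF conv[OF q(1)]], of "e/3"] e by auto
    show "\<exists>M. \<forall>m\<ge>M. \<forall>n\<ge>M. dist (F m x) (F n x) < e"
    proof (intro exI[of _ N] allI impI)
      fix m n assume "N \<le> m" "N \<le> n"
      then show "dist (F m x) (F n x) < e"
        using N[of m n] near[of m] near[of n] unfolding dist_real_def by linarith
    qed
  qed
  then show ?thesis by (rule Cauchy_convergent)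
qed

text \<open>A local form of the Frechet-Kolmogorov criterion: for each \<open>t\<close> the estimate
  holds on the inner part and only from some index on. Mollifications at a fixed scale are compact,
  the translation bound makes them close to \<open>w n\<close> uniformly along the sequence, and the
  boundary layer has small measure.\<close>

lemma translation_compactness:
  fixes w :: "nat \<Rightarrow> 'a::euclidean_space \<Rightarrow> real"
  assumes Om: "open \<Omega>" "bounded \<Omega>" and w[measurable]: "\<And>n. w n \<in> borel_measurable borel"
    and bd: "\<And>n x. 0 \<le> w n x" "\<And>n x. w n x \<le> 1" and supp: "\<And>n x. x \<notin> \<Omega> \<Longrightarrow> w n x = 0" and C: "C \<ge> 0"
    and trans: "\<And>t. t > 0 \<Longrightarrow> \<exists>n0. \<forall>n\<ge>n0. \<forall>h. norm h \<le> t/2 \<longrightarrow>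
      (\<integral>\<^sup>+x\<in>inner_part \<Omega> t. ennreal \<bar>w n (x + h) - w n x\<bar> \<partial>lborel) \<le> ennreal (C * norm h)"
  obtains r :: "nat \<Rightarrow> nat" and v where "strict_mono r" "integrable lborel v" "\<And>x. x \<notin> \<Omega> \<Longrightarrow> v x = 0"
    "(\<lambda>n. LINT x|lborel. \<bar>w (r n) x - v x\<bar>) \<longlonglongrightarrow> 0"
proof -
  have [measurable]: "\<Omega> \<in> sets borel" "\<And>t. inner_part \<Omega> t \<in> sets borel"
    using Om borel_inner_part by auto
  have fin: "emeasure lborel \<Omega> < \<infinity>" by (rule emeasure_bounded_finite[OF Om(2)])
  have int_ind: "integrable lborel (indicator \<Omega> :: 'a \<Rightarrow> real)"
    using fin by (intro integrable_real_indicator) auto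
  have wle: "norm (w n x) \<le> indicator \<Omega> x" for n x
    using bd supp[of x n] by (auto simp: indicator_def)
  have int_w: "integrable lborel (w n)" for n
    by (rule Bochner_Integration.integrable_bound[OF int_ind]) (use wle in auto)
  define d where "d k = 1 / real (Suc k)" for k
  have d: "d k > 0" for k by (simp add: d_def)
  define M where "M n k x = (LINT y|lborel. mollifier (d k) (x - y) * w n y)" for n k x
  have M_meas [measurable]: "M n k \<in> borel_measurable borel" for n k unfolding M_def[abs_def] by measurable
  have int_mw: "integrable lborel (\<lambda>y. mollifier (d k) (x - y) * w n y)" for k n x
    using integrable_mollifier_mult[OF d int_w] by simp
  have M_bd: "\<bar>M n k x\<bar> \<le> 1" for n k x
  proof -
    have "0 \<le> M n k x" unfolding M_def using d bd by (intro integral_nonneg_AE AE_I2 mult_nonneg_nonneg) auto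
    moreover have "M n k x \<le> (LINT y|lborel. mollifier (d k) (x - y))"
      unfolding M_def
    proof (rule integral_mono[OF int_mw])
      show "integrable lborel (\<lambda>y. mollifier (d k) (x - y))"
        using has_bochner_integral_mollifier[OF d[of k], of x] by (simp add: has_bochner_integral_iff)
      show "mollifier (d k) (x - y) * w n y \<le> mollifier (d k) (x - y)" for y
        using bd d by (intro mult_left_le) auto
    qed
    moreover have "(LINT y|lborel. mollifier (d k) (x - y)) = 1"
      using has_bochner_integral_mollifier[OF d[of k], of x] by (simp add: has_bochner_integral_iff)
    ultimately show ?thesis by simp
  qed
  \<comment> \<open>Since \<open>w n\<close> is bounded by the indicator of \<open>\<Omega>\<close>,
    the constant depends on the scale \<open>k\<close> but not on \<open>n\<close>.\<close>
  have M_lip: "\<exists>L. \<forall>n x y. \<bar>M n k x - M n k y\<bar> \<le> L * norm (x - y)" for k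
  proof -
    obtain L where L: "L > 0" "\<And>y z::'a. \<bar>mollifier (d k) y - mollifier (d k) z\<bar> \<le> L * norm (y - z)"
      using mollifier_lipschitz[OF d] by blast
    have "\<bar>M n k x - M n k y\<bar> \<le> (L * measure lborel \<Omega>) * norm (x - y)" for n x y
    proof -
      have "M n k x - M n k y = (LINT z|lborel. mollifier (d k) (x - z) * w n z - mollifier (d k) (y - z) * w n z)"
        unfolding M_def using int_mw by simp
      also have "\<bar>\<dots>\<bar> \<le> (LINT z|lborel. L * norm (x - y) * indicator \<Omega> z)"
      proof (rule integral_abs_bound[THEN order_trans], rule integral_mono)
        show "integrable lborel (\<lambda>z. \<bar>mollifier (d k) (x - z) * w n z - mollifier (d k) (y - z) * w n z\<bar>)"
          using int_mw by (intro integrable_abs Bochner_Integration.integrable_diff)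
        show "integrable lborel (\<lambda>z. L * norm (x - y) * indicat_real \<Omega> z)" using int_ind by simp
        fix z
        have "\<bar>mollifier (d k) (x - z) * w n z - mollifier (d k) (y - z) * w n z\<bar> = \<bar>mollifier (d k) (x - z) - mollifier (d k) (y - z)\<bar> * \<bar>w n z\<bar>"
          by (simp add: abs_mult[symmetric] left_diff_distrib)
        also have "\<dots> \<le> (L * norm ((x - z) - (y - z))) * indicator \<Omega> z"
          using L(1) wle[of n z] by (intro mult_mono L(2)) auto
        finally show "\<bar>mollifier (d k) (x - z) * w n z - mollifier (d k) (y - z) * w n z\<bar> \<le> L * norm (x - y) * indicat_real \<Omega> z"
          by simp
      qed
      also have "\<dots> = (L * measure lborel \<Omega>) * norm (x - y)" using fin by simp
      finally show ?thesis .
    qed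
    then show ?thesis by blast
  qed
  obtain D :: "'a set" where D: "countable D" "\<And>X. open X \<Longrightarrow> X \<noteq> {} \<Longrightarrow> \<exists>d\<in>D. d \<in> X"
    using countable_dense_setE by blast
  \<comment> \<open>Scales and dense points are diagonalised together, so one subsequence serves
    every mollification scale.\<close>
  have cnt: "countable ((UNIV :: nat set) \<times> D)" using D(1) by simp
  have M_bd': "\<bar>M n (fst i) (snd i)\<bar> \<le> 1" if "i \<in> (UNIV :: nat set) \<times> D" for n i by (rule M_bd)
  obtain r :: "nat \<Rightarrow> nat" where r: "strict_mono r"
    "\<And>i. i \<in> (UNIV :: nat set) \<times> D \<Longrightarrow> convergent (\<lambda>n. M (r n) (fst i) (snd i))"
    by (rule diagonal_convergent_subsequence[OF cnt, where F="\<lambda>n i. M n (fst i) (snd i)"], rule M_bd', assumption, rule that)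
  have conv: "convergent (\<lambda>n. M (r n) k x)" for k x
  proof -
    obtain L where L: "\<forall>n x y. \<bar>M n k x - M n k y\<bar> \<le> L * norm (x - y)" using M_lip by blast
    show ?thesis
    proof (rule equi_lipschitz_convergent[where F="\<lambda>n. M (r n) k" and L=L and D=D])
      show "\<bar>M (r n) k x - M (r n) k y\<bar> \<le> L * norm (x - y)" for n x y using L by blast
      show "convergent (\<lambda>n. M (r n) k q)" if "q \<in> D" for q using r(2)[of "(k, q)"] that by simp
    qed (rule D(2))
  qed
  define m where "m k x = lim (\<lambda>n. M (r n) k x)" for k x
  let ?m = "\<lambda>n k x. ennreal \<bar>M (r n) k x - m k x\<bar>"
  have lim: "(\<lambda>n. M (r n) k x) \<longlonglongrightarrow> m k x" for k x
    using conv unfolding m_def by (simp add: convergent_LIMSEQ_iff)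
  have [measurable]: "m k \<in> borel_measurable borel" for k
    by (rule borel_measurable_LIMSEQ_metric[OF M_meas lim])
  have mbd: "\<bar>m k x\<bar> \<le> 1" for k x
    using LIMSEQ_le_const2[OF tendsto_rabs[OF lim[of k x]], of 1] M_bd by auto
  have M_L1: "\<exists>N. \<forall>i\<ge>N. (\<integral>\<^sup>+x\<in>\<Omega>. ?m i k x \<partial>lborel) < ennreal e" if e: "e > 0" for e k
  proof -
    have "(\<lambda>n. \<integral>\<^sup>+x\<in>\<Omega>. ?m n k x \<partial>lborel) \<longlonglongrightarrow> (\<integral>\<^sup>+x. 0 \<partial>(lborel :: 'a measure))"
    proof (rule nn_integral_dominated_convergence[where w="\<lambda>x. 2 * indicator \<Omega> x"])
      show "(\<integral>\<^sup>+x. 2 * indicator \<Omega> x \<partial>lborel) < \<infinity>"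
        using fin by (simp add: nn_integral_cmult ennreal_mult_less_top)
      show "AE x in lborel. ?m n k x * indicator \<Omega> x \<le> 2 * indicator \<Omega> x" for n
      proof (intro AE_I2)
        fix x
        have "\<bar>M (r n) k x - m k x\<bar> \<le> 2" using M_bd[of "r n" k x] mbd[of k x] by linarith
        then have "?m n k x \<le> ennreal 2" by (rule ennreal_leI)
        then show "?m n k x * indicator \<Omega> x \<le> 2 * indicator \<Omega> x"
          by (intro mult_right_mono) auto
      qed
      show "AE x in lborel. (\<lambda>n. ?m n k x * indicator \<Omega> x) \<longlonglongrightarrow> 0"
      proof (intro AE_I2)
        fix x
        have "(\<lambda>n. \<bar>M (r n) k x - m k x\<bar>) \<longlonglongrightarrow> \<bar>m k x - m k x\<bar>" by (intro tendsto_intros lim)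
        then have "(\<lambda>n. ?m n k x) \<longlonglongrightarrow> ennreal 0" by (intro tendsto_ennrealI) simp
        then show "(\<lambda>n. ?m n k x * indicator \<Omega> x) \<longlonglongrightarrow> 0"
          by (cases "x \<in> \<Omega>") auto
      qed
    qed auto
    then have "eventually (\<lambda>n. (\<integral>\<^sup>+x\<in>\<Omega>. ?m n k x \<partial>lborel) < ennreal e) sequentially"
      using e by (intro order_tendstoD(2)) auto
    then show ?thesis by (auto simp: eventually_sequentially)
  qed
  have Cauchy: "\<exists>N. \<forall>i\<ge>N. \<forall>j\<ge>N. (LINT x|lborel. norm (w (r i) x - w (r j) x)) < e" if e: "e > 0" for e
  proof -
    obtain t where t: "t > 0" "emeasure lborel (\<Omega> - inner_part \<Omega> t) < ennreal (e/6)"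
      using inner_part_exhausts[OF Om(1) fin, of "e/6"] e by auto
    obtain n0 where n0: "\<And>n h. n \<ge> n0 \<Longrightarrow> norm h \<le> t/2 \<Longrightarrow>
      (\<integral>\<^sup>+x\<in>inner_part \<Omega> t. ennreal \<bar>w n (x + h) - w n x\<bar> \<partial>lborel) \<le> ennreal (C * norm h)"
      using trans[OF t(1)] by blast
    \<comment> \<open>The radius has to be below \<open>t/2\<close>, where translations are
      controlled, and to make the error \<open>C * d k\<close> small; \<open>C + 1\<close> avoids
      dividing by zero.\<close>
    obtain k where k: "1 / real (Suc k) < min (t/2) (e / (6 * (C + 1)))"
      using nat_approx_posE[of "min (t/2) (e / (6 * (C + 1)))"] t e C by (metis add_nonneg_pos divide_pos_pos less_numeral_extra(1) min_less_iff_conj mult_pos_pos zero_less_numeral)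
    have dk: "d k < t/2" "C * d k \<le> e/6"
    proof -
      show "d k < t/2" using k by (simp add: d_def)
      have "C * d k \<le> (C + 1) * (e / (6 * (C + 1)))"
        using k C d[of k] by (intro mult_mono) (auto simp: d_def)
      also have "\<dots> = e/6" using C by (simp add: field_simps)
      finally show "C * d k \<le> e/6" .
    qed
    have wM: "(\<integral>\<^sup>+x\<in>inner_part \<Omega> t. ennreal \<bar>M n k x - w n x\<bar> \<partial>lborel) \<le> ennreal (e/6)" if "n \<ge> n0" for n
    proof -
      have "(\<integral>\<^sup>+x\<in>inner_part \<Omega> t. ennreal (norm ((LINT y|lborel. mollifier (d k) (x - y) *\<^sub>R w n y) - w n x)) \<partial>lborel) \<le> ennreal (e/6)"
      proof (rule mollify_L1_bound[OF d int_w])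
        fix h :: 'a assume h: "norm h < d k"
        have "(\<integral>\<^sup>+x\<in>inner_part \<Omega> t. ennreal \<bar>w n (x + h) - w n x\<bar> \<partial>lborel) \<le> ennreal (C * norm h)"
          using h dk that by (intro n0) auto
        also have "\<dots> \<le> ennreal (e/6)"
        proof (rule ennreal_leI)
          have "C * norm h \<le> C * d k" using h C by (intro mult_left_mono) auto
          then show "C * norm h \<le> e/6" using dk(2) by linarith
        qed
        finally show "(\<integral>\<^sup>+x\<in>inner_part \<Omega> t. ennreal (norm (w n (x + h) - w n x)) \<partial>lborel) \<le> ennreal (e/6)" by simp
      qed auto
      then show ?thesis by (simp add: M_def)
    qed
    obtain N where N: "\<And>i. i \<ge> N \<Longrightarrow> (\<integral>\<^sup>+x\<in>\<Omega>. ?m i k x \<partial>lborel) < ennreal (e/6)"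
      using M_L1[of "e/6" k] e by auto
    show ?thesis
    proof (intro exI[of _ "max N n0"] allI impI)
      fix i j assume ij: "max N n0 \<le> i" "max N n0 \<le> j"
      have rij: "n0 \<le> r i" "n0 \<le> r j" using seq_suble[OF r(1), of i] seq_suble[OF r(1), of j] ij by auto
      let ?I = "inner_part \<Omega> t" and ?W = "\<lambda>i x. ennreal \<bar>M (r i) k x - w (r i) x\<bar>"
        and ?d = "\<lambda>x. norm (w (r i) x - w (r j) x)"
      \<comment> \<open>On the inner part both functions are compared with their mollifications and
        these with their common limit \<open>m k\<close>; on the layer the difference is at most 1.
        Five terms of size \<open>e/6\<close> keep the final inequality strict.\<close>
      have pt: "ennreal (?d x) \<le> ?W i x * indicator ?I x
          + (?m i k x * indicator \<Omega> x + (?m j k x * indicator \<Omega> x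
          + (?W j x * indicator ?I x + indicator (\<Omega> - ?I) x)))" for x
      proof -
        consider "x \<in> ?I" | "x \<in> \<Omega> - ?I" | "x \<notin> \<Omega>" by blast
        then show ?thesis
        proof cases
          case 1
          then have "x \<in> \<Omega>" using inner_part_subset[of t \<Omega>] t(1) by auto
          then show ?thesis using 1 by (simp flip: ennreal_plus add: ennreal_leI)
        next
          case 2
          have "\<bar>w (r i) x - w (r j) x\<bar> \<le> 1" using bd[of "r i" x] bd[of "r j" x] by (auto simp: abs_le_iff)
          then have "ennreal (?d x) \<le> ennreal 1" by (intro ennreal_leI) simp
          then show ?thesis using 2 by (simp add: add_increasing)
        next
          case 3
          then show ?thesis using supp by simp
        qed
      qed
      have "ennreal (LINT x|lborel. ?d x) = (\<integral>\<^sup>+x. ennreal (?d x) \<partial>lborel)"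
        using int_w by (intro nn_integral_eq_integral[symmetric] integrable_norm Bochner_Integration.integrable_diff) auto
      also have "\<dots> \<le> (\<integral>\<^sup>+x. ?W i x * indicator ?I x
          + (?m i k x * indicator \<Omega> x + (?m j k x * indicator \<Omega> x
          + (?W j x * indicator ?I x + indicator (\<Omega> - ?I) x))) \<partial>lborel)"
        by (intro nn_integral_mono pt)
      also have "\<dots> = (\<integral>\<^sup>+x\<in>?I. ?W i x \<partial>lborel)
          + ((\<integral>\<^sup>+x\<in>\<Omega>. ?m i k x \<partial>lborel) + ((\<integral>\<^sup>+x\<in>\<Omega>. ?m j k x \<partial>lborel)
          + ((\<integral>\<^sup>+x\<in>?I. ?W j x \<partial>lborel) + emeasure lborel (\<Omega> - ?I))))"
        by (simp add: nn_integral_add)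
      also have "\<dots> \<le> ennreal (e/6) + (ennreal (e/6) + (ennreal (e/6) + (ennreal (e/6) + ennreal (e/6))))"
        using wM[OF rij(1)] wM[OF rij(2)] N[of i] N[of j] ij t(2) by (intro add_mono) auto
      also have "\<dots> = ennreal (e/6 + (e/6 + (e/6 + (e/6 + e/6))))" using e by (simp flip: ennreal_plus)
      finally have "(LINT x|lborel. ?d x) \<le> e/6 + (e/6 + (e/6 + (e/6 + e/6)))"
        using e by (subst (asm) ennreal_le_iff) auto
      then show "(LINT x|lborel. ?d x) < e" using e by linarith
    qed
  qed
  obtain r' where r': "strict_mono r'" "AE x in lborel. Cauchy (\<lambda>i. w (r (r' i)) x)"
    using cauchy_L1_AE_cauchy_subseq[of lborel "\<lambda>n. w (r n)", OF int_w Cauchy] by blast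
  \<comment> \<open>Where the sequence does not converge the value of \<open>lim\<close> is
    irrelevant, being confined to a null set. Outside \<open>\<Omega>\<close> the sequence is
    constantly 0, so \<open>v\<close> vanishes there exactly.\<close>
  define v where "v x = lim (\<lambda>i. w (r (r' i)) x)" for x
  have v_meas [measurable]: "v \<in> borel_measurable borel" unfolding v_def by measurable
  have v_lim: "AE x in lborel. (\<lambda>i. w (r (r' i)) x) \<longlonglongrightarrow> v x"
    using r'(2) by eventually_elim (simp add: v_def Cauchy_convergent_iff convergent_LIMSEQ_iff)
  have v0: "v x = 0" if "x \<notin> \<Omega>" for x using supp[OF that] by (simp add: v_def)
  have int_v: "integrable lborel v"
    by (rule integrable_dominated_convergence[OF _ _ int_ind v_lim]) (use wle in auto)
  have "(\<lambda>i. LINT x|lborel. \<bar>w (r (r' i)) x - v x\<bar>) \<longlonglongrightarrow> (LINT x|(lborel :: 'a measure). 0)"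
  proof (rule integral_dominated_convergence[where w="\<lambda>x. indicator \<Omega> x + \<bar>v x\<bar>"])
    show "integrable lborel (\<lambda>x. indicat_real \<Omega> x + \<bar>v x\<bar>)" using int_ind int_v by simp
    show "AE x in lborel. (\<lambda>i. \<bar>w (r (r' i)) x - v x\<bar>) \<longlonglongrightarrow> 0"
      using v_lim
    proof eventually_elim
      case (elim x)
      then have "(\<lambda>i. \<bar>w (r (r' i)) x - v x\<bar>) \<longlonglongrightarrow> \<bar>v x - v x\<bar>" by (intro tendsto_intros)
      then show ?case by simp
    qed
    show "AE x in lborel. norm \<bar>w (r (r' i)) x - v x\<bar> \<le> indicat_real \<Omega> x + \<bar>v x\<bar>" for i
      using wle[of "r (r' i)"] by (intro AE_I2) (smt (verit) real_norm_def)
  qed measurable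
  then show thesis
    using strict_mono_o[OF r(1) r'(1)] int_v v0 by (intro that[of "r \<circ> r'" v]) (auto simp: o_def)
qed

section \<open>Perimeter from translation estimates\<close>

lemma integral_lborel_translate:
  fixes f :: "'a::euclidean_space \<Rightarrow> real"
  assumes [measurable]: "f \<in> borel_measurable borel"
  shows "(LINT x|lborel. f (x + h)) = (LINT x|lborel. f x)"
proof -
  have "(LINT x|lborel. f x) = (LINT x|distr lborel borel ((+) h). f x)"
    by (simp add: lborel_distr_plus)
  also have "\<dots> = (LINT x|lborel. f (x + h))"
    by (subst integral_distr) (auto simp: add.commute)
  finally show ?thesis ..
qed

lemma compact_subset_inner_part:
  assumes "open \<Omega>" "compact K" "K \<subseteq> \<Omega>"
  obtains t where "t > 0" "K \<subseteq> inner_part \<Omega> t"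
proof -
  have "K \<inter> - \<Omega> = {}" using assms by auto
  then obtain d where d: "d > 0" "\<And>p q. p \<in> K \<Longrightarrow> q \<in> - \<Omega> \<Longrightarrow> d \<le> dist p q"
    using separate_compact_closed[of K "- \<Omega>"] assms by (auto simp: closed_Compl)
  have "K \<subseteq> inner_part \<Omega> (d/2)"
  proof
    fix x assume x: "x \<in> K"
    have "y \<in> \<Omega>" if "y \<in> cball x (d/2)" for y
      using d(2)[OF x, of y] that d(1) by (cases "y \<in> \<Omega>") auto
    then show "x \<in> inner_part \<Omega> (d/2)" by (auto simp: inner_part_def)
  qed
  then show thesis using d(1) by (intro that[of "d/2"]) auto
qed

lemma C1c_partial_component:
  fixes \<phi> :: "real^'n::finite \<Rightarrow> real^'n"
  assumes "\<phi> \<in> C1c \<Omega>"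
  shows "((\<lambda>t. \<phi> (x + t *\<^sub>R axis i 1) $ i) has_real_derivative partial i \<phi> (x + t *\<^sub>R axis i 1) $ i) (at t)"
proof -
  let ?e = "axis i 1 :: real^'n"
  have "\<phi> differentiable (at (x + t *\<^sub>R ?e))" using assms by (simp add: C1c_def)
  then have d: "(\<phi> has_derivative frechet_derivative \<phi> (at (x + t *\<^sub>R ?e))) (at (x + t *\<^sub>R ?e))"
    by (simp add: frechet_derivative_works)
  have "((\<lambda>t. x + t *\<^sub>R ?e) has_derivative (\<lambda>v. v *\<^sub>R ?e)) (at t)"
    by (auto intro!: derivative_eq_intros)
  from bounded_linear.has_derivative[OF bounded_linear_vec_nth has_derivative_compose[OF this d]]
  have "((\<lambda>t. \<phi> (x + t *\<^sub>R ?e) $ i) has_derivative (\<lambda>v. frechet_derivative \<phi> (at (x + t *\<^sub>R ?e)) (v *\<^sub>R ?e) $ i)) (at t)" .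
  moreover have "frechet_derivative \<phi> (at (x + t *\<^sub>R ?e)) (v *\<^sub>R ?e) = v *\<^sub>R frechet_derivative \<phi> (at (x + t *\<^sub>R ?e)) ?e" for v
    using has_derivative_bounded_linear[OF d] linear_scale bounded_linear.linear by blast
  ultimately show ?thesis
    by (simp add: has_field_derivative_def partial_def mult_commute_abs)
qed

text \<open>Integrating \<open>w\<close> against a difference quotient of the test function equals
  integrating a difference quotient of \<open>w\<close> against the test function, which the
  translation bound controls by \<open>C\<close>. Dominated convergence replaces the quotient by the
  partial derivative.\<close>

lemma variation_bound:
  fixes \<phi> :: "real^'n::finite \<Rightarrow> real^'n" and w :: "real^'n \<Rightarrow> real"
  assumes Om: "open \<Omega>" "bounded \<Omega>" and \<phi>: "\<phi> \<in> C1c \<Omega>" "\<And>x. norm (\<phi> x) \<le> 1"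
    and w[measurable]: "w \<in> borel_measurable borel" and bd: "\<And>x. \<bar>w x\<bar> \<le> indicator \<Omega> x" and C: "C \<ge> 0"
    and trans: "\<And>t h. t > 0 \<Longrightarrow> norm h \<le> t/2 \<Longrightarrow>
      (\<integral>\<^sup>+x\<in>inner_part \<Omega> t. ennreal \<bar>w (x + h) - w x\<bar> \<partial>lborel) \<le> ennreal (C * norm h)"
  shows "integrable lborel (\<lambda>x. w x * partial i \<phi> x $ i)" "(LINT x|lborel. w x * partial i \<phi> x $ i) \<le> C"
proof -
  let ?e = "axis i 1 :: real^'n"
  have [measurable]: "\<Omega> \<in> sets borel" "\<And>t. inner_part \<Omega> t \<in> sets borel"
    using Om borel_inner_part by auto
  have int_ind: "integrable lborel (indicator \<Omega> :: real^'n \<Rightarrow> real)"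
    using emeasure_bounded_finite[OF Om(2)] by (intro integrable_real_indicator) auto
  have int_w: "integrable lborel w"
    by (rule Bochner_Integration.integrable_bound[OF int_ind]) (use bd in \<open>auto simp: indicator_def\<close>)
  have diff: "\<And>x. \<phi> differentiable (at x)" and cont': "continuous_on UNIV (partial i \<phi>)"
    and K: "compact (closure {x. \<phi> x \<noteq> 0})" "closure {x. \<phi> x \<noteq> 0} \<subseteq> \<Omega>"
    using \<phi>(1) by (auto simp: C1c_def)
  have cont: "continuous_on UNIV \<phi>"
    by (rule differentiable_imp_continuous_on) (auto intro: differentiable_at_imp_differentiable_on diff)
  have [measurable]: "(\<lambda>x. \<phi> x $ i) \<in> borel_measurable borel" "(\<lambda>x. partial i \<phi> x $ i) \<in> borel_measurable borel"
    by (intro borel_measurable_continuous_onI continuous_intros cont cont')+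
  obtain t where t: "t > 0" "closure {x. \<phi> x \<noteq> 0} \<subseteq> inner_part \<Omega> t"
    using compact_subset_inner_part[OF Om(1) K] by blast
  then have \<phi>0: "\<phi> x = 0" if "x \<notin> inner_part \<Omega> t" for x
    using that closure_subset[of "{x. \<phi> x \<noteq> 0}"] by auto
  have \<phi>1: "\<bar>\<phi> x $ i\<bar> \<le> 1" for x using component_le_norm_cart[of "\<phi> x" i] \<phi>(2)[of x] by linarith
  \<comment> \<open>The radius is enlarged by 1 because the derivative is evaluated up to distance 1
    from points of \<open>\<Omega>\<close>; this bounds the difference quotients by one
    constant.\<close>
  obtain R where R: "\<And>x. x \<in> \<Omega> \<Longrightarrow> norm x \<le> R" using Om(2) by (auto simp: bounded_iff)
  obtain B where B: "\<And>x. x \<in> cball 0 (R + 1) \<Longrightarrow> norm (partial i \<phi> x) \<le> B"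
  proof -
    have "bounded (partial i \<phi> ` cball 0 (R + 1))"
      by (intro compact_imp_bounded compact_continuous_image continuous_on_subset[OF cont']) auto
    then obtain B where "\<forall>x\<in>cball 0 (R + 1). norm (partial i \<phi> x) \<le> B" by (auto simp: bounded_iff)
    then show thesis by (intro that) blast
  qed
  have B': "\<bar>partial i \<phi> (x + s *\<^sub>R ?e) $ i\<bar> \<le> B" if "x \<in> \<Omega>" "\<bar>s\<bar> \<le> 1" for x s
  proof -
    have "norm (x + s *\<^sub>R ?e) \<le> norm x + norm (s *\<^sub>R ?e)" by (rule norm_triangle_ineq)
    also have "\<dots> \<le> R + 1" using R[OF that(1)] that(2) by (simp add: norm_axis_1)
    finally have "norm (partial i \<phi> (x + s *\<^sub>R ?e)) \<le> B" by (intro B) simp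
    then show ?thesis using component_le_norm_cart[of "partial i \<phi> (x + s *\<^sub>R ?e)" i] by linarith
  qed
  have int_B: "integrable lborel (\<lambda>x. B * indicat_real \<Omega> x)" using int_ind by simp
  show "integrable lborel (\<lambda>x. w x * partial i \<phi> x $ i)"
  proof (rule Bochner_Integration.integrable_bound[OF int_B])
    have "\<bar>w x\<bar> * \<bar>partial i \<phi> x $ i\<bar> \<le> \<bar>B * indicat_real \<Omega> x\<bar>" for x
    proof (cases "x \<in> \<Omega>")
      case True
      then have "\<bar>w x\<bar> * \<bar>partial i \<phi> x $ i\<bar> \<le> 1 * B"
        using bd[of x] B'[of x 0] by (intro mult_mono) auto
      then show ?thesis using True by simp
    next
      case False then show ?thesis using bd[of x] by simp
    qed
    then show "AE x in lborel. norm (w x * partial i \<phi> x $ i) \<le> norm (B * indicat_real \<Omega> x)"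
      by (simp add: abs_mult)
  qed measurable
  \<comment> \<open>Steps below \<open>t/2\<close> are admissible translations on the inner part
    carrying the support of \<open>\<phi>\<close>; steps below 1 stay within the range of the bound
    \<open>B\<close>.\<close>
  define s where "s n = min (t/2) 1 / real (Suc n)" for n
  have s: "s n > 0" "s n \<le> t/2" "s n \<le> 1" for n
  proof -
    show "s n > 0" using t by (simp add: s_def)
    have "s n \<le> min (t/2) 1 / 1" unfolding s_def using t by (intro divide_left_mono) auto
    then show "s n \<le> t/2" "s n \<le> 1" by auto
  qed
  have s0: "s \<longlonglongrightarrow> 0" unfolding s_def using LIMSEQ_Suc[OF lim_const_over_n[of "min (t/2) 1"]] by simp
  let ?\<phi> = "\<lambda>n x. \<phi> (x + s n *\<^sub>R ?e) $ i" and ?w = "\<lambda>n x. w (x - s n *\<^sub>R ?e)"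
  define F where "F n x = w x * ((?\<phi> n x - \<phi> x $ i) / s n)" for n x
  have F_le: "(LINT x|lborel. F n x) \<le> C" for n
  proof -
    have int1: "integrable lborel (\<lambda>x. w x * \<phi> x $ i)"
      by (rule Bochner_Integration.integrable_bound[OF int_w]) (use \<phi>1 in \<open>auto simp: abs_mult mult_left_le\<close>)
    have int2: "integrable lborel (\<lambda>x. w x * ?\<phi> n x)"
    proof (rule Bochner_Integration.integrable_bound[OF int_w])
      show "(\<lambda>x. w x * ?\<phi> n x) \<in> borel_measurable lborel"
        using measurable_compose[of "\<lambda>x. x + s n *\<^sub>R ?e" lborel borel "\<lambda>x. \<phi> x $ i" borel] by simp
    qed (use \<phi>1 in \<open>auto simp: abs_mult mult_left_le\<close>)
    have [measurable]: "(\<lambda>x. ?w n x) \<in> borel_measurable borel" by measurable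
    have int3: "integrable lborel (\<lambda>x. ?w n x * \<phi> x $ i)"
    proof -
      have "integrable (distr lborel borel ((+) (- (s n *\<^sub>R ?e)))) (\<lambda>x. w x * ?\<phi> n x)"
        using int2 by (simp only: lborel_distr_plus)
      then show ?thesis
        by (subst (asm) integrable_distr_eq) (use int2 in \<open>auto simp: add.commute\<close>)
    qed
    have "(LINT x|lborel. F n x) = (LINT x|lborel. (w x * ?\<phi> n x - w x * \<phi> x $ i) / s n)"
      unfolding F_def by (intro Bochner_Integration.integral_cong refl) (simp add: right_diff_distrib)
    also have "\<dots> = ((LINT x|lborel. w x * ?\<phi> n x) - (LINT x|lborel. w x * \<phi> x $ i)) / s n"
      using int1 int2 by simp
    \<comment> \<open>Discrete integration by parts: the shift passes from the test function to
      \<open>w\<close>.\<close>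
    also have "(LINT x|lborel. w x * ?\<phi> n x) = (LINT x|lborel. ?w n x * \<phi> x $ i)"
      using integral_lborel_translate[of "\<lambda>x. ?w n x * \<phi> x $ i" "s n *\<^sub>R ?e"] by simp
    also have "(LINT x|lborel. ?w n x * \<phi> x $ i) - (LINT x|lborel. w x * \<phi> x $ i)
      = (LINT x|lborel. (?w n x - w x) * \<phi> x $ i)"
      using int1 int3 by (simp add: left_diff_distrib)
    also have "\<dots> \<le> C * s n"
    proof -
      let ?I = "LINT x|lborel. (?w n x - w x) * \<phi> x $ i"
      have "ennreal \<bar>?I\<bar> \<le> (\<integral>\<^sup>+x. ennreal (norm ((?w n x - w x) * \<phi> x $ i)) \<partial>lborel)"
        using int1 int3 integral_norm_bound_ennreal[of lborel "\<lambda>x. (?w n x - w x) * \<phi> x $ i"]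
        by (simp add: left_diff_distrib)
      also have "\<dots> \<le> (\<integral>\<^sup>+x\<in>inner_part \<Omega> t. ennreal \<bar>w (x + - (s n *\<^sub>R ?e)) - w x\<bar> \<partial>lborel)"
      proof (intro nn_integral_mono)
        fix x
        show "ennreal (norm ((?w n x - w x) * \<phi> x $ i)) \<le> ennreal \<bar>w (x + - (s n *\<^sub>R ?e)) - w x\<bar> * indicator (inner_part \<Omega> t) x"
          using \<phi>1[of x] \<phi>0[of x] by (cases "x \<in> inner_part \<Omega> t") (auto simp: abs_mult mult_left_le intro!: ennreal_leI)
      qed
      also have "\<dots> \<le> ennreal (C * norm (- (s n *\<^sub>R ?e)))"
        using s[of n] t by (intro trans) (auto simp: norm_axis_1)
      also have "\<dots> = ennreal (C * s n)" using s(1)[of n] by (simp add: norm_axis_1)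
      finally have "\<bar>?I\<bar> \<le> C * s n" using C s(1)[of n] by (subst (asm) ennreal_le_iff) auto
      then show ?thesis by linarith
    qed
    finally show ?thesis using s(1)[of n] by (simp add: divide_right_mono field_simps)
  qed
  have "(\<lambda>n. LINT x|lborel. F n x) \<longlonglongrightarrow> (LINT x|lborel. w x * partial i \<phi> x $ i)"
  proof (rule integral_dominated_convergence[OF _ _ int_B])
    show "AE x in lborel. (\<lambda>n. F n x) \<longlonglongrightarrow> w x * partial i \<phi> x $ i"
    proof (intro AE_I2)
      fix x
      have "((\<lambda>h. (\<phi> (x + (0 + h) *\<^sub>R ?e) $ i - \<phi> (x + 0 *\<^sub>R ?e) $ i) / h) \<longlongrightarrow> partial i \<phi> (x + 0 *\<^sub>R ?e) $ i) (at 0)"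
        using C1c_partial_component[OF \<phi>(1), of x i 0] unfolding DERIV_def .
      moreover have "filterlim s (at 0) sequentially"
        using s0 s(1) by (intro filterlim_atI) (auto simp: less_imp_neq[symmetric])
      ultimately have "(\<lambda>n. (\<phi> (x + (0 + s n) *\<^sub>R ?e) $ i - \<phi> (x + 0 *\<^sub>R ?e) $ i) / s n) \<longlonglongrightarrow> partial i \<phi> (x + 0 *\<^sub>R ?e) $ i"
        by (rule filterlim_compose)
      then show "(\<lambda>n. F n x) \<longlonglongrightarrow> w x * partial i \<phi> x $ i"
        unfolding F_def by (intro tendsto_mult_left) simp
    qed
    show "AE x in lborel. norm (F n x) \<le> B * indicat_real \<Omega> x" for n
    proof (intro AE_I2)
      fix x
      show "norm (F n x) \<le> B * indicat_real \<Omega> x"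
      proof (cases "x \<in> \<Omega>")
        case True
        have "norm (?\<phi> n x - \<phi> (x + 0 *\<^sub>R ?e) $ i) \<le> B * norm (s n - 0)"
        proof (rule field_differentiable_bound[where S="{0..1}"])
          show "((\<lambda>t. \<phi> (x + t *\<^sub>R ?e) $ i) has_field_derivative partial i \<phi> (x + z *\<^sub>R ?e) $ i) (at z within {0..1})" for z
            using C1c_partial_component[OF \<phi>(1), of x i z] by (rule has_field_derivative_at_within)
          show "norm (partial i \<phi> (x + z *\<^sub>R ?e) $ i) \<le> B" if "z \<in> {0..1}" for z
            using B'[OF True, of z] that by simp
        qed (use s[of n] in auto)
        then have "\<bar>(?\<phi> n x - \<phi> x $ i) / s n\<bar> \<le> B"
          using s(1)[of n] by (simp add: divide_le_eq)
        then have "\<bar>w x\<bar> * \<bar>(?\<phi> n x - \<phi> x $ i) / s n\<bar> \<le> 1 * B"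
          using bd[of x] True by (intro mult_mono) auto
        then show ?thesis using True by (simp add: F_def abs_mult)
      next
        case False then show ?thesis using bd[of x] by (simp add: F_def)
      qed
    qed
    have "(\<lambda>x. ?\<phi> n x) \<in> borel_measurable borel" for n
      using measurable_compose[of "\<lambda>x. x + s n *\<^sub>R ?e" borel borel "\<lambda>x. \<phi> x $ i" borel] by simp
    then show "F n \<in> borel_measurable lborel" for n unfolding F_def[abs_def] by simp
  qed measurable
  then show "(LINT x|lborel. w x * partial i \<phi> x $ i) \<le> C"
    using F_le by (intro LIMSEQ_le_const2) auto
qed

text \<open>Each coordinate direction contributes at most \<open>C\<close>, independently of the
  test field. The dimension as a factor is not sharp, but only finiteness is claimed.\<close>

lemma finite_perimeter_translation:
  fixes \<Omega> E :: "(real^'n::finite) set"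
  assumes Om: "open \<Omega>" "bounded \<Omega>" and E[measurable]: "E \<in> sets borel" and sub: "E \<subseteq> \<Omega>" and C: "C \<ge> 0"
    and trans: "\<And>t h. t > 0 \<Longrightarrow> norm h \<le> t/2 \<Longrightarrow>
      (\<integral>\<^sup>+x\<in>inner_part \<Omega> t. ennreal \<bar>indicator E (x + h) - indicator E x\<bar> \<partial>lborel) \<le> ennreal (C * norm h)"
  shows "finite_perimeter E \<Omega>"
proof -
  have EO: "E \<inter> \<Omega> = E" using sub by auto
  have "perimeter E \<Omega> \<le> ereal (real CARD('n) * C)"
    unfolding perimeter_def
  proof (rule SUP_least)
    fix \<phi> :: "real^'n \<Rightarrow> real^'n" assume "\<phi> \<in> {\<phi> \<in> C1c \<Omega>. \<forall>x. norm (\<phi> x) \<le> 1}"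
    then have \<phi>: "\<phi> \<in> C1c \<Omega>" "\<And>x. norm (\<phi> x) \<le> 1" by auto
    have bd: "\<bar>indicat_real E x\<bar> \<le> indicator \<Omega> x" for x using sub by (auto simp: indicator_def)
    have [measurable]: "(\<lambda>x. partial i \<phi> x $ i) \<in> borel_measurable borel" for i
      using \<phi>(1) by (intro borel_measurable_continuous_onI continuous_intros) (simp add: C1c_def)
    note v = variation_bound[OF Om \<phi> _ bd C trans]
    have "(LINT x|lebesgue_on (E \<inter> \<Omega>). divergence \<phi> x) = (LINT x|lebesgue. indicator E x *\<^sub>R divergence \<phi> x)"
      unfolding EO by (subst integral_restrict_space) auto
    also have "\<dots> = (LINT x|lborel. indicator E x *\<^sub>R divergence \<phi> x)"
      unfolding divergence_def by (rule integral_completion) measurable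
    also have "\<dots> = (LINT x|lborel. (\<Sum>i\<in>UNIV. indicator E x * partial i \<phi> x $ i))"
      by (simp add: divergence_def sum_distrib_left)
    also have "\<dots> = (\<Sum>i\<in>UNIV. LINT x|lborel. indicator E x * partial i \<phi> x $ i)"
      by (rule Bochner_Integration.integral_sum) (rule v(1), auto)
    also have "\<dots> \<le> of_nat (card (UNIV :: 'n set)) * C"
      by (rule sum_bounded_above) (rule v(2), auto)
    finally show "ereal (LINT x|lebesgue_on (E \<inter> \<Omega>). divergence \<phi> x) \<le> ereal (real CARD('n) * C)" by simp
  qed
  then show ?thesis unfolding finite_perimeter_def EO by auto
qed

section \<open>Borel representatives, and the estimates extracted from the energy\<close>

lemma borel_representative:
  fixes h :: "'a::euclidean_space \<Rightarrow> 'b::euclidean_space"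
  assumes h: "h \<in> borel_measurable (lebesgue_on \<Omega>)" and Om[measurable]: "\<Omega> \<in> sets borel"
  obtains f where "f \<in> borel_measurable borel" "\<And>x. x \<notin> \<Omega> \<Longrightarrow> f x = 0" "AE x in lborel. x \<in> \<Omega> \<longrightarrow> f x = h x"
proof -
  have hm: "(\<lambda>x. indicator \<Omega> x *\<^sub>R h x) \<in> borel_measurable lebesgue"
    using h by (subst (asm) borel_measurable_restrict_space_iff) auto
  have "\<exists>g. g \<in> borel_measurable lborel \<and> (AE x in lborel. (indicator \<Omega> x *\<^sub>R h x) \<bullet> b = g x)" for b
  proof -
    have "(\<lambda>x. (indicator \<Omega> x *\<^sub>R h x) \<bullet> b) \<in> borel_measurable lebesgue"
      using hm by (rule borel_measurable_inner) simp
    from completion_ex_borel_measurable_real[OF this] show ?thesis by blast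
  qed
  then obtain g where g: "\<And>b. g b \<in> borel_measurable lborel" "\<And>b. AE x in lborel. (indicator \<Omega> x *\<^sub>R h x) \<bullet> b = g b x"
    by metis
  note [measurable] = g(1)
  \<comment> \<open>Reassembled from Borel versions of the coordinates and cut off by the indicator,
    so that products, translates and Fubini's theorem are available on the whole space.\<close>
  define f where "f x = indicator \<Omega> x *\<^sub>R (\<Sum>b\<in>Basis. g b x *\<^sub>R b)" for x
  show thesis
  proof
    have "f \<in> borel_measurable lborel" unfolding f_def[abs_def] by measurable
    then show "f \<in> borel_measurable borel" by simp
    show "f x = 0" if "x \<notin> \<Omega>" for x using that by (simp add: f_def)
    have "AE x in lborel. \<forall>b\<in>Basis. (indicator \<Omega> x *\<^sub>R h x) \<bullet> b = g b x"
      using g(2) by (subst AE_finite_all) auto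
    then show "AE x in lborel. x \<in> \<Omega> \<longrightarrow> f x = h x"
    proof eventually_elim
      case (elim x)
      show ?case
      proof
        assume x: "x \<in> \<Omega>"
        then have "f x = (\<Sum>b\<in>Basis. (h x \<bullet> b) *\<^sub>R b)" using elim by (simp add: f_def)
        then show "f x = h x" by (simp add: euclidean_representation)
      qed
    qed
  qed
qed

text \<open>\<open>weak_gradient\<close> is an arbitrary choice among all weak gradients, so its
  measurability has to come from local integrability, glued over a countable compact
  exhaustion.\<close>

lemma locally_integrable_on_measurable:
  fixes h :: "real^'n::finite \<Rightarrow> 'b::{banach, second_countable_topology}"
  assumes "open \<Omega>" "locally_integrable_on \<Omega> h"
  shows "h \<in> borel_measurable (lebesgue_on \<Omega>)"
proof -
  obtain C :: "nat \<Rightarrow> (real^'n) set" where C: "\<And>n. compact (C n)" "\<And>n. C n \<subseteq> \<Omega>" "\<Union>(range C) = \<Omega>"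
    using open_Union_compact_subsets[OF assms(1)] by metis
  have CL: "C n \<in> sets lebesgue" for n using C(1)[of n] by (simp add: borel_compact)
  have OL: "\<Omega> \<in> sets lebesgue" using assms(1) by simp
  show ?thesis
  proof (rule measurable_piecewise_restrict[where C="range C"])
    fix K assume "K \<in> range C"
    then obtain n where n: "K = C n" by auto
    have Ks: "\<Omega> \<inter> K = K" using C(2) n by auto
    show "K \<inter> space (lebesgue_on \<Omega>) \<in> sets (lebesgue_on \<Omega>)"
      using CL[of n] OL C(2)[of n] n by (auto simp: sets_restrict_space space_restrict_space)
    have "restrict_space (lebesgue_on \<Omega>) K = lebesgue_on K"
      using CL[of n] OL n by (subst restrict_restrict_space) (simp_all only: n Ks[unfolded n] space_completion space_lborel space_borel Int_UNIV_right)
    moreover have "integrable (lebesgue_on K) h"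
      using assms(2) C n unfolding locally_integrable_on_def by blast
    ultimately show "h \<in> borel_measurable (restrict_space (lebesgue_on \<Omega>) K)" by simp
  qed (use C(3) in \<open>auto simp: space_restrict_space\<close>)
qed

text \<open>The nonnegative integral is a lower integral, insensitive to completion and to null
  sets. This covers integrands such as \<open>W (x /\<^sub>R \<delta>) (u x)\<close>, for which no
  measurability has been established.\<close>

lemma nn_integral_representative:
  assumes Om: "\<Omega> \<in> sets borel" and eq: "AE x in lborel. x \<in> \<Omega> \<longrightarrow> F x = H x"
  shows "(\<integral>\<^sup>+x. H x \<partial>lebesgue_on \<Omega>) = (\<integral>\<^sup>+x\<in>\<Omega>. F x \<partial>(lborel :: 'a::euclidean_space measure))"
proof -
  have "(\<integral>\<^sup>+x. H x \<partial>lebesgue_on \<Omega>) = (\<integral>\<^sup>+x\<in>\<Omega>. H x \<partial>lebesgue)"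
    using Om by (subst nn_integral_restrict_space) auto
  also have "\<dots> = (\<integral>\<^sup>+x\<in>\<Omega>. H x \<partial>lborel)" by (rule nn_integral_completion)
  also have "\<dots> = (\<integral>\<^sup>+x\<in>\<Omega>. F x \<partial>lborel)"
    by (intro nn_integral_cong_AE) (use eq in eventually_elim, auto simp: indicator_def)
  finally show ?thesis .
qed

lemma integral_representative:
  fixes F H :: "'a::euclidean_space \<Rightarrow> real"
  assumes Om: "\<Omega> \<in> sets borel" and F[measurable]: "F \<in> borel_measurable borel" and F0: "\<And>x. x \<notin> \<Omega> \<Longrightarrow> F x = 0"
    and H: "H \<in> borel_measurable (lebesgue_on \<Omega>)"
    and eq: "AE x in lborel. x \<in> \<Omega> \<longrightarrow> F x = H x"
  shows "(LINT x|lebesgue_on \<Omega>. H x) = (LINT x|lborel. F x)"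
proof -
  have Hm: "(\<lambda>x. indicator \<Omega> x *\<^sub>R H x) \<in> borel_measurable lebesgue"
    using H Om by (subst (asm) borel_measurable_restrict_space_iff) auto
  have "(LINT x|lebesgue_on \<Omega>. H x) = (LINT x|lebesgue. indicator \<Omega> x *\<^sub>R H x)"
    using Om by (subst integral_restrict_space) auto
  also have "\<dots> = (LINT x|lebesgue. F x)"
  proof (rule integral_cong_AE[OF Hm])
    show "F \<in> borel_measurable lebesgue" using F by (simp add: measurable_completion)
    show "AE x in lebesgue. indicator \<Omega> x *\<^sub>R H x = F x"
      unfolding AE_completion_iff using eq by eventually_elim (auto simp: indicator_def F0)
  qed
  also have "\<dots> = (LINT x|lborel. F x)" by (rule integral_completion) simp
  finally show ?thesis .
qed

text \<open>Each of the two nonnegative terms is bounded by the energy: the gradient term gives the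
  Dirichlet bound \<open>E / \<epsilon>\<close>, hence the translation estimate, and the other is
  the potential bound.\<close>

lemma energy_representative:
  fixes W :: "real^'n::finite \<Rightarrow> real^'m::finite \<Rightarrow> real"
  assumes Om: "open \<Omega>" "bounded \<Omega>" and \<epsilon>: "\<epsilon> > 0" and Wnn: "\<And>x z. 0 \<le> W x z" and E: "E \<ge> 0"
    and u: "u \<in> L1_space \<Omega>" and en: "energy W \<Omega> \<epsilon> \<delta> u \<le> ennreal E"
  obtains f where "f \<in> borel_measurable borel" "AE x in lborel. x \<in> \<Omega> \<longrightarrow> f x = u x"
    "translation_L2_bound \<Omega> f (E / \<epsilon>)"
    "(\<integral>\<^sup>+x\<in>\<Omega>. ennreal (1 / \<epsilon> * W (x /\<^sub>R \<delta>) (f x)) \<partial>lborel) \<le> ennreal E"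
proof -
  have OmB[measurable]: "\<Omega> \<in> sets borel" using Om by simp
  have fin: "emeasure lborel \<Omega> < \<infinity>" by (rule emeasure_bounded_finite[OF Om(2)])
  \<comment> \<open>Outside this space the energy is infinite by definition.\<close>
  have W12: "u \<in> W12_space \<Omega>" using en by (auto simp: energy_def top_unique split: if_splits)
  define G where "G = weak_gradient \<Omega> u"
  have hw: "has_weak_gradient \<Omega> u G"
    using W12 unfolding G_def weak_gradient_def W12_space_def by (auto intro: someI[of "has_weak_gradient \<Omega> u"])
  have um: "u \<in> borel_measurable (lebesgue_on \<Omega>)" using u by (simp add: L1_space_def)
  have Gm: "G \<in> borel_measurable (lebesgue_on \<Omega>)"
    using hw locally_integrable_on_measurable[OF Om(1), of G] by (simp add: has_weak_gradient_def)
  obtain f where f[measurable]: "f \<in> borel_measurable borel" and f0: "\<And>x. x \<notin> \<Omega> \<Longrightarrow> f x = 0" and fu: "AE x in lborel. x \<in> \<Omega> \<longrightarrow> f x = u x"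
    using borel_representative[OF um OmB] by blast
  obtain g where g[measurable]: "g \<in> borel_measurable borel" and g0: "\<And>x. x \<notin> \<Omega> \<Longrightarrow> g x = 0" and gG: "AE x in lborel. x \<in> \<Omega> \<longrightarrow> g x = G x"
    using borel_representative[OF Gm OmB] by blast
  let ?N = "\<integral>\<^sup>+x. ennreal ((norm (g x))\<^sup>2) \<partial>lborel"
  let ?e = "\<lambda>x. 1 / \<epsilon> * W (x /\<^sub>R \<delta>) (f x) + \<epsilon> * (norm (g x))\<^sup>2"
  have "(\<integral>\<^sup>+x. ennreal (1 / \<epsilon> * W (x /\<^sub>R \<delta>) (u x) + \<epsilon> * (norm (G x))\<^sup>2) \<partial>lebesgue_on \<Omega>)
    = (\<integral>\<^sup>+x\<in>\<Omega>. ennreal (?e x) \<partial>lborel)"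
    by (rule nn_integral_representative[OF OmB]) (use fu gG in eventually_elim, auto)
  then have en': "(\<integral>\<^sup>+x\<in>\<Omega>. ennreal (?e x) \<partial>lborel) \<le> ennreal E"
    using en W12 by (simp add: energy_def G_def)
  have pot: "(\<integral>\<^sup>+x\<in>\<Omega>. ennreal (1 / \<epsilon> * W (x /\<^sub>R \<delta>) (f x)) \<partial>lborel) \<le> ennreal E"
    by (rule order_trans[OF _ en'], intro nn_integral_mono mult_right_mono ennreal_leI) (use \<epsilon> in auto)
  have grad: "?N \<le> ennreal (E / \<epsilon>)"
  proof -
    have "ennreal \<epsilon> * ?N = (\<integral>\<^sup>+x. ennreal (\<epsilon> * (norm (g x))\<^sup>2) \<partial>lborel)"
      using \<epsilon> by (simp add: ennreal_mult nn_integral_cmult)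
    also have "\<dots> \<le> (\<integral>\<^sup>+x\<in>\<Omega>. ennreal (?e x) \<partial>lborel)"
    proof (intro nn_integral_mono)
      fix x
      show "ennreal (\<epsilon> * (norm (g x))\<^sup>2) \<le> ennreal (?e x) * indicator \<Omega> x"
        using \<epsilon> Wnn[of "x /\<^sub>R \<delta>" "f x"] g0[of x] by (cases "x \<in> \<Omega>") (auto intro!: ennreal_leI)
    qed
    also note en'
    finally have *: "ennreal \<epsilon> * ?N \<le> ennreal E" .
    have "?N = ennreal (1/\<epsilon>) * (ennreal \<epsilon> * ?N)"
      using \<epsilon> by (simp add: mult.assoc[symmetric] ennreal_mult[symmetric])
    also have "\<dots> \<le> ennreal (1/\<epsilon>) * ennreal E" using * by (intro mult_left_mono) auto
    also have "\<dots> = ennreal (1/\<epsilon> * E)" using E \<epsilon> by (intro ennreal_mult[symmetric]) auto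
    finally show ?thesis by simp
  qed
  have int_f: "integrable lborel f"
  proof -
    have "(\<integral>\<^sup>+x. ennreal (norm (f x)) \<partial>lborel) = (\<integral>\<^sup>+x\<in>\<Omega>. ennreal (norm (f x)) \<partial>lborel)"
      by (intro nn_integral_cong) (auto simp: indicator_def f0)
    also have "\<dots> = (\<integral>\<^sup>+x. ennreal (norm (u x)) \<partial>lebesgue_on \<Omega>)"
      by (rule nn_integral_representative[OF OmB, symmetric]) (use fu in eventually_elim, auto)
    also have "\<dots> < \<infinity>" using u by (simp add: L1_space_def integrable_iff_bounded)
    finally show ?thesis by (simp add: integrable_iff_bounded)
  qed
  \<comment> \<open>The chosen gradient is only locally integrable a priori. Its square is
    integrable by the energy bound, and \<open>\<Omega>\<close> has finite measure.\<close>
  have int_g: "integrable lborel g"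
  proof -
    have "(\<integral>\<^sup>+x. ennreal (norm (g x)) \<partial>lborel) \<le> (\<integral>\<^sup>+x. indicator \<Omega> x + ennreal ((norm (g x))\<^sup>2) \<partial>lborel)"
    proof (intro nn_integral_mono)
      fix x
      have "2 * norm (g x) \<le> 1 + (norm (g x))\<^sup>2"
        using zero_le_power2[of "norm (g x) - 1"] unfolding power2_diff by simp
      then have "norm (g x) \<le> 1 + (norm (g x))\<^sup>2"
        using norm_ge_zero[of "g x"] by linarith
      then have "ennreal (norm (g x)) \<le> ennreal (1 + (norm (g x))\<^sup>2)" by (rule ennreal_leI)
      then show "ennreal (norm (g x)) \<le> indicator \<Omega> x + ennreal ((norm (g x))\<^sup>2)"
        using g0[of x] by (cases "x \<in> \<Omega>") auto
    qed
    also have "\<dots> = emeasure lborel \<Omega> + ?N"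
      by (subst nn_integral_add) auto
    also have "\<dots> < \<infinity>" using fin le_less_trans[OF grad ennreal_less_top] by simp
    finally show ?thesis by (simp add: integrable_iff_bounded)
  qed
  have [measurable]: "(\<lambda>x. f x $ j) \<in> borel_measurable borel" for j
    using measurable_compose[OF f, of "\<lambda>v. v $ j" borel] by (simp add: borel_measurable_continuous_onI continuous_on_component)
  have [measurable]: "(\<lambda>x. g x $ j $ i) \<in> borel_measurable borel" for i j
    using measurable_compose[OF g, of "\<lambda>v. v $ j $ i" borel] by (simp add: borel_measurable_continuous_onI continuous_on_component)
  interpret weak_gradient_on \<Omega> f g
  proof
    fix \<phi> :: "real^'n \<Rightarrow> real" and i j
    assume \<phi>: "\<phi> \<in> C1c \<Omega>"
    have cont': "continuous_on UNIV (partial i \<phi>)" and diff: "\<And>x. \<phi> differentiable (at x)"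
      using \<phi> by (auto simp: C1c_def)
    have cont: "continuous_on UNIV \<phi>"
      by (rule differentiable_imp_continuous_on) (auto intro: differentiable_at_imp_differentiable_on diff)
    have [measurable]: "\<phi> \<in> borel_measurable borel" "partial i \<phi> \<in> borel_measurable borel"
      by (intro borel_measurable_continuous_onI cont cont')+
    have r: "\<psi> \<in> borel_measurable (lebesgue_on \<Omega>)" if "\<psi> \<in> borel_measurable borel" for \<psi> :: "real^'n \<Rightarrow> real"
      using that by (intro measurable_restrict_space1 measurable_completion) simp
    have uj: "(\<lambda>x. u x $ j) \<in> borel_measurable (lebesgue_on \<Omega>)"
      using measurable_compose[OF um, of "\<lambda>v. v $ j" borel] by (simp add: borel_measurable_continuous_onI continuous_on_component)
    have Gj: "(\<lambda>x. G x $ j $ i) \<in> borel_measurable (lebesgue_on \<Omega>)"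
      using measurable_compose[OF Gm, of "\<lambda>v. v $ j $ i" borel] by (simp add: borel_measurable_continuous_onI continuous_on_component)
    have "(LINT y|lborel. f y $ j * partial i \<phi> y) = (LINT y|lebesgue_on \<Omega>. u y $ j * partial i \<phi> y)"
    proof (rule integral_representative[OF OmB, symmetric])
      show "(\<lambda>y. u y $ j * partial i \<phi> y) \<in> borel_measurable (lebesgue_on \<Omega>)"
        by (intro borel_measurable_times uj r) measurable
      show "AE y in lborel. y \<in> \<Omega> \<longrightarrow> f y $ j * partial i \<phi> y = u y $ j * partial i \<phi> y"
        using fu by eventually_elim simp
    qed (simp_all add: f0)
    also have "\<dots> = - (LINT y|lebesgue_on \<Omega>. G y $ j $ i * \<phi> y)"
      using hw \<phi> by (simp add: has_weak_gradient_def)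
    also have "(LINT y|lebesgue_on \<Omega>. G y $ j $ i * \<phi> y) = (LINT y|lborel. g y $ j $ i * \<phi> y)"
    proof (rule integral_representative[OF OmB])
      show "(\<lambda>y. G y $ j $ i * \<phi> y) \<in> borel_measurable (lebesgue_on \<Omega>)"
        by (intro borel_measurable_times Gj r) measurable
      show "AE y in lborel. y \<in> \<Omega> \<longrightarrow> g y $ j $ i * \<phi> y = G y $ j $ i * \<phi> y"
        using gG by eventually_elim simp
    qed (simp_all add: g0)
    finally show "(LINT y|lborel. f y $ j * partial i \<phi> y) = - (LINT y|lborel. g y $ j $ i * \<phi> y)" .
  qed (rule Om(1) int_f int_g)+
  have "translation_L2_bound \<Omega> f (E / \<epsilon>)"
    unfolding translation_L2_bound_def
  proof (intro allI impI)
    fix h :: "real^'n" and t assume "norm h < t"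
    note translation_bound[OF this]
    also have "ennreal ((norm h)\<^sup>2) * ?N \<le> ennreal ((norm h)\<^sup>2) * ennreal (E / \<epsilon>)"
      by (intro mult_left_mono grad) auto
    also have "\<dots> = ennreal ((norm h)\<^sup>2 * (E / \<epsilon>))" using E \<epsilon> by (intro ennreal_mult[symmetric]) auto
    finally show "(\<integral>\<^sup>+x\<in>inner_part \<Omega> t. ennreal ((norm (f (x + h) - f x))\<^sup>2) \<partial>lborel) \<le> ennreal ((norm h)\<^sup>2 * (E / \<epsilon>))" .
  qed
  from that[OF f fu this pot] show thesis .
qed

section \<open>Sequences of bounded energy\<close>

text \<open>The order of the quantifiers matters: \<open>C\<close> does not depend on
  \<open>t\<close>, which affects only the index from which the displacements fit into the inner
  part. This is what later gives a perimeter bound uniform up to the boundary.\<close>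

lemma off_wells_vanish:
  fixes W :: "real^'n::finite \<Rightarrow> real^'m::finite \<Rightarrow> real" and f :: "nat \<Rightarrow> real^'n \<Rightarrow> real^'m"
  assumes Om: "open \<Omega>" and f: "\<And>n. f n \<in> borel_measurable borel" and E: "E \<ge> 0" and s: "s > 0"
    and cont: "AE x in lebesgue_on unit_cube. continuous_on UNIV (W x)"
    and meas: "\<And>z. (\<lambda>x. W x z) \<in> borel_measurable lebesgue"
    and per: "\<And>z. cube_periodic (\<lambda>x. W x z)"
    and nonneg: "\<And>x z. 0 \<le> W x z" and zero: "\<And>x z. W x z = 0 \<longleftrightarrow> z \<in> {a, b}"
    and R: "R > 0" "AE x in lebesgue_on unit_cube. \<forall>z. norm z \<ge> R \<longrightarrow> W x z \<ge> 1 / R * norm z"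
    and eps: "\<And>n. \<epsilon> n > 0" and delta: "\<And>n. \<delta> n > 0" "\<delta> \<longlonglongrightarrow> 0" and ratio: "(\<lambda>n. \<delta> n / \<epsilon> n) \<longlonglongrightarrow> 0"
    and trans: "\<And>n. translation_L2_bound \<Omega> (f n) (E / \<epsilon> n)"
    and pot: "\<And>n. (\<integral>\<^sup>+x\<in>\<Omega>. ennreal (1 / \<epsilon> n * W (x /\<^sub>R \<delta> n) (f n x)) \<partial>lborel) \<le> ennreal E"
  shows "\<exists>C\<ge>0. \<forall>t>0. \<exists>n0. \<forall>n\<ge>n0.
    emeasure lborel {x \<in> inner_part \<Omega> t. f n x \<in> off_wells a b s} \<le> ennreal (C * \<epsilon> n)"
proof -
  have pos: "W x z > 0" if "z \<notin> {a, b}" for x z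
    using nonneg[of x z] zero[of x z] that by (simp add: less_le)
  obtain K c where K: "compact K" "K \<subseteq> unit_cube" "emeasure lborel K > 0" and c: "c > 0"
    "\<And>x z. x \<in> K \<Longrightarrow> z \<in> off_wells a b (s/2) \<Longrightarrow> c \<le> W x z"
    using uniform_positivity_set[where a=a and b=b and s="s/2", OF cont meas pos R] s by auto
  define L where "L = real CARD('n) + 1"
  have L: "L > 0" by (simp add: L_def)
  define m where "m = measure lborel K"
  have m: "emeasure lborel K = ennreal m" "m > 0"
  proof -
    show *: "emeasure lborel K = ennreal m"
      unfolding m_def using emeasure_compact_finite[OF K(1)] by (intro emeasure_eq_ennreal_measure) auto
    show "m > 0" using K(3) unfolding * by simp
  qed
  define \<beta> where "\<beta> = measure lborel (ball (0::real^'n) L)"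
  have \<beta>: "emeasure lborel (ball (0::real^'n) L) = ennreal \<beta>" "\<beta> \<ge> 0"
    unfolding \<beta>_def using emeasure_bounded_finite[of "ball (0::real^'n) L"]
    by (auto intro!: emeasure_eq_ennreal_measure)
  define Q where "Q = E / c + 4 / s\<^sup>2 * (L\<^sup>2 * E)"
  have Q: "Q \<ge> 0" using E c by (simp add: Q_def)
  show ?thesis
  proof (intro exI[of _ "\<beta> * Q / m"] conjI allI impI)
    show "0 \<le> \<beta> * Q / m" using \<beta> Q m by simp
    fix t :: real assume t: "t > 0"
    have "eventually (\<lambda>n. \<delta> n / \<epsilon> n < 1) sequentially" using ratio by (rule order_tendstoD) simp
    moreover have "eventually (\<lambda>n. \<delta> n < t / L) sequentially" using delta(2) by (rule order_tendstoD) (use t L in simp)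
    ultimately have "eventually (\<lambda>n. \<delta> n / \<epsilon> n < 1 \<and> \<delta> n < t / L) sequentially" by (rule eventually_conj)
    then obtain n0 where n0: "\<And>n. n \<ge> n0 \<Longrightarrow> \<delta> n / \<epsilon> n < 1" "\<And>n. n \<ge> n0 \<Longrightarrow> \<delta> n < t / L"
      by (auto simp: eventually_sequentially)
    show "\<exists>n0. \<forall>n\<ge>n0. emeasure lborel {x \<in> inner_part \<Omega> t. f n x \<in> off_wells a b s} \<le> ennreal (\<beta> * Q / m * \<epsilon> n)"
    proof (intro exI[of _ n0] allI impI)
      fix n assume n: "n0 \<le> n"
      have \<delta>\<epsilon>: "\<delta> n \<le> \<epsilon> n" using n0(1)[OF n] eps[of n] by (simp add: field_simps)
      have \<delta>t: "L * \<delta> n < t" using n0(2)[OF n] L by (simp add: field_simps)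
      let ?Y = "{x \<in> inner_part \<Omega> t. f n x \<in> off_wells a b s}"
      \<comment> \<open>The potential is taken with its factor \<open>1 / \<epsilon> n\<close>, so
        \<open>c\<close> is rescaled likewise and the first term becomes
        \<open>E * \<epsilon> n / c\<close>.\<close>
      have "emeasure lborel ?Y * emeasure lborel K
        \<le> emeasure lborel (ball (0::real^'n) L) * ennreal (E / (c / \<epsilon> n) + 4 / s\<^sup>2 * ((L * \<delta> n)\<^sup>2 * (E / \<epsilon> n)))"
        unfolding L_def
      proof (rule off_wells_measure_bound[where W="\<lambda>x z. 1 / \<epsilon> n * W x z", OF K(1,2) _ _ _ Om f s trans pot E])
        show "c / \<epsilon> n \<le> 1 / \<epsilon> n * W x z" if "x \<in> K" "z \<in> off_wells a b (s/2)" for x z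
          using c(2)[OF that] eps[of n] by (simp add: divide_right_mono)
        show "cube_periodic (\<lambda>x. 1 / \<epsilon> n * W x z)" for z using per[of z] by (simp add: cube_periodic_def)
        show "(real CARD('n) + 1) * \<delta> n < t" using \<delta>t by (simp add: L_def)
      qed (use c eps[of n] delta(1) E in \<open>auto intro: less_imp_le\<close>)
      also have "\<dots> \<le> ennreal \<beta> * ennreal (Q * \<epsilon> n)"
        unfolding \<beta>(1)
      proof (intro mult_left_mono ennreal_leI)
        \<comment> \<open>Here \<open>\<delta> n \<le> \<epsilon> n\<close> makes the translation
          cost of order \<open>\<epsilon> n\<close>.\<close>
        have "(L * \<delta> n)\<^sup>2 * (E / \<epsilon> n) \<le> (L * \<epsilon> n)\<^sup>2 * (E / \<epsilon> n)"
          using \<delta>\<epsilon> L E eps[of n] delta(1)[of n] by (intro mult_right_mono power_mono mult_left_mono) auto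
        also have "\<dots> = L\<^sup>2 * E * \<epsilon> n" using eps[of n] by (simp add: power2_eq_square)
        finally have "4 / s\<^sup>2 * ((L * \<delta> n)\<^sup>2 * (E / \<epsilon> n)) \<le> 4 / s\<^sup>2 * (L\<^sup>2 * E * \<epsilon> n)"
          by (intro mult_left_mono) auto
        then show "E / (c / \<epsilon> n) + 4 / s\<^sup>2 * ((L * \<delta> n)\<^sup>2 * (E / \<epsilon> n)) \<le> Q * \<epsilon> n"
          by (simp add: Q_def distrib_right mult.assoc)
      qed simp
      also have "\<dots> = ennreal (\<beta> * (Q * \<epsilon> n))" using \<beta> Q eps[of n] by (intro ennreal_mult[symmetric]) auto
      finally have *: "emeasure lborel ?Y * ennreal m \<le> ennreal (\<beta> * (Q * \<epsilon> n))" unfolding m(1) .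
      have "emeasure lborel ?Y = emeasure lborel ?Y * ennreal m * ennreal (1 / m)"
        using m(2) by (simp add: mult.assoc ennreal_mult[symmetric])
      also have "\<dots> \<le> ennreal (\<beta> * (Q * \<epsilon> n)) * ennreal (1 / m)" using * by (intro mult_right_mono) auto
      also have "\<dots> = ennreal (\<beta> * (Q * \<epsilon> n) * (1 / m))" using \<beta> Q eps[of n] m by (intro ennreal_mult[symmetric]) auto
      finally show "emeasure lborel ?Y \<le> ennreal (\<beta> * Q / m * \<epsilon> n)" by (simp add: mult_ac)
    qed
  qed
qed

text \<open>The linear growth, known almost everywhere in the cube, is extended by periodicity and
  rescaled, then integrated against the energy bound.\<close>

lemma potential_tail_bound:
  fixes W :: "real^'n::finite \<Rightarrow> real^'m::finite \<Rightarrow> real" and f :: "real^'n \<Rightarrow> real^'m"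
  assumes Om[measurable]: "\<Omega> \<in> sets borel" and f[measurable]: "f \<in> borel_measurable borel" and E: "E \<ge> 0"
    and per: "\<And>z. cube_periodic (\<lambda>x. W x z)" and nonneg: "\<And>x z. 0 \<le> W x z"
    and R: "R > 0" "AE x in lebesgue_on unit_cube. \<forall>z. norm z \<ge> R \<longrightarrow> W x z \<ge> 1 / R * norm z"
    and eps: "\<epsilon> > 0" and delta: "\<delta> > 0"
    and pot: "(\<integral>\<^sup>+x\<in>\<Omega>. ennreal (1 / \<epsilon> * W (x /\<^sub>R \<delta>) (f x)) \<partial>lborel) \<le> ennreal E"
  shows "(\<integral>\<^sup>+x\<in>\<Omega>. ennreal (norm (f x) - R) \<partial>lborel) \<le> ennreal (R * E * \<epsilon>)"
proof -
  \<comment> \<open>Conversion to \<open>ennreal\<close> sends negative numbers to 0, so this is the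
    integral of the positive part.\<close>
  let ?T = "\<integral>\<^sup>+x\<in>\<Omega>. ennreal (norm (f x) - R) \<partial>lborel"
  have "cube_periodic (\<lambda>x. \<forall>z. norm z \<ge> R \<longrightarrow> W x z \<ge> 1 / R * norm z)"
    using per unfolding cube_periodic_def by simp
  from AE_lborel_scale[OF AE_periodic_extension[OF R(2) this] delta]
  have growth: "AE x in lborel. \<forall>z. norm z \<ge> R \<longrightarrow> W (x /\<^sub>R \<delta>) z \<ge> 1 / R * norm z" .
  have "?T = ennreal (R * \<epsilon>) * (ennreal (1 / (R * \<epsilon>)) * ?T)"
    using R(1) eps by (simp add: mult.assoc[symmetric] ennreal_mult[symmetric])
  also have "ennreal (1 / (R * \<epsilon>)) * ?T = (\<integral>\<^sup>+x\<in>\<Omega>. ennreal (1 / (R * \<epsilon>) * (norm (f x) - R)) \<partial>lborel)"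
  proof (subst nn_integral_cmult[symmetric], measurable, intro nn_integral_cong)
    fix x
    have "ennreal (1 / (R * \<epsilon>) * (norm (f x) - R)) = ennreal (1 / (R * \<epsilon>)) * ennreal (norm (f x) - R)"
      using R(1) eps by (intro ennreal_mult') auto
    then show "ennreal (1 / (R * \<epsilon>)) * (ennreal (norm (f x) - R) * indicator \<Omega> x) = ennreal (1 / (R * \<epsilon>) * (norm (f x) - R)) * indicator \<Omega> x"
      by (simp only: mult.assoc)
  qed
  also have "\<dots> \<le> (\<integral>\<^sup>+x\<in>\<Omega>. ennreal (1 / \<epsilon> * W (x /\<^sub>R \<delta>) (f x)) \<partial>lborel)"
  proof (rule nn_integral_mono_AE)
    show "AE x in lborel. ennreal (1 / (R * \<epsilon>) * (norm (f x) - R)) * indicator \<Omega> x \<le> ennreal (1 / \<epsilon> * W (x /\<^sub>R \<delta>) (f x)) * indicator \<Omega> x"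
      using growth
    proof eventually_elim
      case (elim x)
      have "1 / (R * \<epsilon>) * (norm (f x) - R) \<le> 1 / \<epsilon> * W (x /\<^sub>R \<delta>) (f x)"
      proof (cases "norm (f x) \<ge> R")
        case True
        have "1 / R * (norm (f x) - R) \<le> 1 / R * norm (f x)" using R(1) by (intro mult_left_mono) auto
        also have "\<dots> \<le> W (x /\<^sub>R \<delta>) (f x)" using elim True by blast
        finally have "1 / \<epsilon> * (1 / R * (norm (f x) - R)) \<le> 1 / \<epsilon> * W (x /\<^sub>R \<delta>) (f x)"
          using eps by (intro mult_left_mono) auto
        then show ?thesis by (simp add: mult.commute)
      next
        case False
        then have "1 / (R * \<epsilon>) * (norm (f x) - R) \<le> 0" using R(1) eps by (intro mult_nonneg_nonpos) auto
        also have "0 \<le> 1 / \<epsilon> * W (x /\<^sub>R \<delta>) (f x)" using eps nonneg by simp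
        finally show ?thesis .
      qed
      then show ?case by (intro mult_right_mono ennreal_leI) auto
    qed
  qed
  also note pot
  also have "ennreal (R * \<epsilon>) * ennreal E = ennreal (R * E * \<epsilon>)"
    using R(1) eps E by (simp add: ennreal_mult[symmetric] mult_ac)
  finally show ?thesis by (simp add: mult_left_mono)
qed

text \<open>The compact quantity is the cutoff of \<open>f n\<close>, not \<open>f n\<close> itself.
  Off a small set \<open>f n\<close> is near a well and the limit of the cutoffs tells which one; on
  the rest the tail bound controls the size of \<open>f n\<close>.\<close>

lemma phase_sequence_compact:
  fixes f :: "nat \<Rightarrow> real^'n::finite \<Rightarrow> real^'m::finite"
  assumes Om: "open \<Omega>" "bounded \<Omega>" and f[measurable]: "\<And>n. f n \<in> borel_measurable borel"
    and E: "E \<ge> 0" and R: "R > 0" and eps: "\<And>n. \<epsilon> n > 0" "\<epsilon> \<longlonglongrightarrow> 0"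
    and trans: "\<And>n. translation_L2_bound \<Omega> (f n) (E / \<epsilon> n)"
    and off: "\<And>s. s > 0 \<Longrightarrow> \<exists>C\<ge>0. \<forall>t>0. \<exists>n0. \<forall>n\<ge>n0.
      emeasure lborel {x \<in> inner_part \<Omega> t. f n x \<in> off_wells a b s} \<le> ennreal (C * \<epsilon> n)"
    and tail: "\<And>n. (\<integral>\<^sup>+x\<in>\<Omega>. ennreal (norm (f n x) - R) \<partial>lborel) \<le> ennreal (R * E * \<epsilon> n)"
  obtains v and k :: "nat \<Rightarrow> nat" where "v \<in> borel_measurable borel" "\<And>x. v x \<in> {a, b}" "strict_mono k"
    "finite_perimeter {x \<in> \<Omega>. v x = a} \<Omega>"
    "(\<lambda>n. \<integral>\<^sup>+x\<in>\<Omega>. ennreal (norm (f (k n) x - v x)) \<partial>lborel) \<longlonglongrightarrow> 0"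
proof -
  have [measurable]: "\<Omega> \<in> sets borel" "\<And>t. inner_part \<Omega> t \<in> sets borel"
    using Om borel_inner_part by auto
  have fin: "emeasure lborel \<Omega> < \<infinity>" by (rule emeasure_bounded_finite[OF Om(2)])
  define \<mu> where "\<mu> = measure lborel \<Omega>"
  have \<mu>: "emeasure lborel \<Omega> = ennreal \<mu>" "\<mu> \<ge> 0"
    using fin by (auto simp: \<mu>_def intro!: emeasure_eq_ennreal_measure)
  \<comment> \<open>The quarter distance separates the wells as required; if they coincide, any
    positive radius will do.\<close>
  define r where "r = (if a = b then 1 else norm (a - b) / 4)"
  have r: "r > 0" "a = b \<or> 4 * r \<le> norm (a - b)" by (auto simp: r_def)
  obtain C1 where C1: "C1 \<ge> 0" "\<And>t. t > 0 \<Longrightarrow> \<exists>n0. \<forall>n\<ge>n0.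
      emeasure lborel {x \<in> inner_part \<Omega> t. f n x \<in> off_wells a b (r/2)} \<le> ennreal (C1 * \<epsilon> n)"
    using off[of "r/2"] r by auto
  define C where "C = (C1 + E) / (2 * r) + 2 * E / r\<^sup>2"
  have C: "C \<ge> 0" using C1 E r by (simp add: C_def)
  \<comment> \<open>The indicator provides the support condition of
    \<open>translation_compactness\<close>, since the cutoff of \<open>f n\<close> need not vanish
    outside \<open>\<Omega>\<close>. Translations by at most \<open>t/2\<close> from
    \<open>inner_part \<Omega> t\<close> do not notice it.\<close>
  define w where "w n x = indicator \<Omega> x * phase r a (f n x)" for n x
  have w_meas [measurable]: "w n \<in> borel_measurable borel" for n unfolding w_def[abs_def] by measurable
  have w_eq: "w n x = phase r a (f n x)" if "x \<in> \<Omega>" for n x using that by (simp add: w_def)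
  have inner_mem: "x \<in> \<Omega>" "x + h \<in> \<Omega>" if "x \<in> inner_part \<Omega> t" "norm h \<le> t/2" "t > 0" for x h t
  proof -
    show "x \<in> \<Omega>" using that inner_part_subset[of t \<Omega>] by auto
    have "x + h \<in> inner_part \<Omega> 0" using that by (intro inner_part_add[OF that(1)]) auto
    then show "x + h \<in> \<Omega>" using inner_part_subset[of 0 \<Omega>] by auto
  qed
  have w_trans: "\<exists>n0. \<forall>n\<ge>n0. \<forall>h. norm h \<le> t/2 \<longrightarrow>
      (\<integral>\<^sup>+x\<in>inner_part \<Omega> t. ennreal \<bar>w n (x + h) - w n x\<bar> \<partial>lborel) \<le> ennreal (C * norm h)" if t: "t > 0" for t
  proof -
    obtain n0 where n0: "\<And>n. n \<ge> n0 \<Longrightarrow> emeasure lborel {x \<in> inner_part \<Omega> (t/2). f n x \<in> off_wells a b (r/2)} \<le> ennreal (C1 * \<epsilon> n)"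
      using C1(2)[of "t/2"] t by auto
    show ?thesis
    proof (intro exI[of _ n0] allI impI)
      fix n and h :: "real^'n" assume n: "n0 \<le> n" and h: "norm h \<le> t/2"
      have "(\<integral>\<^sup>+x\<in>inner_part \<Omega> t. ennreal \<bar>w n (x + h) - w n x\<bar> \<partial>lborel)
        = (\<integral>\<^sup>+x\<in>inner_part \<Omega> t. ennreal \<bar>phase r a (f n (x + h)) - phase r a (f n x)\<bar> \<partial>lborel)"
        using inner_mem[OF _ h t] by (intro nn_integral_cong) (auto simp: indicator_def w_eq)
      also have "\<dots> \<le> ennreal (norm h * C)"
        unfolding C_def by (rule phase_translation_bound[OF r eps(1) Om(1) f C1(1) E trans n0[OF n] h])
      finally show "(\<integral>\<^sup>+x\<in>inner_part \<Omega> t. ennreal \<bar>w n (x + h) - w n x\<bar> \<partial>lborel) \<le> ennreal (C * norm h)"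
        by (simp add: mult.commute)
    qed
  qed
  have w_bd: "0 \<le> w n x" "w n x \<le> 1" and w_supp: "x \<notin> \<Omega> \<Longrightarrow> w n x = 0" for n x
    using phase_bounds[of r a "f n x"] by (auto simp: w_def indicator_def)
  obtain k :: "nat \<Rightarrow> nat" and p where k: "strict_mono k" and p: "integrable lborel p" "\<And>x. x \<notin> \<Omega> \<Longrightarrow> p x = 0"
    and wp': "(\<lambda>n. LINT x|lborel. \<bar>w (k n) x - p x\<bar>) \<longlonglongrightarrow> 0"
    by (rule translation_compactness[OF Om w_meas w_bd w_supp C w_trans]) (assumption | rule that)+
  define q where "q n = (LINT x|lborel. \<bar>w (k n) x - p x\<bar>)" for n
  have q: "q \<longlonglongrightarrow> 0" "\<And>n. 0 \<le> q n" using wp' by (simp_all add: q_def[abs_def])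
  have [measurable]: "p \<in> borel_measurable borel" using p(1) by auto
  have int_w: "integrable lborel (w n)" for n
  proof (rule Bochner_Integration.integrable_bound[of _ "indicat_real \<Omega>"])
    show "integrable lborel (indicat_real \<Omega>)" using fin by (intro integrable_real_indicator) auto
  qed (use w_bd w_supp in \<open>auto simp: indicator_def\<close>)
  let ?t = "\<lambda>n x. ennreal (norm (f (k n) x) - R)"
  \<comment> \<open>The limit \<open>p\<close> is not known to take only the values 0 and 1; the
    threshold yields a function with values in the wells at every point.\<close>
  define v where "v x = (if p x > 1/2 then a else b)" for x
  have v_meas [measurable]: "v \<in> borel_measurable borel" unfolding v_def[abs_def] by measurable
  have v_ab: "v x \<in> {a, b}" for x by (simp add: v_def)
  define M where "M = R + (norm a + norm b)"
  have M: "M > 0" using R by (simp add: M_def add_pos_nonneg)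
  define d where "d n = (\<integral>\<^sup>+x\<in>\<Omega>. ennreal (norm (f (k n) x - v x)) \<partial>lborel)" for n
  have \<epsilon>k: "(\<lambda>n. \<epsilon> (k n)) \<longlonglongrightarrow> 0" using LIMSEQ_subseq_LIMSEQ[OF eps(2) k] by (simp add: o_def)
  have d_le: "eventually (\<lambda>n. d n \<le> ennreal e) sequentially" if e: "e > 0" for e
  proof -
    \<comment> \<open>Distance \<open>s\<close> on all of \<open>\<Omega>\<close> contributes at
      most \<open>e/5\<close>; \<open>\<mu> + 1\<close> avoids division by zero, and
      \<open>s \<le> r\<close> keeps the neighbourhoods where the cutoff is constant.\<close>
    define s where "s = min r (e / (5 * (\<mu> + 1)))"
    have s: "s > 0" "s \<le> r" using r e \<mu> by (auto simp: s_def)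
    have s\<mu>: "s * \<mu> \<le> e/5"
    proof -
      have "s * \<mu> \<le> e / (5 * (\<mu> + 1)) * (\<mu> + 1)" using \<mu> s e by (intro mult_mono) (auto simp: s_def)
      also have "\<dots> = e/5" using \<mu> by (simp add: field_simps)
      finally show ?thesis .
    qed
    obtain t where t: "t > 0" "emeasure lborel (\<Omega> - inner_part \<Omega> t) < ennreal (e / (5 * M))"
      using inner_part_exhausts[OF Om(1) fin, of "e / (5 * M)"] e M by auto
    obtain C2 where C2_nn: "C2 \<ge> 0" and C2': "\<forall>t>0. \<exists>n0. \<forall>n\<ge>n0.
      emeasure lborel {x \<in> inner_part \<Omega> t. f n x \<in> off_wells a b s} \<le> ennreal (C2 * \<epsilon> n)"
      using off[OF s(1)] by blast
    from C2'[rule_format, OF t(1)] obtain n0 where n0: "\<forall>n\<ge>n0.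
      emeasure lborel {x \<in> inner_part \<Omega> t. f n x \<in> off_wells a b s} \<le> ennreal (C2 * \<epsilon> n)" ..
    note C2 = C2_nn n0[rule_format]
    have e1: "eventually (\<lambda>n. R * E * \<epsilon> (k n) < e/5) sequentially"
      using tendsto_mult_right_zero[OF \<epsilon>k, of "R * E"] by (rule order_tendstoD) (use e in simp)
    have e2: "eventually (\<lambda>n. M * C2 * \<epsilon> (k n) < e/5) sequentially"
      using tendsto_mult_right_zero[OF \<epsilon>k, of "M * C2"] by (rule order_tendstoD) (use e in simp)
    have e3: "eventually (\<lambda>n. M * 2 * q n < e/5) sequentially"
      using tendsto_mult_right_zero[OF q(1), of "M * 2"] by (rule order_tendstoD) (use e in simp)
    show ?thesis
      using e1 e2 e3 eventually_ge_at_top[of n0]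
    proof eventually_elim
      case (elim n)
      have kn: "k n \<ge> n0" using seq_suble[OF k, of n] elim(4) by linarith
      let ?I = "inner_part \<Omega> t"
      define Y where "Y = {x \<in> ?I. f (k n) x \<in> off_wells a b s}"
      have [measurable]: "Y \<in> sets borel" unfolding Y_def by measurable
      \<comment> \<open>Good points lie in the inner part, have a value near a well and satisfy
        \<open>\<bar>w (k n) x - p x\<bar> < 1/2\<close>; there \<open>v\<close> selects the well
        that \<open>f\<close> is close to. Elsewhere the difference is at most the tail plus
        \<open>M\<close>, and the bracket multiplying \<open>M\<close> is at least 1.\<close>
      have pt: "ennreal (norm (f (k n) x - v x)) * indicator \<Omega> x \<le> ennreal s * indicator \<Omega> x
        + (?t n x * indicator \<Omega> x
        + ennreal M * (indicator (\<Omega> - ?I) x + (indicator Y x + ennreal (2 * \<bar>w (k n) x - p x\<bar>))))" for x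
      proof (cases "x \<in> \<Omega>")
        case xO: True
        show ?thesis
        proof (cases "x \<in> ?I \<and> x \<notin> Y \<and> \<bar>w (k n) x - p x\<bar> < 1/2")
          case True
          then have "f (k n) x \<notin> off_wells a b s" by (auto simp: Y_def)
          then consider "norm (f (k n) x - a) < s" | "a \<noteq> b" "norm (f (k n) x - b) < s"
            by (cases "a = b") (auto simp: off_wells_def not_le)
          then have "norm (f (k n) x - v x) < s"
          proof cases
            case 1
            then have "phase r a (f (k n) x) = 1" using r(1) s(2) by (intro phase_eq_1) auto
            then have "w (k n) x = 1" using w_eq[OF xO, of "k n"] by simp
            then have "p x > 1/2" using True by linarith
            then show ?thesis using 1 by (simp add: v_def)
          next
            case 2
            have "norm (a - b) \<le> norm (f (k n) x - a) + norm (f (k n) x - b)"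
              using norm_triangle_ineq[of "a - f (k n) x" "f (k n) x - b"] by (simp add: norm_minus_commute)
            then have "2 * r \<le> norm (f (k n) x - a)" using 2 r s(2) by auto
            then have "phase r a (f (k n) x) = 0" using r(1) by (intro phase_eq_0)
            then have "w (k n) x = 0" using w_eq[OF xO, of "k n"] by simp
            then have "\<not> p x > 1/2" using True by linarith
            then show ?thesis using 2 by (simp add: v_def)
          qed
          then have "ennreal (norm (f (k n) x - v x)) \<le> ennreal s" by (intro ennreal_leI) simp
          then show ?thesis using xO by (simp add: add_increasing2)
        next
          case False
          have "1 \<le> indicator (\<Omega> - ?I) x + (indicator Y x + ennreal (2 * \<bar>w (k n) x - p x\<bar>))"
          proof -
            consider "x \<notin> ?I" | "x \<in> Y" | "1/2 \<le> \<bar>w (k n) x - p x\<bar>" using False by force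
            then show ?thesis
            proof cases
              case 3
              then have "ennreal 1 \<le> ennreal (2 * \<bar>w (k n) x - p x\<bar>)" by (intro ennreal_leI) simp
              then show ?thesis by (simp add: add_increasing)
            qed (use xO in \<open>auto simp: add_increasing add_increasing2\<close>)
          qed
          then have M1: "ennreal M \<le> ennreal M * (indicator (\<Omega> - ?I) x + (indicator Y x + ennreal (2 * \<bar>w (k n) x - p x\<bar>)))"
            using mult_left_mono[of 1 _ "ennreal M"] by simp
          have "norm (v x) \<le> norm a + norm b" by (simp add: v_def)
          then have "norm (f (k n) x - v x) \<le> max 0 (norm (f (k n) x) - R) + M"
            using norm_triangle_ineq4[of "f (k n) x" "v x"] by (simp add: M_def)
          then have "ennreal (norm (f (k n) x - v x)) \<le> ennreal (max 0 (norm (f (k n) x) - R) + M)" by (rule ennreal_leI)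
          also have "\<dots> = ennreal (max 0 (norm (f (k n) x) - R)) + ennreal M" using M by (intro ennreal_plus) auto
          also have "ennreal (max 0 (norm (f (k n) x) - R)) = ?t n x"
            by (auto simp: max_def ennreal_neg)
          also have "?t n x + ennreal M \<le> ?t n x +
              ennreal M * (indicator (\<Omega> - ?I) x + (indicator Y x + ennreal (2 * \<bar>w (k n) x - p x\<bar>)))"
            using M1 by (intro add_left_mono)
          finally show ?thesis using xO by (simp add: add_increasing)
        qed
      qed simp
      have "d n \<le> (\<integral>\<^sup>+x. ennreal s * indicator \<Omega> x
        + (?t n x * indicator \<Omega> x
        + ennreal M * (indicator (\<Omega> - ?I) x + (indicator Y x + ennreal (2 * \<bar>w (k n) x - p x\<bar>)))) \<partial>lborel)"
        unfolding d_def by (intro nn_integral_mono pt)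
      also have "\<dots> = ennreal s * emeasure lborel \<Omega> + ((\<integral>\<^sup>+x\<in>\<Omega>. ?t n x \<partial>lborel)
        + ennreal M * (emeasure lborel (\<Omega> - ?I) + (emeasure lborel Y + (\<integral>\<^sup>+x. ennreal (2 * \<bar>w (k n) x - p x\<bar>) \<partial>lborel))))"
        by (simp add: nn_integral_add nn_integral_cmult)
      also have "(\<integral>\<^sup>+x. ennreal (2 * \<bar>w (k n) x - p x\<bar>) \<partial>lborel) = ennreal (2 * q n)"
      proof -
        have "integrable lborel (\<lambda>x. 2 * \<bar>w (k n) x - p x\<bar>)"
          by (intro integrable_mult_right integrable_abs Bochner_Integration.integrable_diff int_w p(1))
        then show ?thesis by (subst nn_integral_eq_integral) (auto simp: q_def)
      qed
      also have "ennreal s * emeasure lborel \<Omega> + ((\<integral>\<^sup>+x\<in>\<Omega>. ?t n x \<partial>lborel)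
        + ennreal M * (emeasure lborel (\<Omega> - ?I) + (emeasure lborel Y + ennreal (2 * q n))))
        \<le> ennreal s * ennreal \<mu> + (ennreal (R * E * \<epsilon> (k n))
        + ennreal M * (ennreal (e / (5 * M)) + (ennreal (C2 * \<epsilon> (k n)) + ennreal (2 * q n))))"
        unfolding \<mu>(1) using tail[of "k n"] t(2) C2(2)[OF kn] by (intro add_mono mult_left_mono) (auto simp: Y_def)
      also have "\<dots> = ennreal (s * \<mu> + (R * E * \<epsilon> (k n) + M * (e / (5 * M) + (C2 * \<epsilon> (k n) + 2 * q n))))"
      proof -
        have nn: "0 \<le> s" "0 \<le> \<mu>" "0 \<le> R * E * \<epsilon> (k n)" "0 \<le> M" "0 \<le> e / (5 * M)" "0 \<le> C2 * \<epsilon> (k n)"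
          "0 \<le> 2 * q n"
          using q(2) s \<mu> R E eps(1)[of "k n"] M e C2(1) by (auto simp: less_imp_le)
        then show ?thesis
          by (simp only: ennreal_mult[symmetric] ennreal_plus[symmetric] add_nonneg_nonneg mult_nonneg_nonneg)
      qed
      also have "\<dots> \<le> ennreal e"
      proof (rule ennreal_leI)
        have "M * (e / (5 * M) + (C2 * \<epsilon> (k n) + 2 * q n))
          = e/5 + (M * C2 * \<epsilon> (k n) + M * 2 * q n)"
          using M by (simp add: distrib_left)
        then show "s * \<mu> + (R * E * \<epsilon> (k n) + M * (e / (5 * M) + (C2 * \<epsilon> (k n) + 2 * q n))) \<le> e"
          using s\<mu> elim by linarith
      qed
      finally show "d n \<le> ennreal e" .
    qed
  qed
  have d_lim: "d \<longlonglongrightarrow> 0"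
  proof (rule order_tendstoI)
    fix y :: ennreal assume "0 < y"
    then obtain z where z: "0 < z" "z < y" using dense by blast
    obtain e where e: "e > 0" "z = ennreal e" using z by (cases z) auto
    show "eventually (\<lambda>n. d n < y) sequentially"
      using d_le[OF e(1)] by eventually_elim (use z e in auto)
  qed simp
  define F where "F = {x \<in> \<Omega>. v x = a}"
  have F_meas [measurable]: "F \<in> sets borel" unfolding F_def by measurable
  \<comment> \<open>The cutoff takes the values 1 and 0 at two distinct wells, so it recovers the
    indicator of the phase from \<open>v\<close>.\<close>
  have F_ind: "indicator F x = phase r a (v x)" if "x \<in> \<Omega>" for x
  proof (cases "v x = a")
    case True
    then show ?thesis using that phase_eq_1[of r a a] r(1) by (simp add: F_def)
  next
    case False
    then have vb: "v x = b" "a \<noteq> b" using v_ab[of x] by auto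
    then have "phase r a b = 0" using r by (intro phase_eq_0) (auto simp: norm_minus_commute)
    then show ?thesis using False vb by (simp add: F_def)
  qed
  have "finite_perimeter F \<Omega>"
  proof (rule finite_perimeter_translation[OF Om F_meas _ C])
    fix t :: real and h :: "real^'n" assume t: "t > 0" and h: "norm h \<le> t/2"
    obtain n0 where n0: "\<And>n. n \<ge> n0 \<Longrightarrow>
      (\<integral>\<^sup>+x\<in>inner_part \<Omega> t. ennreal \<bar>w n (x + h) - w n x\<bar> \<partial>lborel) \<le> ennreal (C * norm h)"
      using w_trans[OF t] h by blast
    let ?I = "inner_part \<Omega> t" and ?F = "\<lambda>x. \<bar>indicator F (x + h) - indicator F x\<bar> :: real" and ?w = "\<lambda>n x. \<bar>w (k n) (x + h) - w (k n) x\<bar>"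
    show "(\<integral>\<^sup>+x\<in>?I. ennreal (?F x) \<partial>lborel) \<le> ennreal (C * norm h)"
    proof (rule ennreal_le_epsilon)
      fix e :: real assume e: "0 < e"
      \<comment> \<open>The cutoff has Lipschitz constant \<open>1/r\<close> and the error occurs at
        \<open>x\<close> and at \<open>x + h\<close>: two errors of \<open>e * r / 2\<close> sum to
        \<open>e\<close>.\<close>
      then have "eventually (\<lambda>n. d n \<le> ennreal (e * r / 2) \<and> n \<ge> n0) sequentially"
        using d_le[of "e * r / 2"] r(1) by (intro eventually_conj eventually_ge_at_top) auto
      then obtain n where n: "d n \<le> ennreal (e * r / 2)" "n \<ge> n0" by (auto simp: eventually_sequentially)
      have kn: "k n \<ge> n0" using seq_suble[OF k, of n] n(2) by linarith
      define D where "D x = ennreal (norm (f (k n) x - v x)) * indicator \<Omega> x" for x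
      have [measurable]: "D \<in> borel_measurable borel" unfolding D_def[abs_def] by measurable
      have pt: "ennreal (?F x) * indicator ?I x \<le>
          ennreal (?w n x) * indicator ?I x + (ennreal (1/r) * D (x + h) + ennreal (1/r) * D x)" for x
      proof (cases "x \<in> ?I")
        case True
        note m = inner_mem[OF True h t]
        have "?F x \<le> ?w n x
          + (1/r * norm (f (k n) (x + h) - v (x + h)) + 1/r * norm (f (k n) x - v x))"
          using phase_lipschitz[OF r(1), of a "f (k n) (x + h)" "v (x + h)"] phase_lipschitz[OF r(1), of a "f (k n) x" "v x"]
          unfolding F_ind[OF m(1)] F_ind[OF m(2)] w_eq[OF m(1)] w_eq[OF m(2)] by simp
        then have "ennreal (?F x) \<le> ennreal (?w n x
          + (1/r * norm (f (k n) (x + h) - v (x + h)) + 1/r * norm (f (k n) x - v x)))" by (rule ennreal_leI)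
        also have "\<dots> = ennreal (?w n x)
          + (ennreal (1/r) * ennreal (norm (f (k n) (x + h) - v (x + h))) + ennreal (1/r) * ennreal (norm (f (k n) x - v x)))"
          using r(1) by (subst ennreal_mult_plus_mult) auto
        finally show ?thesis using True m by (simp add: D_def)
      qed simp
      have "(\<integral>\<^sup>+x\<in>?I. ennreal (?F x) \<partial>lborel) \<le>
        (\<integral>\<^sup>+x. ennreal (?w n x) * indicator ?I x + (ennreal (1/r) * D (x + h) + ennreal (1/r) * D x) \<partial>lborel)"
        by (intro nn_integral_mono pt)
      also have "\<dots> = (\<integral>\<^sup>+x\<in>?I. ennreal (?w n x) \<partial>lborel)
        + (ennreal (1/r) * (\<integral>\<^sup>+x. D (x + h) \<partial>lborel) + ennreal (1/r) * (\<integral>\<^sup>+x. D x \<partial>lborel))"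
        by (simp add: nn_integral_add nn_integral_cmult)
      also have "(\<integral>\<^sup>+x. D (x + h) \<partial>lborel) = (\<integral>\<^sup>+x. D x \<partial>lborel)" by (rule nn_integral_lborel_translate) measurable
      also have "(\<integral>\<^sup>+x. D x \<partial>lborel) = d n" unfolding D_def d_def ..
      also have "(\<integral>\<^sup>+x\<in>?I. ennreal (?w n x) \<partial>lborel) + (ennreal (1/r) * d n + ennreal (1/r) * d n)
        \<le> ennreal (C * norm h) + (ennreal (1/r) * ennreal (e * r / 2) + ennreal (1/r) * ennreal (e * r / 2))"
        using n0[OF kn] n(1) by (intro add_mono mult_left_mono) auto
      also have "ennreal (1/r) * ennreal (e * r / 2) + ennreal (1/r) * ennreal (e * r / 2) = ennreal e"
        using e r(1) by (subst ennreal_mult_plus_mult) auto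
      finally show "(\<integral>\<^sup>+x\<in>?I. ennreal (?F x) \<partial>lborel) \<le> ennreal (C * norm h) + ennreal e" .
    qed
  qed (auto simp: F_def)
  then show thesis using d_lim unfolding F_def d_def[abs_def] by (rule that[OF v_meas v_ab k])
qed

theorem theorem1p6:
  fixes \<Omega> :: "(real^'n::finite) set"
    and W :: "real^'n \<Rightarrow> real^'m::finite \<Rightarrow> real"
    and a b :: "real^'m"
    and \<epsilon> \<delta> :: "nat \<Rightarrow> real"
    and u :: "nat \<Rightarrow> real^'n \<Rightarrow> real^'m"
  assumes Omega: "open \<Omega>" "bounded \<Omega>"
    and W_measurable: "(\<lambda>(x, z). W x z) \<in> borel_measurable lebesgue"
    and W_nonneg: "\<And>x z. 0 \<le> W x z"
    and W1: "AE x in lebesgue_on unit_cube. continuous_on UNIV (W x)"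
            "\<And>z. (\<lambda>x. W x z) \<in> borel_measurable lebesgue"
            "\<And>z. cube_periodic (\<lambda>x. W x z)"
    and W2: "\<And>x z. W x z = 0 \<longleftrightarrow> z \<in> {a, b}"
    and W3: "\<exists>R>0. AE x in lebesgue_on unit_cube. \<forall>z. norm z \<ge> R \<longrightarrow> W x z \<ge> 1 / R * norm z"
    and W4: "\<And>K::real. K > 0 \<Longrightarrow> \<exists>C>0.
               esssup (lebesgue_on (unit_cube \<times> {z. norm z \<le> K})) (\<lambda>(x, z). ereal (W x z)) \<le> ereal C"
    and eps: "\<And>n. \<epsilon> n > 0" "\<epsilon> \<longlonglongrightarrow> 0"
    and delta: "\<And>n. \<delta> n > 0" "\<delta> \<longlonglongrightarrow> 0"
    and ratio: "(\<lambda>n. \<delta> n / \<epsilon> n) \<longlonglongrightarrow> 0"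
    and u_L1: "\<And>n. u n \<in> L1_space \<Omega>"
    and bounded_energy: "(SUP n. energy W \<Omega> (\<epsilon> n) (\<delta> n) (u n)) < \<infinity>"
  shows "\<exists>v \<in> BV_two_phase \<Omega> a b. \<exists>r. strict_mono r \<and>
           (\<lambda>k. LINT x|lebesgue_on \<Omega>. norm (u (r k) x - v x)) \<longlonglongrightarrow> 0"
proof -
  have OmB [measurable]: "\<Omega> \<in> sets borel" using Omega by simp
  obtain R where R: "R > 0" "AE x in lebesgue_on unit_cube. \<forall>z. norm z \<ge> R \<longrightarrow> W x z \<ge> 1 / R * norm z"
    using W3 by blast
  obtain E where E: "E \<ge> 0" "(SUP n. energy W \<Omega> (\<epsilon> n) (\<delta> n) (u n)) = ennreal E"
    using bounded_energy by (cases "SUP n. energy W \<Omega> (\<epsilon> n) (\<delta> n) (u n)") auto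
  have energy_le: "energy W \<Omega> (\<epsilon> n) (\<delta> n) (u n) \<le> ennreal E" for n
    unfolding E(2)[symmetric] by (rule SUP_upper) simp
  \<comment> \<open>Bundling the properties in one predicate lets a single choice of
    \<open>f n\<close> satisfy all of them.\<close>
  define rep where "rep n f \<longleftrightarrow> f \<in> borel_measurable borel \<and> (AE x in lborel. x \<in> \<Omega> \<longrightarrow> f x = u n x) \<and>
    translation_L2_bound \<Omega> f (E / \<epsilon> n) \<and> (\<integral>\<^sup>+x\<in>\<Omega>. ennreal (1 / \<epsilon> n * W (x /\<^sub>R \<delta> n) (f x)) \<partial>lborel) \<le> ennreal E" for n f
  have "\<exists>f. rep n f" for n
    by (rule energy_representative[OF Omega eps(1)[of n] W_nonneg E(1) u_L1[of n] energy_le[of n]])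
      (auto simp: rep_def)
  then obtain f where "\<And>n. rep n (f n)" by metis
  then have f: "\<And>n. f n \<in> borel_measurable borel" "\<And>n. AE x in lborel. x \<in> \<Omega> \<longrightarrow> f n x = u n x"
    and trans: "\<And>n. translation_L2_bound \<Omega> (f n) (E / \<epsilon> n)"
    and pot: "\<And>n. (\<integral>\<^sup>+x\<in>\<Omega>. ennreal (1 / \<epsilon> n * W (x /\<^sub>R \<delta> n) (f n x)) \<partial>lborel) \<le> ennreal E"
    by (simp_all add: rep_def)
  obtain v and k :: "nat \<Rightarrow> nat" where v[measurable]: "v \<in> borel_measurable borel" and ab: "\<And>x. v x \<in> {a, b}"
    and k: "strict_mono k" and per: "finite_perimeter {x \<in> \<Omega>. v x = a} \<Omega>"
    and lim: "(\<lambda>n. \<integral>\<^sup>+x\<in>\<Omega>. ennreal (norm (f (k n) x - v x)) \<partial>lborel) \<longlonglongrightarrow> 0"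
    by (rule phase_sequence_compact[OF Omega f(1) E(1) R(1) eps trans
        off_wells_vanish[OF Omega(1) f(1) E(1) _ W1 W_nonneg W2 R eps(1) delta ratio trans pot]
        potential_tail_bound[OF OmB f(1) E(1) W1(3) W_nonneg R eps(1) delta(1) pot]]) (assumption | rule that)+
  have "v \<in> BV_two_phase \<Omega> a b"
  proof -
    have "integrable lborel (\<lambda>x. indicator \<Omega> x *\<^sub>R v x)"
    proof (rule Bochner_Integration.integrable_bound[of _ "\<lambda>x. (norm a + norm b) * indicat_real \<Omega> x"])
      show "integrable lborel (\<lambda>x. (norm a + norm b) * indicat_real \<Omega> x)"
        using emeasure_bounded_finite[OF Omega(2)] by (intro integrable_mult_right integrable_real_indicator) auto
      have "norm (v x) \<le> norm a + norm b" for x using ab[of x] by auto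
      then show "AE x in lborel. norm (indicat_real \<Omega> x *\<^sub>R v x) \<le> norm ((norm a + norm b) * indicat_real \<Omega> x)"
        by (auto simp: indicator_def)
    qed measurable
    then have "integrable lebesgue (\<lambda>x. indicator \<Omega> x *\<^sub>R v x)"
      by (subst integrable_completion) auto
    then have "v \<in> L1_space \<Omega>"
      unfolding L1_space_def mem_Collect_eq by (subst integrable_restrict_space) auto
    then show ?thesis using ab per by (auto simp: BV_two_phase_def)
  qed
  moreover have "(\<lambda>n. LINT x|lebesgue_on \<Omega>. norm (u (k n) x - v x)) \<longlonglongrightarrow> 0"
  proof -
    \<comment> \<open>The distance to \<open>u\<close> is computed with the representative, which
      differs on a null set; an upper bound is enough for convergence to 0.\<close>
    have le: "ennreal (LINT x|lebesgue_on \<Omega>. norm (u (k n) x - v x)) \<le> (\<integral>\<^sup>+x\<in>\<Omega>. ennreal (norm (f (k n) x - v x)) \<partial>lborel)" for n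
    proof -
      have "ennreal (LINT x|lebesgue_on \<Omega>. norm (u (k n) x - v x)) \<le> (\<integral>\<^sup>+x. ennreal (norm (u (k n) x - v x)) \<partial>lebesgue_on \<Omega>)"
        using ennreal_norm_integral_le[of "lebesgue_on \<Omega>" "\<lambda>x. norm (u (k n) x - v x)"] by simp
      also have "\<dots> = (\<integral>\<^sup>+x\<in>\<Omega>. ennreal (norm (f (k n) x - v x)) \<partial>lborel)"
        by (rule nn_integral_representative[OF OmB]) (use f(2)[of "k n"] in eventually_elim, auto)
      finally show ?thesis .
    qed
    have "(\<lambda>n. ennreal (LINT x|lebesgue_on \<Omega>. norm (u (k n) x - v x))) \<longlonglongrightarrow> 0"
      by (rule tendsto_sandwich[OF _ _ tendsto_const lim]) (use le in auto)
    then show ?thesis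
      by (subst (asm) ennreal_0[symmetric], subst (asm) tendsto_ennreal_iff) auto
  qed
  ultimately show ?thesis using k by blast
qed

end
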